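(* Every nearly cosymplectic (non-coKähler) $5$-dimensional manifold $(M,\phi,\xi,\eta,g)$ is Einstein with positive scalar curvature.
   Context: All manifolds are smooth and connected; $\nabla$ is the Levi-Civita connection of $g$. An almost contact metric structure $(\phi,\xi,\eta,g)$ on $M^{2n+1}$ consists of a $(1,1)$-tensor field $\phi$, a vector field $\xi$, a $1$-form $\eta$ and a Riemannian metric $g$ with $\phi^2=-I+\eta\otimes\xi$, $\eta(\xi)=1$, $g(\phi X,\phi Y)=g(X,Y)-\eta(X)\eta(Y)$. It is coKähler if $\nabla\phi=0$, and nearly cosymplectic if $(\nabla_X\phi)Y+(\nabla_Y\phi)X=0$ for all vector fields $X,Y$. *)

theory Defs
  imports "HOL-Analysis.Analysis"
begin

section \<open>Smooth maps between Euclidean spaces\<close>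

text \<open>Both notions are meant for open sets \<open>S\<close>.\<close>

primrec Ck_on :: "nat \<Rightarrow> 'a::real_normed_vector set \<Rightarrow> ('a \<Rightarrow> 'b::real_normed_vector) \<Rightarrow> bool" where
  "Ck_on 0 S f \<longleftrightarrow> continuous_on S f"
| "Ck_on (Suc k) S f \<longleftrightarrow>
     (\<forall>x\<in>S. f differentiable (at x)) \<and> (\<forall>v. Ck_on k S (\<lambda>x. frechet_derivative f (at x) v))"

definition smooth_on :: "'a::real_normed_vector set \<Rightarrow> ('a \<Rightarrow> 'b::real_normed_vector) \<Rightarrow> bool" where
  "smooth_on S f \<longleftrightarrow> (\<forall>k. Ck_on k S f)"

section \<open>Smooth manifolds\<close>

text \<open>The points of a manifold are the elements of a type that is Hausdorff and second countable;
  its smooth structure is given by an atlas. A chart is a pair of its domain and its coordinate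
  map; the latter is only meaningful on the domain.\<close>

type_synonym ('a, 'n) chart = "'a set \<times> ('a \<Rightarrow> real ^ 'n)"

definition chart_image :: "('a, 'n::finite) chart \<Rightarrow> (real ^ 'n) set" where
  "chart_image c = snd c ` fst c"

definition chart_inv :: "('a, 'n::finite) chart \<Rightarrow> real ^ 'n \<Rightarrow> 'a" where
  "chart_inv c = inv_into (fst c) (snd c)"

definition is_chart :: "('a::topological_space, 'n::finite) chart \<Rightarrow> bool" where
  "is_chart c \<longleftrightarrow> open (fst c) \<and> open (chart_image c) \<and>
     homeomorphism (fst c) (chart_image c) (snd c) (chart_inv c)"

definition transition :: "('a, 'n::finite) chart \<Rightarrow> ('a, 'n) chart \<Rightarrow> real ^ 'n \<Rightarrow> real ^ 'n" where
  "transition c d = snd d \<circ> chart_inv c"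

definition smooth_manifold ::
    "('a::{t2_space, second_countable_topology}, 'n::finite) chart set \<Rightarrow> bool" where
  "smooth_manifold A \<longleftrightarrow>
     (\<forall>c\<in>A. is_chart c) \<and> (\<Union>c\<in>A. fst c) = UNIV \<and>
     (\<forall>c\<in>A. \<forall>d\<in>A. smooth_on (snd c ` (fst c \<inter> fst d)) (transition c d))"

definition smooth_fun :: "('a, 'n::finite) chart set \<Rightarrow> ('a \<Rightarrow> real) \<Rightarrow> bool" where
  "smooth_fun A f \<longleftrightarrow> (\<forall>c\<in>A. smooth_on (chart_image c) (f \<circ> chart_inv c))"

section \<open>Vector fields\<close>

text \<open>At each point \<open>p\<close> one chart of the atlas around \<open>p\<close> is selected. The tangent space at \<open>p\<close> is
  \<open>real ^ 'n\<close>, where a vector stands for the tangent vector having these components in the chart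
  selected at \<open>p\<close>. The selected chart may jump from point to point, so fields are compared at
  different points only after transforming their components to one fixed chart \<open>c\<close>;
  \<open>vf_rep A c X\<close> is the resulting coordinate expression of \<open>X\<close> on the image of \<open>c\<close>.\<close>

definition chart_at :: "('a, 'n::finite) chart set \<Rightarrow> 'a \<Rightarrow> ('a, 'n) chart" where
  "chart_at A p = (SOME c. c \<in> A \<and> p \<in> fst c)"

definition vf_rep :: "('a, 'n::finite) chart set \<Rightarrow> ('a, 'n) chart \<Rightarrow>
    ('a \<Rightarrow> real ^ 'n) \<Rightarrow> real ^ 'n \<Rightarrow> real ^ 'n" where
  "vf_rep A c X x =
     (let p = chart_inv c x; d = chart_at A p
      in frechet_derivative (transition d c) (at (snd d p)) (X p))"

definition smooth_vf :: "('a, 'n::finite) chart set \<Rightarrow> ('a \<Rightarrow> real ^ 'n) \<Rightarrow> bool" where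
  "smooth_vf A X \<longleftrightarrow> (\<forall>c\<in>A. smooth_on (chart_image c) (vf_rep A c X))"

text \<open>The derivative \<open>X f\<close> of a function along a vector field.\<close>

definition vf_deriv :: "('a, 'n::finite) chart set \<Rightarrow> ('a \<Rightarrow> real ^ 'n) \<Rightarrow> ('a \<Rightarrow> real) \<Rightarrow> 'a \<Rightarrow> real" where
  "vf_deriv A X f p =
     (let c = chart_at A p in frechet_derivative (f \<circ> chart_inv c) (at (snd c p)) (X p))"

text \<open>In local coordinates the \<open>i\<close>-th component of \<open>[X, Y]\<close> is
  \<open>\<Sum>j. X j * \<partial>j (Y i) - Y j * \<partial>j (X i)\<close>.\<close>

definition lie_bracket :: "('a, 'n::finite) chart set \<Rightarrow>
    ('a \<Rightarrow> real ^ 'n) \<Rightarrow> ('a \<Rightarrow> real ^ 'n) \<Rightarrow> 'a \<Rightarrow> real ^ 'n" where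
  "lie_bracket A X Y p =
     (let c = chart_at A p
      in frechet_derivative (vf_rep A c Y) (at (snd c p)) (X p)
       - frechet_derivative (vf_rep A c X) (at (snd c p)) (Y p))"

section \<open>Tensor fields and Riemannian metrics\<close>

text \<open>Tensor fields are families of (multi)linear maps on the tangent spaces; they are smooth
  if they send smooth vector fields to smooth functions or smooth vector fields.\<close>

definition one_form :: "('a, 'n::finite) chart set \<Rightarrow> ('a \<Rightarrow> real ^ 'n \<Rightarrow> real) \<Rightarrow> bool" where
  "one_form A \<eta> \<longleftrightarrow> (\<forall>p. linear (\<eta> p)) \<and> (\<forall>X. smooth_vf A X \<longrightarrow> smooth_fun A (\<lambda>p. \<eta> p (X p)))"

definition tensor_1_1 :: "('a, 'n::finite) chart set \<Rightarrow> ('a \<Rightarrow> real ^ 'n \<Rightarrow> real ^ 'n) \<Rightarrow> bool" where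
  "tensor_1_1 A \<phi> \<longleftrightarrow> (\<forall>p. linear (\<phi> p)) \<and> (\<forall>X. smooth_vf A X \<longrightarrow> smooth_vf A (\<lambda>p. \<phi> p (X p)))"

definition riemannian_metric ::
    "('a, 'n::finite) chart set \<Rightarrow> ('a \<Rightarrow> real ^ 'n \<Rightarrow> real ^ 'n \<Rightarrow> real) \<Rightarrow> bool" where
  "riemannian_metric A g \<longleftrightarrow>
     (\<forall>p. bilinear (g p)) \<and>
     (\<forall>p u v. g p u v = g p v u) \<and>
     (\<forall>p u. u \<noteq> 0 \<longrightarrow> g p u u > 0) \<and>
     (\<forall>X Y. smooth_vf A X \<longrightarrow> smooth_vf A Y \<longrightarrow> smooth_fun A (\<lambda>p. g p (X p) (Y p)))"

section \<open>Connections and curvature\<close>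

text \<open>A connection \<open>D\<close> is an operator on vector fields, \<open>D X Y\<close> being the covariant derivative
  of \<open>Y\<close> along \<open>X\<close>; it is only meaningful on smooth vector fields.\<close>

type_synonym ('a, 'n) connection = "('a \<Rightarrow> real ^ 'n) \<Rightarrow> ('a \<Rightarrow> real ^ 'n) \<Rightarrow> 'a \<Rightarrow> real ^ 'n"

definition affine_connection :: "('a, 'n::finite) chart set \<Rightarrow> ('a, 'n) connection \<Rightarrow> bool" where
  "affine_connection A D \<longleftrightarrow>
     (\<forall>X Y. smooth_vf A X \<longrightarrow> smooth_vf A Y \<longrightarrow> smooth_vf A (D X Y)) \<and>
     (\<forall>X Y Z. smooth_vf A X \<longrightarrow> smooth_vf A Y \<longrightarrow> smooth_vf A Z \<longrightarrow>
        (\<forall>p. D (\<lambda>q. X q + Y q) Z p = D X Z p + D Y Z p) \<and>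
        (\<forall>p. D X (\<lambda>q. Y q + Z q) p = D X Y p + D X Z p)) \<and>
     (\<forall>f X Y. smooth_fun A f \<longrightarrow> smooth_vf A X \<longrightarrow> smooth_vf A Y \<longrightarrow>
        (\<forall>p. D (\<lambda>q. f q *\<^sub>R X q) Y p = f p *\<^sub>R D X Y p) \<and>
        (\<forall>p. D X (\<lambda>q. f q *\<^sub>R Y q) p = f p *\<^sub>R D X Y p + vf_deriv A X f p *\<^sub>R Y p))"

definition levi_civita :: "('a, 'n::finite) chart set \<Rightarrow>
    ('a \<Rightarrow> real ^ 'n \<Rightarrow> real ^ 'n \<Rightarrow> real) \<Rightarrow> ('a, 'n) connection \<Rightarrow> bool" where
  "levi_civita A g D \<longleftrightarrow>
     affine_connection A D \<and>
     (\<forall>X Y. smooth_vf A X \<longrightarrow> smooth_vf A Y \<longrightarrow>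
        (\<forall>p. D X Y p - D Y X p = lie_bracket A X Y p)) \<and>
     (\<forall>X Y Z. smooth_vf A X \<longrightarrow> smooth_vf A Y \<longrightarrow> smooth_vf A Z \<longrightarrow>
        (\<forall>p. vf_deriv A X (\<lambda>q. g q (Y q) (Z q)) p = g p (D X Y p) (Z p) + g p (Y p) (D X Z p)))"

definition curvature :: "('a, 'n::finite) chart set \<Rightarrow> ('a, 'n) connection \<Rightarrow>
    ('a \<Rightarrow> real ^ 'n) \<Rightarrow> ('a \<Rightarrow> real ^ 'n) \<Rightarrow> ('a \<Rightarrow> real ^ 'n) \<Rightarrow> 'a \<Rightarrow> real ^ 'n" where
  "curvature A D X Y Z p = D X (D Y Z) p - D Y (D X Z) p - D (lie_bracket A X Y) Z p"

text \<open>As the curvature is tensorial, its value on tangent vectors at \<open>p\<close> is computed from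
  arbitrary extensions to smooth vector fields.\<close>

definition vf_extension :: "('a, 'n::finite) chart set \<Rightarrow> 'a \<Rightarrow> real ^ 'n \<Rightarrow> 'a \<Rightarrow> real ^ 'n" where
  "vf_extension A p v = (SOME X. smooth_vf A X \<and> X p = v)"

definition curvature_at :: "('a, 'n::finite) chart set \<Rightarrow> ('a, 'n) connection \<Rightarrow>
    'a \<Rightarrow> real ^ 'n \<Rightarrow> real ^ 'n \<Rightarrow> real ^ 'n \<Rightarrow> real ^ 'n" where
  "curvature_at A D p u v w =
     curvature A D (vf_extension A p u) (vf_extension A p v) (vf_extension A p w) p"

definition ricci :: "('a, 'n::finite) chart set \<Rightarrow> ('a, 'n) connection \<Rightarrow>
    'a \<Rightarrow> real ^ 'n \<Rightarrow> real ^ 'n \<Rightarrow> real" where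
  "ricci A D p v w = trace (matrix (\<lambda>u. curvature_at A D p u v w))"

text \<open>The Gram matrix of a bilinear form with respect to the standard basis; the scalar curvature
  is the contraction of the Ricci tensor with the inverse metric.\<close>

definition gram :: "(real ^ 'n \<Rightarrow> real ^ 'n \<Rightarrow> real) \<Rightarrow> real ^ 'n ^ 'n" where
  "gram b = (\<chi> i j. b (axis i 1) (axis j 1))"

definition scalar_curvature :: "('a, 'n::finite) chart set \<Rightarrow>
    ('a \<Rightarrow> real ^ 'n \<Rightarrow> real ^ 'n \<Rightarrow> real) \<Rightarrow> ('a, 'n) connection \<Rightarrow> 'a \<Rightarrow> real" where
  "scalar_curvature A g D p = trace (matrix_inv (gram (g p)) ** gram (ricci A D p))"

definition einstein :: "('a, 'n::finite) chart set \<Rightarrow>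
    ('a \<Rightarrow> real ^ 'n \<Rightarrow> real ^ 'n \<Rightarrow> real) \<Rightarrow> ('a, 'n) connection \<Rightarrow> bool" where
  "einstein A g D \<longleftrightarrow> (\<exists>k. \<forall>p v w. ricci A D p v w = k * g p v w)"

section \<open>Almost contact metric structures\<close>

definition almost_contact_metric :: "('a, 'n::finite) chart set \<Rightarrow>
    ('a \<Rightarrow> real ^ 'n \<Rightarrow> real ^ 'n) \<Rightarrow> ('a \<Rightarrow> real ^ 'n) \<Rightarrow> ('a \<Rightarrow> real ^ 'n \<Rightarrow> real) \<Rightarrow>
    ('a \<Rightarrow> real ^ 'n \<Rightarrow> real ^ 'n \<Rightarrow> real) \<Rightarrow> bool" where
  "almost_contact_metric A \<phi> \<xi> \<eta> g \<longleftrightarrow>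
     tensor_1_1 A \<phi> \<and> smooth_vf A \<xi> \<and> one_form A \<eta> \<and> riemannian_metric A g \<and>
     (\<forall>p v. \<phi> p (\<phi> p v) = - v + \<eta> p v *\<^sub>R \<xi> p) \<and>
     (\<forall>p. \<eta> p (\<xi> p) = 1) \<and>
     (\<forall>p u v. g p (\<phi> p u) (\<phi> p v) = g p u v - \<eta> p u * \<eta> p v)"

definition cov_deriv_1_1 :: "('a, 'n::finite) connection \<Rightarrow> ('a \<Rightarrow> real ^ 'n \<Rightarrow> real ^ 'n) \<Rightarrow>
    ('a \<Rightarrow> real ^ 'n) \<Rightarrow> ('a \<Rightarrow> real ^ 'n) \<Rightarrow> 'a \<Rightarrow> real ^ 'n" where
  "cov_deriv_1_1 D \<phi> X Y p = D X (\<lambda>q. \<phi> q (Y q)) p - \<phi> p (D X Y p)"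

text \<open>The following two properties are those of an almost contact metric structure with tensor
  field \<open>\<phi>\<close> and Levi-Civita connection \<open>D\<close>.\<close>

definition coKaehler :: "('a, 'n::finite) chart set \<Rightarrow>
    ('a \<Rightarrow> real ^ 'n \<Rightarrow> real ^ 'n) \<Rightarrow> ('a, 'n) connection \<Rightarrow> bool" where
  "coKaehler A \<phi> D \<longleftrightarrow>
     (\<forall>X Y. smooth_vf A X \<longrightarrow> smooth_vf A Y \<longrightarrow> (\<forall>p. cov_deriv_1_1 D \<phi> X Y p = 0))"

definition nearly_cosymplectic :: "('a, 'n::finite) chart set \<Rightarrow>
    ('a \<Rightarrow> real ^ 'n \<Rightarrow> real ^ 'n) \<Rightarrow> ('a, 'n) connection \<Rightarrow> bool" where
  "nearly_cosymplectic A \<phi> D \<longleftrightarrow>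
     (\<forall>X Y. smooth_vf A X \<longrightarrow> smooth_vf A Y \<longrightarrow>
        (\<forall>p. cov_deriv_1_1 D \<phi> X Y p + cov_deriv_1_1 D \<phi> Y X p = 0))"

end

theory Submission
  imports Defs "HOL-Computational_Algebra.Polynomial"
begin

text \<open>
  Put \<open>h = \<nabla>\<xi>\<close>. Differentiating the structure equations shows that \<open>h\<close> is skew, anticommutes with \<open>\<phi>\<close>
  and kills \<open>\<xi>\<close>, and that \<open>g((\<nabla>\<^sub>X \<phi>)Y, Z)\<close> is a three-form. In dimension five this three-form vanishes on
  the four-dimensional space \<open>ker \<eta>\<close>, so that \<open>\<nabla>\<phi>\<close> is determined by \<open>h\<close>, and \<open>h\<^sup>2 = -\<lambda>\<^sup>2(I - \<eta> \<otimes> \<xi>)\<close>. As \<open>\<xi>\<close> is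
  a Killing field, \<open>R(X, \<xi>)Y = (\<nabla>\<^sub>X h)Y\<close>; comparing with the Ricci identity for \<open>\<phi>\<close> gives
  \<open>(\<nabla>\<^sub>X h)Y = g(h\<^sup>2X, Y)\<xi> - \<eta>(Y)h\<^sup>2X\<close>. Hence \<open>\<lambda>\<^sup>2\<close> is constant, and it is not zero because otherwise
  \<open>\<nabla>\<phi> = 0\<close>. The Ricci identities for \<open>\<phi>\<close> and \<open>h\<close> now say that the curvature differs from that of a sphere of
  curvature \<open>\<lambda>\<^sup>2\<close> by a tensor commuting with the quaternionic structure \<open>(\<phi>, h/\<lambda>, \<phi>h/\<lambda>)\<close> of \<open>ker \<eta>\<close>. Such a
  tensor is Ricci-flat by Bianchi's identity, so \<open>Ric = 4\<lambda>\<^sup>2 g\<close>.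
\<close>

section \<open>Smooth functions on Euclidean spaces\<close>

text \<open>On ker \<eta>, which \<phi> makes a complex vector space of dimension two, \<phi> can be
  moved between the arguments of the three-form. The form is therefore the real part of a complex
  three-form, and a complex plane carries none. The factor 4 in the Ricci tensor is the dimension
  minus one, as for a five-sphere. The obstacle is that a connection acts on global vector fields
  and that components refer to charts which jump from point to point, whereas the algebra lives in a
  single tangent space. Bump functions make vectors and coordinates global, tensoriality leads back
  to one point, and fields parallel at that point let every algebraic identity be differentiated
  without first-order terms. Each round of differentiation feeds a locale of pure linear algebra,
  whose conclusions hold at all points and so can be differentiated again. The number \<lambda>^2
  arises from a choice at each point, so its differentiability has to be established before its
  constancy.\<close>

lemma Ck_on_cong:
  assumes "open S" "\<And>x. x \<in> S \<Longrightarrow> f x = g x" "Ck_on k S f"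
  shows "Ck_on k S g"
  using assms(2,3)
proof (induction k arbitrary: f g)
  case 0
  then show ?case by (simp cong: continuous_on_cong)
next
  case (Suc k)
  have fd: "f differentiable (at x)" if "x \<in> S" for x
    using Suc.prems(2) that by simp
  have der: "frechet_derivative f (at x) = frechet_derivative g (at x)" if "x \<in> S" for x
    by (rule frechet_derivative_transform_within_open[OF fd[OF that] assms(1) that])
      (use Suc.prems(1) in auto)
  have gd: "g differentiable (at x)" if "x \<in> S" for x
    using fd[OF that] has_derivative_transform_within_open[OF _ assms(1) that] Suc.prems(1)
    unfolding differentiable_def by blast
  have "Ck_on k S (\<lambda>x. frechet_derivative g (at x) v)" for v
  proof (rule Suc.IH)
    show "frechet_derivative f (at x) v = frechet_derivative g (at x) v" if "x \<in> S" for x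
      using der[OF that] by simp
    show "Ck_on k S (\<lambda>x. frechet_derivative f (at x) v)"
      using Suc.prems(2) by simp
  qed
  then show ?case using gd by simp
qed

lemma Ck_on_subset: "Ck_on k S f \<Longrightarrow> T \<subseteq> S \<Longrightarrow> Ck_on k T f"
  by (induction k arbitrary: f) (auto intro: continuous_on_subset)

lemma Ck_on_SucD: "Ck_on (Suc k) S f \<Longrightarrow> Ck_on k S f"
proof (induction k arbitrary: f)
  case 0
  then show ?case
    by (auto intro!: continuous_at_imp_continuous_on differentiable_imp_continuous_within)
next
  case (Suc k)
  then show ?case by (metis Ck_on.simps(2))
qed

lemma Ck_on_SucI:
  assumes "open S" "\<And>x. x \<in> S \<Longrightarrow> (f has_derivative f' x) (at x)"
    and "\<And>v. Ck_on k S (\<lambda>x. f' x v)"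
  shows "Ck_on (Suc k) S f"
proof -
  have der: "frechet_derivative f (at x) = f' x" if "x \<in> S" for x
    using frechet_derivative_at[OF assms(2)[OF that]] by simp
  have "Ck_on k S (\<lambda>x. frechet_derivative f (at x) v)" for v
    by (rule Ck_on_cong[OF assms(1) _ assms(3)]) (simp add: der)
  moreover have "f differentiable (at x)" if "x \<in> S" for x
    using assms(2)[OF that] unfolding differentiable_def by blast
  ultimately show ?thesis by simp
qed

lemma Ck_on_has_derivative:
  "Ck_on (Suc k) S f \<Longrightarrow> x \<in> S \<Longrightarrow> (f has_derivative frechet_derivative f (at x)) (at x)"
  by (simp flip: frechet_derivative_works)

lemma Ck_on_local:
  assumes "\<And>x. x \<in> S \<Longrightarrow> \<exists>T. open T \<and> x \<in> T \<and> Ck_on k T f"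
  shows "Ck_on k S f"
  using assms
proof (induction k arbitrary: f)
  case 0
  have "isCont f x" if "x \<in> S" for x
    using 0[OF that] by (auto simp: continuous_on_eq_continuous_at)
  then show ?case by (simp add: continuous_at_imp_continuous_on)
next
  case (Suc k)
  have "f differentiable (at x)" if "x \<in> S" for x
    using Suc.prems[OF that] by auto
  moreover have "Ck_on k S (\<lambda>x. frechet_derivative f (at x) v)" for v
  proof (rule Suc.IH)
    show "\<exists>T. open T \<and> x \<in> T \<and> Ck_on k T (\<lambda>x. frechet_derivative f (at x) v)"
      if "x \<in> S" for x
      using Suc.prems[OF that] by auto
  qed
  ultimately show ?case by simp
qed

lemma Ck_on_const: "Ck_on k S (\<lambda>x. c)"
  by (induction k arbitrary: c) auto

lemma Ck_on_add:
  assumes "open S" "Ck_on k S f" "Ck_on k S g"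
  shows "Ck_on k S (\<lambda>x. f x + g x)"
  using assms(2,3)
proof (induction k arbitrary: f g)
  case 0
  then show ?case by (auto intro: continuous_intros)
next
  case (Suc k)
  show ?case
    by (rule Ck_on_SucI[OF assms(1) has_derivative_add[OF Ck_on_has_derivative[OF Suc.prems(1)]
              Ck_on_has_derivative[OF Suc.prems(2)]]])
      (use Suc in auto)
qed

lemma Ck_on_sum:
  assumes "open S" "\<And>i. i \<in> I \<Longrightarrow> Ck_on k S (f i)"
  shows "Ck_on k S (\<lambda>x. \<Sum>i\<in>I. f i x)"
  using assms(2)
  by (induction I rule: infinite_finite_induct) (auto intro: Ck_on_add[OF assms(1)] Ck_on_const)

lemma Ck_on_bounded_linear:
  assumes "open S" "bounded_linear L" "Ck_on k S f"
  shows "Ck_on k S (\<lambda>x. L (f x))"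
  using assms(3)
proof (induction k arbitrary: f)
  case 0
  then show ?case by (auto intro: bounded_linear.continuous_on[OF assms(2)])
next
  case (Suc k)
  show ?case
    by (rule Ck_on_SucI[OF assms(1) bounded_linear.has_derivative[OF assms(2)
              Ck_on_has_derivative[OF Suc.prems(1)]]])
      (use Suc in auto)
qed

lemma Ck_on_bounded_bilinear:
  assumes "open S" "bounded_bilinear B" "Ck_on k S f" "Ck_on k S g"
  shows "Ck_on k S (\<lambda>x. B (f x) (g x))"
  using assms(3,4)
proof (induction k arbitrary: f g)
  case 0
  then show ?case by (auto intro: bounded_bilinear.continuous_on[OF assms(2)])
next
  case (Suc k)
  have "Ck_on k S (\<lambda>x. frechet_derivative f (at x) v)" "Ck_on k S (\<lambda>x. frechet_derivative g (at x) v)" for v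
    using Suc.prems by simp_all
  note IH = Suc.IH[OF Ck_on_SucD[OF Suc.prems(1)] this(2)]
    Suc.IH[OF this(1) Ck_on_SucD[OF Suc.prems(2)]]
  show ?case
    by (rule Ck_on_SucI[OF assms(1) bounded_bilinear.FDERIV[OF assms(2)
              Ck_on_has_derivative[OF Suc.prems(1)] Ck_on_has_derivative[OF Suc.prems(2)]]],
        assumption, assumption, rule Ck_on_add[OF assms(1) IH])
qed

lemma Ck_on_ident: "open S \<Longrightarrow> Ck_on k S (\<lambda>x. x)"
  by (cases k) (auto intro: Ck_on_SucI[where f' = "\<lambda>x v. v"] Ck_on_const simp del: Ck_on.simps(2))

text \<open>In the chain rule the direction \<open>frechet_derivative g (at x) v\<close> varies with
  \<open>x\<close>, while \<open>Ck_on\<close> controls derivatives in fixed directions only.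
  Expanding the direction in \<open>Basis\<close> leaves a finite sum of products, which is why
  \<open>g\<close> takes values in a Euclidean space.\<close>

lemma Ck_on_compose:
  fixes g :: "'a::real_normed_vector \<Rightarrow> 'b::euclidean_space"
  assumes "open S" "open T" "g ` S \<subseteq> T" "Ck_on k T f" "Ck_on k S g"
  shows "Ck_on k S (\<lambda>x. f (g x))"
  using assms(4,5)
proof (induction k arbitrary: f)
  case 0
  then show ?case
    using assms(3) by (auto intro: continuous_on_compose2)
next
  case (Suc k)
  have fd: "(f has_derivative frechet_derivative f (at y)) (at y)" if "y \<in> T" for y
    using Ck_on_has_derivative[OF Suc.prems(1) that] .
  have gd: "(g has_derivative frechet_derivative g (at y)) (at y)" if "y \<in> S" for y
    using Ck_on_has_derivative[OF Suc.prems(2) that] .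
  let ?d = "\<lambda>x v. \<Sum>b\<in>Basis. (frechet_derivative g (at x) v \<bullet> b) *\<^sub>R frechet_derivative f (at (g x)) b"
  show ?case
  proof (rule Ck_on_SucI[OF assms(1), where f' = ?d])
    fix x assume x: "x \<in> S"
    then have gx: "g x \<in> T" using assms(3) by auto
    have comp: "((\<lambda>x. f (g x)) has_derivative
        (\<lambda>v. frechet_derivative f (at (g x)) (frechet_derivative g (at x) v))) (at x)"
      using diff_chain_at[OF gd[OF x] fd[OF gx]] by (simp add: o_def)
    have rep: "frechet_derivative f (at (g x)) w = (\<Sum>b\<in>Basis. (w \<bullet> b) *\<^sub>R frechet_derivative f (at (g x)) b)" for w
    proof -
      have lin: "linear (frechet_derivative f (at (g x)))"
        using fd[OF gx] has_derivative_linear by blast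
      show ?thesis
        by (subst (1) euclidean_representation[of w, symmetric])
          (simp add: linear_sum[OF lin] linear_cmul[OF lin])
    qed
    show "((\<lambda>x. f (g x)) has_derivative ?d x) (at x)"
      by (rule has_derivative_eq_rhs[OF comp]) (rule ext, rule rep)
  next
    fix v
    have "Ck_on k S (\<lambda>x. (frechet_derivative g (at x) v \<bullet> b) *\<^sub>R frechet_derivative f (at (g x)) b)" for b
    proof -
      have 1: "Ck_on k S (\<lambda>x. frechet_derivative g (at x) v)"
        using Suc.prems(2) by simp
      have "Ck_on k T (\<lambda>x. frechet_derivative f (at x) b)"
        using Suc.prems(1) by simp
      then have 2: "Ck_on k S (\<lambda>x. frechet_derivative f (at (g x)) b)"
        by (rule Suc.IH[OF _ Ck_on_SucD[OF Suc.prems(2)]])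
      show ?thesis
        by (rule Ck_on_bounded_bilinear[OF assms(1) bounded_bilinear_scaleR
              Ck_on_bounded_linear[OF assms(1) bounded_linear_inner_left 1] 2])
    qed
    then show "Ck_on k S (\<lambda>x. ?d x v)"
      by (intro Ck_on_sum[OF assms(1)])
  qed
qed

lemma smooth_on_cong:
  assumes "open S" "\<And>x. x \<in> S \<Longrightarrow> f x = g x" "smooth_on S f"
  shows "smooth_on S g"
  using assms Ck_on_cong unfolding smooth_on_def by blast

lemma smooth_on_subset: "smooth_on S f \<Longrightarrow> T \<subseteq> S \<Longrightarrow> smooth_on T f"
  using Ck_on_subset unfolding smooth_on_def by blast

lemma smooth_on_local:
  assumes "\<And>x. x \<in> S \<Longrightarrow> \<exists>T. open T \<and> x \<in> T \<and> smooth_on T f"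
  shows "smooth_on S f"
  unfolding smooth_on_def
proof
  fix k show "Ck_on k S f"
    by (rule Ck_on_local) (use assms in \<open>auto simp: smooth_on_def\<close>)
qed

lemma smooth_on_const: "smooth_on S (\<lambda>x. c)"
  by (simp add: smooth_on_def Ck_on_const)

lemma smooth_on_ident: "open S \<Longrightarrow> smooth_on S (\<lambda>x. x)"
  by (simp add: smooth_on_def Ck_on_ident)

lemma smooth_on_add:
  "open S \<Longrightarrow> smooth_on S f \<Longrightarrow> smooth_on S g \<Longrightarrow> smooth_on S (\<lambda>x. f x + g x)"
  by (simp add: smooth_on_def Ck_on_add)

lemma smooth_on_sum:
  "open S \<Longrightarrow> (\<And>i. i \<in> I \<Longrightarrow> smooth_on S (f i)) \<Longrightarrow> smooth_on S (\<lambda>x. \<Sum>i\<in>I. f i x)"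
  by (simp add: smooth_on_def Ck_on_sum)

lemma smooth_on_bounded_linear:
  "open S \<Longrightarrow> bounded_linear L \<Longrightarrow> smooth_on S f \<Longrightarrow> smooth_on S (\<lambda>x. L (f x))"
  by (simp add: smooth_on_def Ck_on_bounded_linear)

lemma smooth_on_scaleR:
  "open S \<Longrightarrow> smooth_on S f \<Longrightarrow> smooth_on S g \<Longrightarrow> smooth_on S (\<lambda>x. f x *\<^sub>R g x)"
  by (simp add: smooth_on_def Ck_on_bounded_bilinear[OF _ bounded_bilinear_scaleR])

lemma smooth_on_mult:
  fixes f g :: "'a::real_normed_vector \<Rightarrow> real"
  shows "open S \<Longrightarrow> smooth_on S f \<Longrightarrow> smooth_on S g \<Longrightarrow> smooth_on S (\<lambda>x. f x * g x)"
  using smooth_on_scaleR[of S f g] by simp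

lemma smooth_on_compose:
  fixes g :: "'a::real_normed_vector \<Rightarrow> 'b::euclidean_space"
  shows "open S \<Longrightarrow> open T \<Longrightarrow> g ` S \<subseteq> T \<Longrightarrow> smooth_on T f \<Longrightarrow> smooth_on S g \<Longrightarrow>
    smooth_on S (\<lambda>x. f (g x))"
  unfolding smooth_on_def using Ck_on_compose by blast

lemma smooth_on_has_derivative:
  "smooth_on S f \<Longrightarrow> x \<in> S \<Longrightarrow> (f has_derivative frechet_derivative f (at x)) (at x)"
  unfolding smooth_on_def using Ck_on_has_derivative by blast

lemma smooth_on_continuous_on: "smooth_on S f \<Longrightarrow> continuous_on S f"
  unfolding smooth_on_def by (metis Ck_on.simps(1))

lemma smooth_on_deriv: "smooth_on S f \<Longrightarrow> smooth_on S (\<lambda>x. frechet_derivative f (at x) v)"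
  unfolding smooth_on_def by (metis Ck_on.simps(2))

text \<open>The variable direction is again expanded in \<open>Basis\<close> to reduce to fixed
  directions.\<close>

lemma smooth_on_deriv_apply:
  fixes f :: "'a::euclidean_space \<Rightarrow> 'b::real_normed_vector"
  assumes "open S" "smooth_on S f" "smooth_on S V"
  shows "smooth_on S (\<lambda>x. frechet_derivative f (at x) (V x))"
proof (rule smooth_on_cong[OF assms(1)])
  show "smooth_on S (\<lambda>x. \<Sum>b\<in>Basis. (V x \<bullet> b) *\<^sub>R frechet_derivative f (at x) b)"
    by (intro smooth_on_sum smooth_on_scaleR smooth_on_deriv assms
        smooth_on_bounded_linear[OF _ bounded_linear_inner_left])
  fix x assume "x \<in> S"
  then have lin: "linear (frechet_derivative f (at x))"
    using smooth_on_has_derivative[OF assms(2)] has_derivative_linear by blast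
  show "(\<Sum>b\<in>Basis. (V x \<bullet> b) *\<^sub>R frechet_derivative f (at x) b) = frechet_derivative f (at x) (V x)"
    by (subst (2) euclidean_representation[of "V x", symmetric])
      (simp add: linear_sum[OF lin] linear_cmul[OF lin])
qed

subsection \<open>Symmetry of second derivatives\<close>

text \<open>The second difference is the increment of \<open>G\<close>; the mean value theorem is
  applied first along \<open>u\<close>, then along \<open>v\<close>. Its left-hand side is symmetric
  in \<open>u\<close> and \<open>v\<close>, so exchanging them compares the two mixed
  derivatives.\<close>

lemma second_difference_mvt:
  fixes f :: "'a::real_normed_vector \<Rightarrow> real"
  assumes a: "0 < a"
    and S: "\<And>s t. s \<in> {0..a} \<Longrightarrow> t \<in> {0..a} \<Longrightarrow> x + s *\<^sub>R u + t *\<^sub>R v \<in> S"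
    and f: "smooth_on S f"
  obtains s t where "s \<in> {0..a}" "t \<in> {0..a}"
    "f (x + a *\<^sub>R u + a *\<^sub>R v) - f (x + a *\<^sub>R u) - f (x + a *\<^sub>R v) + f x
      = a * a * frechet_derivative (\<lambda>y. frechet_derivative f (at y) u) (at (x + s *\<^sub>R u + t *\<^sub>R v)) v"
proof -
  define fu where "fu = (\<lambda>y. frechet_derivative f (at y) u)"
  have fu: "smooth_on S fu" unfolding fu_def by (rule smooth_on_deriv[OF f])
  have line: "((\<lambda>s. F (y + s *\<^sub>R w)) has_real_derivative frechet_derivative F (at (y + s *\<^sub>R w)) w) (at s)"
    if F: "smooth_on S F" and y: "y + s *\<^sub>R w \<in> S" for F :: "'a \<Rightarrow> real" and y w s
  proof -
    have FD: "(F has_derivative frechet_derivative F (at (y + s *\<^sub>R w))) (at (y + s *\<^sub>R w))"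
      by (rule smooth_on_has_derivative[OF F y])
    have "((\<lambda>s. y + s *\<^sub>R w) has_derivative (\<lambda>h. h *\<^sub>R w)) (at s)"
      by (auto intro!: derivative_eq_intros)
    from diff_chain_at[OF this FD] have "((\<lambda>s. F (y + s *\<^sub>R w)) has_derivative
        (\<lambda>h. frechet_derivative F (at (y + s *\<^sub>R w)) (h *\<^sub>R w))) (at s)"
      by (simp add: o_def)
    then show ?thesis
      unfolding has_field_derivative_def
      by (rule has_derivative_eq_rhs)
        (simp add: linear_cmul[OF has_derivative_linear[OF FD]] fun_eq_iff mult.commute)
  qed
  define G where "G = (\<lambda>s. f (x + a *\<^sub>R v + s *\<^sub>R u) - f (x + s *\<^sub>R u))"
  have G: "(G has_real_derivative fu (x + a *\<^sub>R v + s *\<^sub>R u) - fu (x + s *\<^sub>R u)) (at s)" if "s \<in> {0..a}" for s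
    unfolding G_def fu_def
    by (rule DERIV_diff[OF line[OF f] line[OF f]]) (use S[of s a] S[of s 0] that a in \<open>simp_all add: add_ac\<close>)
  obtain s where s: "0 < s" "s < a"
    "G a - G 0 = (a - 0) * (fu (x + a *\<^sub>R v + s *\<^sub>R u) - fu (x + s *\<^sub>R u))"
    using MVT2[OF a, of G "\<lambda>s. fu (x + a *\<^sub>R v + s *\<^sub>R u) - fu (x + s *\<^sub>R u)"] G by auto
  have H: "((\<lambda>t. fu (x + s *\<^sub>R u + t *\<^sub>R v)) has_real_derivative
      frechet_derivative fu (at (x + s *\<^sub>R u + t *\<^sub>R v)) v) (at t)" if "t \<in> {0..a}" for t
    by (rule line[OF fu S]) (use that s in auto)
  obtain t where t: "0 < t" "t < a" "fu (x + s *\<^sub>R u + a *\<^sub>R v) - fu (x + s *\<^sub>R u + 0 *\<^sub>R v)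
      = (a - 0) * frechet_derivative fu (at (x + s *\<^sub>R u + t *\<^sub>R v)) v"
    using MVT2[OF a, of "\<lambda>t. fu (x + s *\<^sub>R u + t *\<^sub>R v)"
      "\<lambda>t. frechet_derivative fu (at (x + s *\<^sub>R u + t *\<^sub>R v)) v"] H by auto
  show thesis
  proof (rule that)
    show "s \<in> {0..a}" "t \<in> {0..a}" using s t by auto
    have eq: "x + a *\<^sub>R v + s *\<^sub>R u = x + s *\<^sub>R u + a *\<^sub>R v" "x + a *\<^sub>R v + a *\<^sub>R u = x + a *\<^sub>R u + a *\<^sub>R v"
      by simp_all
    show "f (x + a *\<^sub>R u + a *\<^sub>R v) - f (x + a *\<^sub>R u) - f (x + a *\<^sub>R v) + f x
      = a * a * frechet_derivative (\<lambda>y. frechet_derivative f (at y) u) (at (x + s *\<^sub>R u + t *\<^sub>R v)) v"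
      using s(3) t(3) unfolding G_def eq fu_def by (simp add: algebra_simps)
  qed
qed

text \<open>Small parallelograms at \<open>x\<close> give points \<open>p n\<close> and
  \<open>q n\<close> tending to \<open>x\<close> at which the two mixed derivatives agree; both are
  continuous.\<close>

lemma second_derivative_symmetric:
  fixes f :: "'a::real_normed_vector \<Rightarrow> real"
  assumes S: "open S" "x \<in> S" and f: "smooth_on S f"
  shows "frechet_derivative (\<lambda>y. frechet_derivative f (at y) u) (at x) v
    = frechet_derivative (\<lambda>y. frechet_derivative f (at y) v) (at x) u"
proof -
  let ?D = "\<lambda>u v y. frechet_derivative (\<lambda>y. frechet_derivative f (at y) u) (at y) v"
  have "\<forall>n. \<exists>p q. dist p x < inverse (Suc n) \<and> dist q x < inverse (Suc n) \<and> ?D u v p = ?D v u q"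
  proof
    fix n
    obtain e where e: "0 < e" "ball x e \<subseteq> S"
      using S openE by blast
    define d where "d = min e (inverse (Suc n))"
    have d: "0 < d" using e by (simp add: d_def)
    \<comment> \<open>With this side length the parallelogram stays within d/2 of \<open>x\<close>;
      the summand 1 keeps the denominator positive if \<open>u\<close> and \<open>v\<close> are both
      zero.\<close>
    define a where "a = d / (2 * (norm u + norm v + 1))"
    have nn: "0 < norm u + norm v + 1" by (simp add: add_nonneg_pos)
    have a: "0 < a" using d nn by (simp add: a_def)
    have near: "dist (x + s *\<^sub>R u + t *\<^sub>R v) x < d" if "s \<in> {0..a}" "t \<in> {0..a}" for s t
    proof -
      have "dist (x + s *\<^sub>R u + t *\<^sub>R v) x \<le> norm (s *\<^sub>R u) + norm (t *\<^sub>R v)"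
        by (simp add: dist_norm add.assoc norm_triangle_ineq del: norm_scaleR)
      also have "\<dots> \<le> a * norm u + a * norm v"
        using that by (auto intro!: add_mono mult_right_mono)
      also have "\<dots> \<le> a * (norm u + norm v + 1)" using a by (simp add: algebra_simps)
      also have "\<dots> = d / 2" unfolding a_def using nn by (simp add: field_simps)
      also have "\<dots> < d" using d by simp
      finally show ?thesis .
    qed
    have inS: "x + s *\<^sub>R u + t *\<^sub>R v \<in> S" if "s \<in> {0..a}" "t \<in> {0..a}" for s t
      using near[OF that] e by (auto simp: d_def dist_commute)
    have inS': "x + s *\<^sub>R v + t *\<^sub>R u \<in> S" if "s \<in> {0..a}" "t \<in> {0..a}" for s t
      using inS[OF that(2,1)] by (simp add: algebra_simps)
    obtain s t where st: "s \<in> {0..a}" "t \<in> {0..a}"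
      "f (x + a *\<^sub>R u + a *\<^sub>R v) - f (x + a *\<^sub>R u) - f (x + a *\<^sub>R v) + f x
        = a * a * ?D u v (x + s *\<^sub>R u + t *\<^sub>R v)"
      using second_difference_mvt[OF a inS f] by blast
    obtain s' t' where st': "s' \<in> {0..a}" "t' \<in> {0..a}"
      "f (x + a *\<^sub>R v + a *\<^sub>R u) - f (x + a *\<^sub>R v) - f (x + a *\<^sub>R u) + f x
        = a * a * ?D v u (x + s' *\<^sub>R v + t' *\<^sub>R u)"
      using second_difference_mvt[OF a inS' f] by blast
    have eq: "x + a *\<^sub>R v + a *\<^sub>R u = x + a *\<^sub>R u + a *\<^sub>R v" by simp
    have "a * a * ?D u v (x + s *\<^sub>R u + t *\<^sub>R v) = a * a * ?D v u (x + s' *\<^sub>R v + t' *\<^sub>R u)"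
      using st(3) st'(3) unfolding eq by linarith
    then have "?D u v (x + s *\<^sub>R u + t *\<^sub>R v) = ?D v u (x + s' *\<^sub>R v + t' *\<^sub>R u)"
      using a by simp
    moreover have "x + s' *\<^sub>R v + t' *\<^sub>R u = x + t' *\<^sub>R u + s' *\<^sub>R v" by simp
    ultimately show "\<exists>p q. dist p x < inverse (Suc n) \<and> dist q x < inverse (Suc n) \<and> ?D u v p = ?D v u q"
      using near[OF st(1,2)] near[OF st'(2,1)] unfolding d_def by fastforce
  qed
  then obtain p q where pq: "\<And>n. dist (p n) x < inverse (Suc n)" "\<And>n. dist (q n) x < inverse (Suc n)"
    "\<And>n. ?D u v (p n) = ?D v u (q n)"
    by metis
  have lim: "r \<longlonglongrightarrow> x" if "\<And>n. dist (r n) x < inverse (Suc n)" for r :: "nat \<Rightarrow> 'a"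
    by (rule metric_tendsto_imp_tendsto[OF LIMSEQ_inverse_real_of_nat])
      (use that in \<open>auto intro: always_eventually less_imp_le\<close>)
  have cont: "isCont (?D u v) x" for u v
    using smooth_on_continuous_on[OF smooth_on_deriv[OF smooth_on_deriv[OF f]]] S
    by (simp add: continuous_on_eq_continuous_at)
  have "(\<lambda>n. ?D u v (p n)) \<longlonglongrightarrow> ?D u v x" "(\<lambda>n. ?D v u (q n)) \<longlonglongrightarrow> ?D v u x"
    by (rule isCont_tendsto_compose[OF cont lim[OF pq(1)]], rule isCont_tendsto_compose[OF cont lim[OF pq(2)]])
  then show ?thesis
    using pq(3) LIMSEQ_unique by simp
qed

subsection \<open>Bump functions\<close>

text \<open>The polynomial factor makes the family closed under differentiation, so that one
  induction over all \<open>p\<close> proves smoothness of exp (-1/t).\<close>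

definition flat :: "real poly \<Rightarrow> real \<Rightarrow> real" where
  "flat p t = (if t > 0 then poly p (1 / t) * exp (- (1 / t)) else 0)"

lemma flat_tendsto_0: "((\<lambda>t. poly p (1 / t) * exp (- (1 / t))) \<longlongrightarrow> 0) (at_right 0)"
  for p :: "real poly"
proof -
  have "((\<lambda>x. poly p x * exp (- x)) \<longlongrightarrow> 0) at_top"
  proof -
    have "((\<lambda>x. \<Sum>i\<le>degree p. coeff p i * (x ^ i / exp x)) \<longlongrightarrow> (\<Sum>i\<le>degree p. coeff p i * 0)) at_top"
      by (intro tendsto_sum tendsto_mult tendsto_const tendsto_power_div_exp_0)
    then show ?thesis
      by (simp add: poly_altdef sum_distrib_right exp_minus divide_inverse mult.assoc)
  qed
  moreover have "filterlim (\<lambda>t::real. 1 / t) at_top (at_right 0)"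
    using filterlim_inverse_at_top_right by (simp add: inverse_eq_divide)
  ultimately show ?thesis
    by (rule filterlim_compose)
qed

text \<open>Differentiating p(1/t) exp (-1/t) yields (p - p')(1/t) exp (-1/t) / t^2, and the two
  \<open>pCons 0\<close> are the multiplication by t^(-2).\<close>

lemma flat_has_derivative:
  "(flat p has_real_derivative flat (pCons 0 (pCons 0 (p - pderiv p))) t) (at t)"
proof (cases t "0::real" rule: linorder_cases)
  case less
  have "((\<lambda>t. 0) has_real_derivative 0) (at t)" by simp
  then have "(flat p has_real_derivative 0) (at t)"
    by (rule has_field_derivative_transform_within_open[where S = "{..<0}"])
      (use less in \<open>auto simp: flat_def\<close>)
  then show ?thesis using less by (simp add: flat_def)
next
  case greater
  have "((\<lambda>t. poly p (1 / t) * exp (- (1 / t))) has_real_derivative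
      poly (pderiv p) (1 / t) * (- 1 / (t * t)) * exp (- (1 / t))
       + exp (- (1 / t)) * (1 / (t * t)) * poly p (1 / t)) (at t)"
    using greater
    by (auto intro!: derivative_eq_intros DERIV_chain2[OF poly_DERIV] simp: field_simps)
  then have "(flat p has_real_derivative
      poly (pderiv p) (1 / t) * (- 1 / (t * t)) * exp (- (1 / t))
       + exp (- (1 / t)) * (1 / (t * t)) * poly p (1 / t)) (at t)"
    by (rule has_field_derivative_transform_within_open[where S = "{0<..}"])
      (use greater in \<open>auto simp: flat_def\<close>)
  then show ?thesis using greater by (simp add: flat_def field_simps)
next
  case equal
  \<comment> \<open>For positive t the difference quotient at 0 is again of the form
    \<open>flat\<close>, with the polynomial multiplied by its variable.\<close>
  have "((\<lambda>t. flat p t / t) \<longlongrightarrow> 0) (at_right 0)"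
    by (rule Lim_transform_eventually[OF flat_tendsto_0[of "pCons 0 p"]])
      (auto simp: eventually_at_filter flat_def)
  moreover have "((\<lambda>t. flat p t / t) \<longlongrightarrow> 0) (at_left 0)"
    by (rule Lim_transform_eventually[OF tendsto_const]) (auto simp: eventually_at_filter flat_def)
  ultimately have "((\<lambda>t. flat p t / t) \<longlongrightarrow> 0) (at 0)"
    by (simp add: filterlim_at_split)
  then show ?thesis
    unfolding equal DERIV_def by (simp add: flat_def)
qed

lemma smooth_on_flat: "smooth_on UNIV (flat p)"
proof -
  have "Ck_on k UNIV (flat p)" for k
  proof (induction k arbitrary: p)
    case 0
    show ?case
      by (simp add: continuous_at_imp_continuous_on DERIV_isCont[OF flat_has_derivative])
  next
    case (Suc k)
    show ?case
    proof (rule Ck_on_SucI[OF open_UNIV])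
      show "(flat p has_derivative (\<lambda>h. flat (pCons 0 (pCons 0 (p - pderiv p))) t * h)) (at t)" for t
        using flat_has_derivative unfolding has_field_derivative_def .
      show "Ck_on k UNIV (\<lambda>t. flat (pCons 0 (pCons 0 (p - pderiv p))) t * v)" for v
        by (rule Ck_on_bounded_linear[OF open_UNIV bounded_linear_mult_left Suc])
    qed
  qed
  then show ?thesis by (simp add: smooth_on_def)
qed

lemma smooth_bump:
  fixes x :: "'a::euclidean_space"
  assumes "open S" "x \<in> S"
  obtains b :: "'a \<Rightarrow> real" and K
  where "smooth_on UNIV b" "b x = 1" "compact K" "K \<subseteq> S" "\<And>y. y \<notin> K \<Longrightarrow> b y = 0"
proof -
  obtain r where r: "0 < r" "cball x r \<subseteq> S"
    using assms open_contains_cball by blast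
  \<comment> \<open>This is r^2 - |y - x|^2 as a polynomial in the coordinates; it is positive
    exactly on the open ball of radius \<open>r\<close>.\<close>
  define N where "N = (\<lambda>y. r * r - (\<Sum>b\<in>Basis. (y \<bullet> b - x \<bullet> b) * (y \<bullet> b - x \<bullet> b)))"
  have N_eq: "N y = r * r - dist x y * dist x y" for y
  proof -
    have "dist x y * dist x y = (y - x) \<bullet> (y - x)"
      by (simp add: dist_norm norm_minus_commute[of x y] flip: power2_norm_eq_inner power2_eq_square)
    also have "\<dots> = (\<Sum>b\<in>Basis. (y \<bullet> b - x \<bullet> b) * (y \<bullet> b - x \<bullet> b))"
      by (subst euclidean_inner) (simp add: inner_diff_left)
    finally show ?thesis by (simp add: N_def)
  qed
  have inner: "smooth_on UNIV (\<lambda>y. y \<bullet> b - x \<bullet> b)" for b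
  proof -
    have "smooth_on UNIV (\<lambda>y. y \<bullet> b + (- (x \<bullet> b)))"
      by (intro smooth_on_add smooth_on_const open_UNIV smooth_on_ident
          smooth_on_bounded_linear[OF _ bounded_linear_inner_left])
    then show ?thesis by simp
  qed
  have "smooth_on UNIV (\<lambda>y. r * r + (- 1) * (\<Sum>b\<in>Basis. (y \<bullet> b - x \<bullet> b) * (y \<bullet> b - x \<bullet> b)))"
    by (intro smooth_on_add smooth_on_mult smooth_on_sum smooth_on_const open_UNIV inner)
  then have sN: "smooth_on UNIV N" by (simp add: N_def)
  define c where "c = inverse (flat 1 (r * r))"
  have c: "flat 1 (r * r) \<noteq> 0" using r by (simp add: flat_def)
  show thesis
  proof (rule that)
    have "smooth_on UNIV (\<lambda>y. flat 1 (N y))"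
      by (rule smooth_on_compose[OF open_UNIV open_UNIV _ smooth_on_flat sN]) auto
    then show "smooth_on UNIV (\<lambda>y. c * flat 1 (N y))"
      by (intro smooth_on_mult smooth_on_const open_UNIV)
    show "c * flat 1 (N x) = 1" using c by (simp add: c_def N_eq)
    show "compact (cball x r)" by simp
    show "cball x r \<subseteq> S" by (rule r)
    show "c * flat 1 (N y) = 0" if "y \<notin> cball x r" for y
    proof -
      have "r * r < dist x y * dist x y"
        using that r by (intro mult_strict_mono') auto
      then show ?thesis by (simp add: flat_def N_eq)
    qed
  qed
qed

section \<open>Calculus on manifolds\<close>

locale manifold =
  fixes A :: "('a::{t2_space, second_countable_topology}, 'n::finite) chart set"
  assumes smooth_manifold: "smooth_manifold A"
begin

abbreviation ch :: "'a \<Rightarrow> ('a, 'n) chart" where "ch p \<equiv> chart_at A p"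

abbreviation overlap :: "('a, 'n) chart \<Rightarrow> ('a, 'n) chart \<Rightarrow> (real ^ 'n) set" where
  "overlap c d \<equiv> snd c ` (fst c \<inter> fst d)"

definition jac :: "('a, 'n) chart \<Rightarrow> ('a, 'n) chart \<Rightarrow> 'a \<Rightarrow> real ^ 'n \<Rightarrow> real ^ 'n" where
  "jac c d q = frechet_derivative (transition c d) (at (snd c q))"

lemma chart_at_in: "ch p \<in> A" and chart_at_mem: "p \<in> fst (ch p)"
proof -
  have "\<exists>c. c \<in> A \<and> p \<in> fst c"
    using smooth_manifold unfolding smooth_manifold_def by blast
  from someI_ex[OF this] show "ch p \<in> A" "p \<in> fst (ch p)"
    unfolding chart_at_def by auto
qed

lemma is_chart: "c \<in> A \<Longrightarrow> is_chart c"
  using smooth_manifold unfolding smooth_manifold_def by blast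

lemma chart_open: "c \<in> A \<Longrightarrow> open (fst c)" "c \<in> A \<Longrightarrow> open (chart_image c)"
  using is_chart unfolding is_chart_def by auto

lemma chart_inv_chart: "c \<in> A \<Longrightarrow> q \<in> fst c \<Longrightarrow> chart_inv c (snd c q) = q"
  and chart_chart_inv: "c \<in> A \<Longrightarrow> x \<in> chart_image c \<Longrightarrow> snd c (chart_inv c x) = x"
  and chart_inv_mem: "c \<in> A \<Longrightarrow> x \<in> chart_image c \<Longrightarrow> chart_inv c x \<in> fst c"
  and continuous_on_chart: "c \<in> A \<Longrightarrow> continuous_on (fst c) (snd c)"
  and continuous_on_chart_inv: "c \<in> A \<Longrightarrow> continuous_on (chart_image c) (chart_inv c)"
  using is_chart[of c] unfolding is_chart_def homeomorphism_def by auto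

lemma chart_mem_image: "q \<in> fst c \<Longrightarrow> snd c q \<in> chart_image c"
  by (simp add: chart_image_def)

lemma overlap_eq:
  assumes "c \<in> A"
  shows "overlap c d = chart_inv c -` fst d \<inter> chart_image c"
proof (intro subset_antisym subsetI)
  fix x assume "x \<in> overlap c d"
  then show "x \<in> chart_inv c -` fst d \<inter> chart_image c"
    using chart_inv_chart[OF assms] by (auto simp: chart_image_def)
next
  fix x assume x: "x \<in> chart_inv c -` fst d \<inter> chart_image c"
  then have "x = snd c (chart_inv c x)" "chart_inv c x \<in> fst c"
    using chart_chart_inv[OF assms] chart_inv_mem[OF assms] by auto
  with x show "x \<in> overlap c d" by auto
qed

lemma open_overlap: "c \<in> A \<Longrightarrow> d \<in> A \<Longrightarrow> open (overlap c d)"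
  using continuous_on_chart_inv[of c] chart_open[of c] chart_open[of d]
  by (simp add: overlap_eq continuous_on_open_vimage)

lemma transition_chart: "c \<in> A \<Longrightarrow> q \<in> fst c \<Longrightarrow> transition c d (snd c q) = snd d q"
  by (simp add: transition_def chart_inv_chart)

lemma smooth_on_transition: "c \<in> A \<Longrightarrow> d \<in> A \<Longrightarrow> smooth_on (overlap c d) (transition c d)"
  using smooth_manifold unfolding smooth_manifold_def by blast

lemma transition_has_derivative:
  assumes "c \<in> A" "d \<in> A" "q \<in> fst c" "q \<in> fst d"
  shows "(transition c d has_derivative jac c d q) (at (snd c q))"
  unfolding jac_def
  by (rule smooth_on_has_derivative[OF smooth_on_transition]) (use assms in auto)

lemma linear_jac:
  "c \<in> A \<Longrightarrow> d \<in> A \<Longrightarrow> q \<in> fst c \<Longrightarrow> q \<in> fst d \<Longrightarrow> linear (jac c d q)"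
  using transition_has_derivative has_derivative_linear by blast

lemma jac_compose:
  assumes "c \<in> A" "d \<in> A" "e \<in> A" "q \<in> fst c" "q \<in> fst d" "q \<in> fst e"
  shows "jac d e q (jac c d q v) = jac c e q v"
proof -
  have "(transition d e has_derivative jac d e q) (at (transition c d (snd c q)))"
    using transition_has_derivative assms by (simp add: transition_chart)
  from diff_chain_at[OF transition_has_derivative[OF assms(1,2,4,5)] this]
  have "(transition d e \<circ> transition c d has_derivative jac d e q \<circ> jac c d q) (at (snd c q))" .
  then have "(transition c e has_derivative jac d e q \<circ> jac c d q) (at (snd c q))"
  proof (rule has_derivative_transform_within_open)
    show "open (overlap c d)" using open_overlap assms by blast
    show "snd c q \<in> overlap c d" using assms by auto
    fix x assume "x \<in> overlap c d"
    then show "(transition d e \<circ> transition c d) x = transition c e x"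
      using assms by (auto simp: transition_chart)
  qed
  from has_derivative_unique[OF this transition_has_derivative[OF assms(1,3,4,6)]]
  show ?thesis by (metis comp_apply)
qed

lemma jac_self:
  assumes "c \<in> A" "q \<in> fst c"
  shows "jac c c q v = v"
proof -
  have "((\<lambda>x. x) has_derivative (\<lambda>v. v)) (at (snd c q))" by simp
  then have "(transition c c has_derivative (\<lambda>v. v)) (at (snd c q))"
    by (rule has_derivative_transform_within_open[OF _ chart_open(2)[OF assms(1)]])
      (use assms in \<open>auto simp: chart_mem_image transition_def chart_chart_inv\<close>)
  from has_derivative_unique[OF this transition_has_derivative[OF assms(1,1,2,2)]]
  show ?thesis by metis
qed

lemma vf_rep_chart:
  assumes "c \<in> A" "q \<in> fst c"
  shows "vf_rep A c X (snd c q) = jac (ch q) c q (X q)"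
  using assms by (simp add: vf_rep_def chart_inv_chart jac_def Let_def)

lemma vf_from_rep:
  assumes "c \<in> A" "q \<in> fst c"
  shows "X q = jac c (ch q) q (vf_rep A c X (snd c q))"
  using assms by (simp add: vf_rep_chart jac_compose chart_at_in chart_at_mem jac_self)

lemma vf_rep_chart_at: "vf_rep A (ch p) X (snd (ch p) p) = X p"
  by (simp add: vf_rep_chart chart_at_in chart_at_mem jac_self)

lemma smooth_vfD: "smooth_vf A X \<Longrightarrow> c \<in> A \<Longrightarrow> smooth_on (chart_image c) (vf_rep A c X)"
  by (simp add: smooth_vf_def)

lemma smooth_funD: "smooth_fun A f \<Longrightarrow> c \<in> A \<Longrightarrow> smooth_on (chart_image c) (f \<circ> chart_inv c)"
  by (simp add: smooth_fun_def)

subsection \<open>Algebra of smooth functions and vector fields\<close>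

lemma chart_image_cases:
  assumes "c \<in> A" "x \<in> chart_image c"
  obtains q where "q \<in> fst c" "x = snd c q" "chart_inv c x = q"
  using assms chart_inv_mem chart_chart_inv by metis

lemma smooth_fun_const: "smooth_fun A (\<lambda>q. k)"
  by (auto simp: smooth_fun_def o_def smooth_on_const)

lemma smooth_vf_add:
  assumes "smooth_vf A X" "smooth_vf A Y" shows "smooth_vf A (\<lambda>q. X q + Y q)"
  unfolding smooth_vf_def
proof
  fix c assume c: "c \<in> A"
  show "smooth_on (chart_image c) (vf_rep A c (\<lambda>q. X q + Y q))"
  proof (rule smooth_on_cong[OF chart_open(2)[OF c]])
    show "smooth_on (chart_image c) (\<lambda>x. vf_rep A c X x + vf_rep A c Y x)"
      using assms c by (intro smooth_on_add chart_open smooth_vfD)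
    fix x assume "x \<in> chart_image c"
    then obtain q where "q \<in> fst c" "x = snd c q" by (rule chart_image_cases[OF c])
    then show "vf_rep A c X x + vf_rep A c Y x = vf_rep A c (\<lambda>q. X q + Y q) x"
      using c by (simp add: vf_rep_chart linear_add[OF linear_jac] chart_at_in chart_at_mem)
  qed
qed

lemma smooth_vf_scale:
  assumes "smooth_fun A f" "smooth_vf A X" shows "smooth_vf A (\<lambda>q. f q *\<^sub>R X q)"
  unfolding smooth_vf_def
proof
  fix c assume c: "c \<in> A"
  show "smooth_on (chart_image c) (vf_rep A c (\<lambda>q. f q *\<^sub>R X q))"
  proof (rule smooth_on_cong[OF chart_open(2)[OF c]])
    show "smooth_on (chart_image c) (\<lambda>x. (f \<circ> chart_inv c) x *\<^sub>R vf_rep A c X x)"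
      using assms c by (intro smooth_on_scaleR chart_open smooth_vfD smooth_funD)
    fix x assume "x \<in> chart_image c"
    then obtain q where "q \<in> fst c" "x = snd c q" "chart_inv c x = q" by (rule chart_image_cases[OF c])
    then show "(f \<circ> chart_inv c) x *\<^sub>R vf_rep A c X x = vf_rep A c (\<lambda>q. f q *\<^sub>R X q) x"
      using c by (simp add: vf_rep_chart linear_cmul[OF linear_jac] chart_at_in chart_at_mem)
  qed
qed

lemma smooth_vf_cscale: "smooth_vf A X \<Longrightarrow> smooth_vf A (\<lambda>q. k *\<^sub>R X q)"
  by (rule smooth_vf_scale[OF smooth_fun_const])

lemma smooth_vf_diff:
  assumes "smooth_vf A X" "smooth_vf A Y" shows "smooth_vf A (\<lambda>q. X q - Y q)"
  using smooth_vf_add[OF assms(1) smooth_vf_cscale[OF assms(2), of "- 1"]] by simp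

lemma smooth_vf_zero: "smooth_vf A (\<lambda>q. 0)"
  unfolding smooth_vf_def
proof
  fix c assume c: "c \<in> A"
  show "smooth_on (chart_image c) (vf_rep A c (\<lambda>q. 0))"
  proof (rule smooth_on_cong[OF chart_open(2)[OF c] _ smooth_on_const])
    fix x assume "x \<in> chart_image c"
    then obtain q where "q \<in> fst c" "x = snd c q" by (rule chart_image_cases[OF c])
    then show "0 = vf_rep A c (\<lambda>q. 0) x"
      using c by (simp add: vf_rep_chart linear_0[OF linear_jac] chart_at_in chart_at_mem)
  qed
qed

lemma smooth_vf_sum:
  "(\<And>i. i \<in> I \<Longrightarrow> smooth_vf A (X i)) \<Longrightarrow> smooth_vf A (\<lambda>q. \<Sum>i\<in>I. X i q)"
  by (induction I rule: infinite_finite_induct) (auto intro: smooth_vf_add smooth_vf_zero)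

subsection \<open>Derivatives of functions along vector fields\<close>

text \<open>The chain rule through the transition map removes the selected chart from the
  definition, so that derivatives at different points can be compared in one chart.\<close>

lemma vf_deriv_chart:
  assumes f: "smooth_fun A f" and c: "c \<in> A" "q \<in> fst c"
  shows "vf_deriv A X f q = frechet_derivative (f \<circ> chart_inv c) (at (snd c q)) (vf_rep A c X (snd c q))"
proof -
  let ?e = "ch q"
  have e: "?e \<in> A" "q \<in> fst ?e" by (rule chart_at_in chart_at_mem)+
  have "(f \<circ> chart_inv c has_derivative frechet_derivative (f \<circ> chart_inv c) (at (snd c q)))
      (at (transition ?e c (snd ?e q)))"
    using smooth_on_has_derivative[OF smooth_funD[OF f c(1)] chart_mem_image[OF c(2)]] e
    by (simp add: transition_chart)
  from diff_chain_at[OF transition_has_derivative[OF e(1) c(1) e(2) c(2)] this]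
  have "(f \<circ> chart_inv ?e has_derivative
      frechet_derivative (f \<circ> chart_inv c) (at (snd c q)) \<circ> jac ?e c q) (at (snd ?e q))"
  proof (rule has_derivative_transform_within_open)
    show "open (overlap ?e c)" using open_overlap e c by blast
    show "snd ?e q \<in> overlap ?e c" using e c by auto
    fix x assume "x \<in> overlap ?e c"
    then show "((f \<circ> chart_inv c) \<circ> transition ?e c) x = (f \<circ> chart_inv ?e) x"
      using c(1) e(1) by (auto simp: transition_chart chart_inv_chart)
  qed
  from frechet_derivative_at[OF this] show ?thesis
    using c by (simp add: vf_deriv_def Let_def vf_rep_chart fun_eq_iff)
qed

lemma fun_rep_has_derivative:
  "smooth_fun A f \<Longrightarrow> ((f \<circ> chart_inv (ch p)) has_derivative
    frechet_derivative (f \<circ> chart_inv (ch p)) (at (snd (ch p) p))) (at (snd (ch p) p))"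
  by (rule smooth_on_has_derivative[OF smooth_funD[OF _ chart_at_in] chart_mem_image[OF chart_at_mem]])

lemma vf_deriv_linear:
  assumes "smooth_fun A f"
  shows "linear (\<lambda>v. vf_deriv A (\<lambda>q. v) f p)"
    and "vf_deriv A X f p = vf_deriv A (\<lambda>q. X p) f p"
  using has_derivative_linear[OF fun_rep_has_derivative[OF assms]]
  by (simp_all add: vf_deriv_def Let_def)

lemma vf_deriv_add_fun:
  assumes "smooth_fun A f" "smooth_fun A h"
  shows "vf_deriv A X (\<lambda>q. f q + h q) p = vf_deriv A X f p + vf_deriv A X h p"
  using frechet_derivative_at[OF has_derivative_add[OF fun_rep_has_derivative fun_rep_has_derivative], OF assms, of p]
  by (simp add: vf_deriv_def Let_def o_def fun_eq_iff)

lemma vf_deriv_diff_fun: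
  assumes "smooth_fun A f" "smooth_fun A h"
  shows "vf_deriv A X (\<lambda>q. f q - h q) p = vf_deriv A X f p - vf_deriv A X h p"
  using frechet_derivative_at[OF has_derivative_diff[OF fun_rep_has_derivative fun_rep_has_derivative], OF assms, of p]
  by (simp add: vf_deriv_def Let_def o_def fun_eq_iff)

lemma smooth_vf_deriv:
  assumes f: "smooth_fun A f" and X: "smooth_vf A X"
  shows "smooth_fun A (vf_deriv A X f)"
  unfolding smooth_fun_def
proof
  fix c assume c: "c \<in> A"
  show "smooth_on (chart_image c) (vf_deriv A X f \<circ> chart_inv c)"
  proof (rule smooth_on_cong[OF chart_open(2)[OF c]])
    show "smooth_on (chart_image c) (\<lambda>x. frechet_derivative (f \<circ> chart_inv c) (at x) (vf_rep A c X x))"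
      by (intro smooth_on_deriv_apply chart_open c smooth_funD[OF f] smooth_vfD[OF X])
    fix x assume "x \<in> chart_image c"
    then obtain q where "q \<in> fst c" "x = snd c q" "chart_inv c x = q" by (rule chart_image_cases[OF c])
    then show "frechet_derivative (f \<circ> chart_inv c) (at x) (vf_rep A c X x) = (vf_deriv A X f \<circ> chart_inv c) x"
      using c by (simp add: vf_deriv_chart[OF f c])
  qed
qed

text \<open>This is the product rule for Y f, written in the chart as a sum over
  \<open>Basis\<close>. The second summand is the Hessian of \<open>F\<close>; it is symmetric and
  cancels in the commutator, leaving the coordinate formula of \<open>lie_bracket\<close>.\<close>

lemma vf_deriv_vf_deriv:
  fixes X Y f p
  defines "c \<equiv> ch p"
  defines "F \<equiv> f \<circ> chart_inv c"
  assumes f: "smooth_fun A f" and Y: "smooth_vf A Y"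
  shows "vf_deriv A X (vf_deriv A Y f) p =
    frechet_derivative F (at (snd c p)) (frechet_derivative (vf_rep A c Y) (at (snd c p)) (X p))
    + frechet_derivative (\<lambda>x. frechet_derivative F (at x) (X p)) (at (snd c p)) (Y p)"
proof -
  have c: "c \<in> A" "p \<in> fst c" unfolding c_def by (rule chart_at_in chart_at_mem)+
  let ?x = "snd c p" and ?Y = "vf_rep A c Y"
  let ?dY = "frechet_derivative ?Y (at ?x)"
  have x: "?x \<in> chart_image c" by (rule chart_mem_image[OF c(2)])
  have F: "smooth_on (chart_image c) F" unfolding F_def by (rule smooth_funD[OF f c(1)])
  have dY: "(?Y has_derivative ?dY) (at ?x)"
    by (rule smooth_on_has_derivative[OF smooth_vfD[OF Y c(1)] x])
  have dF: "((\<lambda>x. frechet_derivative F (at x) v) has_derivative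
      frechet_derivative (\<lambda>x. frechet_derivative F (at x) v) (at ?x)) (at ?x)" for v
    by (rule smooth_on_has_derivative[OF smooth_on_deriv[OF F] x])
  have linF: "linear (frechet_derivative F (at x))" if "x \<in> chart_image c" for x
    using smooth_on_has_derivative[OF F that] has_derivative_linear by blast
  have rep: "(\<Sum>b\<in>Basis. (w \<bullet> b) *\<^sub>R L b) = L w" if "linear L" for L :: "real ^ 'n \<Rightarrow> real" and w
    by (subst (2) euclidean_representation[of w, symmetric])
      (simp add: linear_sum[OF that] linear_cmul[OF that])
  have Yx: "?Y ?x = Y p" unfolding c_def by (rule vf_rep_chart_at)
  have "((\<lambda>x. \<Sum>b\<in>Basis. (?Y x \<bullet> b) *\<^sub>R frechet_derivative F (at x) b) has_derivative
      (\<lambda>h. \<Sum>b\<in>Basis. (?Y ?x \<bullet> b) *\<^sub>R frechet_derivative (\<lambda>x. frechet_derivative F (at x) b) (at ?x) h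
        + (?dY h \<bullet> b) *\<^sub>R frechet_derivative F (at ?x) b)) (at ?x)"
    by (intro has_derivative_sum has_derivative_scaleR has_derivative_inner_left dY dF)
  then have "(vf_deriv A Y f \<circ> chart_inv c has_derivative
      (\<lambda>h. \<Sum>b\<in>Basis. (?Y ?x \<bullet> b) *\<^sub>R frechet_derivative (\<lambda>x. frechet_derivative F (at x) b) (at ?x) h
        + (?dY h \<bullet> b) *\<^sub>R frechet_derivative F (at ?x) b)) (at ?x)"
  proof (rule has_derivative_transform_within_open[OF _ chart_open(2)[OF c(1)] x])
    fix x assume xc: "x \<in> chart_image c"
    then obtain q where "q \<in> fst c" "x = snd c q" "chart_inv c x = q" by (rule chart_image_cases[OF c(1)])
    then show "(\<Sum>b\<in>Basis. (?Y x \<bullet> b) *\<^sub>R frechet_derivative F (at x) b) = (vf_deriv A Y f \<circ> chart_inv c) x"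
      using rep[OF linF[OF xc]] by (simp add: vf_deriv_chart[OF f c(1)] F_def)
  qed
  from frechet_derivative_at[OF this]
  have "vf_deriv A X (vf_deriv A Y f) p = (\<Sum>b\<in>Basis. (?dY (X p) \<bullet> b) *\<^sub>R frechet_derivative F (at ?x) b)
      + (\<Sum>b\<in>Basis. (Y p \<bullet> b) *\<^sub>R frechet_derivative (\<lambda>x. frechet_derivative F (at x) b) (at ?x) (X p))"
    unfolding vf_deriv_def[of A X] Let_def c_def[symmetric]
    unfolding fun_eq_iff by (simp add: Yx sum.distrib add.commute)
  also have "(\<Sum>b\<in>Basis. (?dY (X p) \<bullet> b) *\<^sub>R frechet_derivative F (at ?x) b)
      = frechet_derivative F (at ?x) (?dY (X p))"
    by (rule rep[OF linF[OF x]])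
  also have "(\<Sum>b\<in>Basis. (Y p \<bullet> b) *\<^sub>R frechet_derivative (\<lambda>x. frechet_derivative F (at x) b) (at ?x) (X p))
      = (\<Sum>b\<in>Basis. (Y p \<bullet> b) *\<^sub>R frechet_derivative (\<lambda>x. frechet_derivative F (at x) (X p)) (at ?x) b)"
    by (intro sum.cong refl, subst second_derivative_symmetric[OF chart_open(2)[OF c(1)] x F]) simp
  also have "\<dots> = frechet_derivative (\<lambda>x. frechet_derivative F (at x) (X p)) (at ?x) (Y p)"
    by (rule rep[OF has_derivative_linear[OF dF]])
  finally show ?thesis .
qed

lemma vf_deriv_lie_bracket:
  assumes f: "smooth_fun A f" and X: "smooth_vf A X" and Y: "smooth_vf A Y"
  shows "vf_deriv A (lie_bracket A X Y) f p =
    vf_deriv A X (vf_deriv A Y f) p - vf_deriv A Y (vf_deriv A X f) p"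
proof -
  let ?c = "ch p"
  have lin: "linear (frechet_derivative (f \<circ> chart_inv ?c) (at (snd ?c p)))"
    by (rule has_derivative_linear[OF fun_rep_has_derivative[OF f]])
  have "smooth_on (chart_image ?c) (f \<circ> chart_inv ?c)" "snd ?c p \<in> chart_image ?c" "open (chart_image ?c)"
    using smooth_funD[OF f chart_at_in] chart_mem_image[OF chart_at_mem] chart_open(2)[OF chart_at_in]
    by auto
  from second_derivative_symmetric[OF this(3,2,1), of "X p" "Y p"] show ?thesis
    unfolding vf_deriv_vf_deriv[OF f X] vf_deriv_vf_deriv[OF f Y]
    by (simp add: vf_deriv_def[of A "lie_bracket A X Y"] lie_bracket_def Let_def linear_diff[OF lin])
qed

subsection \<open>Localisation\<close>

text \<open>Extension by zero: outside the chart \<open>c\<close> there is a neighbourhood on which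
  \<open>F\<close> vanishes, because the image of \<open>K\<close> is compact and hence closed in a
  Hausdorff space.\<close>

lemma smooth_on_cutoff:
  assumes c: "c \<in> A" and d: "d \<in> A" and K: "compact K" "K \<subseteq> chart_image c"
    and F: "smooth_on (overlap d c) F"
    and F0: "\<And>x. x \<in> chart_image d \<Longrightarrow> chart_inv d x \<notin> chart_inv c ` K \<Longrightarrow> F x = 0"
  shows "smooth_on (chart_image d) F"
proof (rule smooth_on_local)
  fix x assume x: "x \<in> chart_image d"
  show "\<exists>T. open T \<and> x \<in> T \<and> smooth_on T F"
  proof (cases "chart_inv d x \<in> fst c")
    case True
    then have "x \<in> overlap d c" using x d by (simp add: overlap_eq)
    then show ?thesis using open_overlap[OF d c] F by blast
  next
    case False
    have "compact (chart_inv c ` K)"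
      using K continuous_on_subset[OF continuous_on_chart_inv[OF c]] compact_continuous_image by blast
    then have "open (- (chart_inv c ` K))" by (simp add: compact_imp_closed open_Compl)
    then have "open (chart_inv d -` (- (chart_inv c ` K)) \<inter> chart_image d)"
      using continuous_on_chart_inv[OF d] chart_open(2)[OF d] by (simp add: continuous_on_open_vimage)
    moreover have "x \<in> chart_inv d -` (- (chart_inv c ` K)) \<inter> chart_image d"
      using x False K chart_inv_mem[OF c] by auto
    moreover have "smooth_on (chart_inv d -` (- (chart_inv c ` K)) \<inter> chart_image d) F"
      by (rule smooth_on_cong[OF calculation(1) _ smooth_on_const]) (use F0 in auto)
    ultimately show ?thesis by blast
  qed
qed

lemma smooth_fun_cutoff:
  assumes c: "c \<in> A" and K: "compact K" "K \<subseteq> chart_image c"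
    and u: "smooth_on (chart_image c) u" "\<And>x. x \<notin> K \<Longrightarrow> u x = 0"
  shows "smooth_fun A (\<lambda>q. if q \<in> fst c then u (snd c q) else 0)"
  unfolding smooth_fun_def
proof
  fix d assume d: "d \<in> A"
  let ?f = "\<lambda>q. if q \<in> fst c then u (snd c q) else 0"
  show "smooth_on (chart_image d) (?f \<circ> chart_inv d)"
  proof (rule smooth_on_cutoff[OF c d K])
    have "smooth_on (overlap d c) (\<lambda>x. u (transition d c x))"
      by (rule smooth_on_compose[OF open_overlap[OF d c] chart_open(2)[OF c] _ u(1) smooth_on_transition[OF d c]])
        (use d in \<open>auto simp: transition_chart chart_mem_image\<close>)
    then show "smooth_on (overlap d c) (?f \<circ> chart_inv d)"
      by (rule smooth_on_cong[OF open_overlap[OF d c], rotated])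
        (use d in \<open>auto simp: transition_chart chart_inv_chart\<close>)
    fix x assume "x \<in> chart_image d" "chart_inv d x \<notin> chart_inv c ` K"
    then show "(?f \<circ> chart_inv d) x = 0"
      using u(2) chart_inv_chart[OF c] by force
  qed
qed

lemma smooth_vf_cutoff:
  assumes c: "c \<in> A" and K: "compact K" "K \<subseteq> chart_image c"
    and V: "smooth_on (chart_image c) V" "\<And>x. x \<notin> K \<Longrightarrow> V x = 0"
  shows "smooth_vf A (\<lambda>q. if q \<in> fst c then jac c (ch q) q (V (snd c q)) else 0)"
  unfolding smooth_vf_def
proof
  fix d assume d: "d \<in> A"
  let ?X = "\<lambda>q. if q \<in> fst c then jac c (ch q) q (V (snd c q)) else 0"
  show "smooth_on (chart_image d) (vf_rep A d ?X)"
  proof (rule smooth_on_cutoff[OF c d K])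
    have "smooth_on (overlap c d) (\<lambda>y. frechet_derivative (transition c d) (at y) (V y))"
      by (rule smooth_on_deriv_apply[OF open_overlap[OF c d] smooth_on_transition[OF c d]
            smooth_on_subset[OF V(1)]]) (auto simp: chart_mem_image)
    have "transition d c ` overlap d c \<subseteq> overlap c d"
      using d by (auto simp: transition_chart)
    from smooth_on_compose[OF open_overlap[OF d c] open_overlap[OF c d] this
        \<open>smooth_on (overlap c d) _\<close> smooth_on_transition[OF d c]]
    have "smooth_on (overlap d c)
        (\<lambda>x. frechet_derivative (transition c d) (at (transition d c x)) (V (transition d c x)))"
      .
    then show "smooth_on (overlap d c) (vf_rep A d ?X)"
    proof (rule smooth_on_cong[OF open_overlap[OF d c], rotated])
      fix x assume "x \<in> overlap d c"
      then obtain q where "q \<in> fst c" "q \<in> fst d" "x = snd d q" by auto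
      then show "frechet_derivative (transition c d) (at (transition d c x)) (V (transition d c x)) = vf_rep A d ?X x"
        using c d by (simp add: transition_chart vf_rep_chart jac_compose chart_at_in chart_at_mem)
          (simp add: jac_def)
    qed
    fix x assume x: "x \<in> chart_image d" "chart_inv d x \<notin> chart_inv c ` K"
    from x(1) obtain q where q: "q \<in> fst d" "x = snd d q" "chart_inv d x = q" by (rule chart_image_cases[OF d])
    have "?X q = 0"
    proof (cases "q \<in> fst c")
      case True
      then have "snd c q \<notin> K" using x(2) q chart_inv_chart[OF c True] by force
      then show ?thesis
        using True V(2) c by (simp add: linear_0[OF linear_jac] chart_at_in chart_at_mem)
    qed simp
    then show "vf_rep A d ?X x = 0"
      using q d by (simp add: vf_rep_chart linear_0[OF linear_jac] chart_at_in chart_at_mem del: if_split)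
  qed
qed

lemma ex_smooth_vf:
  obtains X where "smooth_vf A X" "X p = v"
proof -
  let ?c = "ch p"
  have c: "?c \<in> A" "p \<in> fst ?c" by (rule chart_at_in chart_at_mem)+
  obtain b :: "real ^ 'n \<Rightarrow> real" and K where b: "smooth_on UNIV b" "b (snd ?c p) = 1" "compact K" "K \<subseteq> chart_image ?c"
    "\<And>y. y \<notin> K \<Longrightarrow> b y = 0"
    using smooth_bump[OF chart_open(2)[OF c(1)] chart_mem_image[OF c(2)]] by metis
  show thesis
  proof (rule that)
    show "smooth_vf A (\<lambda>q. if q \<in> fst ?c then jac ?c (ch q) q (b (snd ?c q) *\<^sub>R v) else 0)"
      by (rule smooth_vf_cutoff[OF c(1) b(3,4)])
        (use b in \<open>auto intro!: smooth_on_scaleR chart_open c smooth_on_const smooth_on_subset[OF b(1)]\<close>)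
    show "(if p \<in> fst ?c then jac ?c (ch p) p (b (snd ?c p) *\<^sub>R v) else 0) = v"
      using c b by (simp add: jac_self)
  qed
qed

text \<open>The coordinate is shifted so as to vanish at \<open>p\<close>; then the product rule
  discards the derivative of the bump factor.\<close>

lemma ex_coordinate_fun:
  obtains f where "smooth_fun A f" "f p = 0" "\<And>X. vf_deriv A X f p = X p $ j"
proof -
  let ?c = "ch p"
  let ?x = "snd ?c p"
  have c: "?c \<in> A" "p \<in> fst ?c" by (rule chart_at_in chart_at_mem)+
  obtain b :: "real ^ 'n \<Rightarrow> real" and K where b: "smooth_on UNIV b" "b ?x = 1" "compact K" "K \<subseteq> chart_image ?c"
    "\<And>y. y \<notin> K \<Longrightarrow> b y = 0"
    using smooth_bump[OF chart_open(2)[OF c(1)] chart_mem_image[OF c(2)]] by metis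
  define u where "u = (\<lambda>x. b x * (x $ j + - (?x $ j)))"
  define f where "f = (\<lambda>q. if q \<in> fst ?c then u (snd ?c q) else 0)"
  have u: "smooth_on (chart_image ?c) u"
    unfolding u_def
    by (intro smooth_on_mult smooth_on_add chart_open c smooth_on_const smooth_on_subset[OF b(1)]
        smooth_on_bounded_linear[OF _ bounded_linear_vec_nth] smooth_on_ident) auto
  show thesis
  proof (rule that)
    show "smooth_fun A f"
      unfolding f_def by (rule smooth_fun_cutoff[OF c(1) b(3,4) u]) (simp add: u_def b)
    show "f p = 0" by (simp add: f_def u_def)
    have "(b has_derivative frechet_derivative b (at ?x)) (at ?x)"
      by (rule smooth_on_has_derivative[OF b(1)]) simp
    then have "(u has_derivative (\<lambda>v. b ?x * v $ j + frechet_derivative b (at ?x) v * (?x $ j + - (?x $ j)))) (at ?x)"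
      unfolding u_def
      by (auto intro!: derivative_eq_intros bounded_linear.has_derivative[OF bounded_linear_vec_nth])
    then have "(f \<circ> chart_inv ?c has_derivative (\<lambda>v. v $ j)) (at ?x)"
      by (rule has_derivative_transform_within_open[OF _ chart_open(2)[OF c(1)] chart_mem_image[OF c(2)],
            THEN has_derivative_eq_rhs])
        (auto simp: f_def b chart_inv_mem[OF c(1)] chart_chart_inv[OF c(1)])
    from frechet_derivative_at[OF this]
    show "vf_deriv A X f p = X p $ j" for X
      by (metis vf_deriv_def)
  qed
qed

text \<open>Testing against coordinate functions recovers every component. This transfers Jacobi's
  identity from derivations of functions to vector fields.\<close>

lemma vf_eqI:
  assumes "\<And>f. smooth_fun A f \<Longrightarrow> vf_deriv A X f p = vf_deriv A Y f p"
  shows "X p = Y p"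
  unfolding vec_eq_iff
proof
  fix j
  obtain f where "smooth_fun A f" "f p = 0" "\<And>X. vf_deriv A X f p = X p $ j"
    using ex_coordinate_fun by metis
  then show "X p $ j = Y p $ j" using assms by metis
qed

text \<open>Near \<open>p\<close> the field is a combination of coordinate fields, but
  \<open>F\<close> is controlled on global ones. One bump factor makes the component functions
  \<open>f\<close> global and another the coordinate fields \<open>E\<close>, hence the two factors
  \<open>B\<close>. At \<open>p\<close> the factor \<open>B\<close> is 1 and all \<open>f i\<close>
  vanish.\<close>

lemma tensorial_0:
  fixes F :: "('a \<Rightarrow> real ^ 'n) \<Rightarrow> 'b::real_vector"
  assumes add: "\<And>X Y. smooth_vf A X \<Longrightarrow> smooth_vf A Y \<Longrightarrow> F (\<lambda>q. X q + Y q) = F X + F Y"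
    and scale: "\<And>f X. smooth_fun A f \<Longrightarrow> smooth_vf A X \<Longrightarrow> F (\<lambda>q. f q *\<^sub>R X q) = f p *\<^sub>R F X"
    and X: "smooth_vf A X" "X p = 0"
  shows "F X = 0"
proof -
  let ?c = "ch p"
  let ?x = "snd ?c p"
  have c: "?c \<in> A" "p \<in> fst ?c" by (rule chart_at_in chart_at_mem)+
  obtain b :: "real ^ 'n \<Rightarrow> real" and K where b: "smooth_on UNIV b" "b ?x = 1" "compact K" "K \<subseteq> chart_image ?c"
    "\<And>y. y \<notin> K \<Longrightarrow> b y = 0"
    using smooth_bump[OF chart_open(2)[OF c(1)] chart_mem_image[OF c(2)]] by metis
  have bc: "smooth_on (chart_image ?c) b" by (rule smooth_on_subset[OF b(1)]) simp
  define B where "B = (\<lambda>q. if q \<in> fst ?c then b (snd ?c q) else 0)"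
  define E where "E = (\<lambda>i q. if q \<in> fst ?c then jac ?c (ch q) q (b (snd ?c q) *\<^sub>R axis i 1) else 0)"
  define f where "f = (\<lambda>i q. if q \<in> fst ?c then b (snd ?c q) * vf_rep A ?c X (snd ?c q) $ i else 0)"
  have sB: "smooth_fun A B"
    unfolding B_def by (rule smooth_fun_cutoff[OF c(1) b(3,4) bc b(5)])
  have sE: "smooth_vf A (E i)" for i
    unfolding E_def
    by (rule smooth_vf_cutoff[OF c(1) b(3,4)])
      (use b bc in \<open>auto intro!: smooth_on_scaleR chart_open c smooth_on_const\<close>)
  have sf: "smooth_fun A (f i)" for i
    unfolding f_def
    by (rule smooth_fun_cutoff[OF c(1) b(3,4)])
      (use b in \<open>auto intro!: smooth_on_mult chart_open c bc smooth_vfD[OF X(1)]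
          smooth_on_bounded_linear[OF _ bounded_linear_vec_nth]\<close>)
  have F0: "F (\<lambda>q. 0) = 0"
    using scale[OF smooth_fun_const[of 0] X(1)] by simp
  have Fsum: "F (\<lambda>q. \<Sum>i\<in>I. f i q *\<^sub>R E i q) = (\<Sum>i\<in>I. f i p *\<^sub>R F (E i))" if "finite I" for I
    using that
  proof (induction I)
    case empty
    then show ?case by (simp add: F0)
  next
    case (insert i I)
    have "F (\<lambda>q. \<Sum>i\<in>insert i I. f i q *\<^sub>R E i q) = F (\<lambda>q. f i q *\<^sub>R E i q + (\<Sum>i\<in>I. f i q *\<^sub>R E i q))"
      using insert by simp
    also have "\<dots> = f i p *\<^sub>R F (E i) + (\<Sum>i\<in>I. f i p *\<^sub>R F (E i))"
      by (subst add) (auto simp: insert scale sf sE intro!: smooth_vf_scale smooth_vf_sum)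
    finally show ?case using insert by simp
  qed
  have "B q *\<^sub>R (B q *\<^sub>R X q) = (\<Sum>i\<in>UNIV. f i q *\<^sub>R E i q)" for q
  proof (cases "q \<in> fst ?c")
    case True
    have lin: "linear (jac ?c (ch q) q)"
      using linear_jac c(1) True chart_at_in chart_at_mem by blast
    have "X q = jac ?c (ch q) q (\<Sum>i\<in>UNIV. vf_rep A ?c X (snd ?c q) $ i *\<^sub>R axis i 1)"
      using vf_from_rep[OF c(1) True, of X] basis_expansion[of "vf_rep A ?c X (snd ?c q)"]
      by (simp add: scalar_mult_eq_scaleR)
    then show ?thesis
      using True by (simp add: f_def E_def B_def linear_sum[OF lin] linear_cmul[OF lin] scaleR_sum_right mult_ac)
  qed (simp add: f_def E_def B_def)
  then have "F (\<lambda>q. B q *\<^sub>R (B q *\<^sub>R X q)) = (\<Sum>i\<in>UNIV. f i p *\<^sub>R F (E i))"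
    using Fsum[of UNIV] by simp
  moreover have "f i p = 0" for i
    using X(2) vf_rep_chart_at[of p X] by (simp add: f_def)
  moreover have "F (\<lambda>q. B q *\<^sub>R (B q *\<^sub>R X q)) = F X"
    using scale[OF sB smooth_vf_scale[OF sB X(1)]] scale[OF sB X(1)] c b(2) by (simp add: B_def)
  ultimately show ?thesis by simp
qed

lemma tensorial_eq:
  fixes F :: "('a \<Rightarrow> real ^ 'n) \<Rightarrow> 'b::real_vector"
  assumes add: "\<And>X Y. smooth_vf A X \<Longrightarrow> smooth_vf A Y \<Longrightarrow> F (\<lambda>q. X q + Y q) = F X + F Y"
    and scale: "\<And>f X. smooth_fun A f \<Longrightarrow> smooth_vf A X \<Longrightarrow> F (\<lambda>q. f q *\<^sub>R X q) = f p *\<^sub>R F X"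
    and X: "smooth_vf A X" "smooth_vf A Y" "X p = Y p"
  shows "F X = F Y"
proof -
  have "F (\<lambda>q. X q + (- 1) *\<^sub>R Y q) = 0"
    by (rule tensorial_0[where p = p and F = F]) (use X in \<open>auto intro!: smooth_vf_diff add scale\<close>)
  then show ?thesis
    by (subst (asm) add, use X smooth_vf_cscale in blast, use X smooth_vf_cscale in blast,
        subst (asm) scale[OF smooth_fun_const]) (use X in auto)
qed

end

section \<open>Linear algebra of nearly cosymplectic structures at a point\<close>

locale inner_form =
  fixes G :: "'v::real_vector \<Rightarrow> 'v \<Rightarrow> real"
  assumes bilinear_G: "bilinear G"
    and G_sym: "G u v = G v u"
    and G_pos: "u \<noteq> 0 \<Longrightarrow> G u u > 0"
begin

lemmas G_simps [simp] =
  bilinear_ladd[OF bilinear_G] bilinear_radd[OF bilinear_G]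
  bilinear_lsub[OF bilinear_G] bilinear_rsub[OF bilinear_G]
  bilinear_lneg[OF bilinear_G] bilinear_rneg[OF bilinear_G]
  bilinear_lzero[OF bilinear_G] bilinear_rzero[OF bilinear_G]
  bilinear_lmul[OF bilinear_G] bilinear_rmul[OF bilinear_G]

lemma G_eqI: "(\<And>w. G u w = G v w) \<Longrightarrow> u = v"
  using G_pos[of "u - v"] by fastforce

lemma G_normalise:
  assumes "u \<noteq> 0"
  shows "G ((1 / sqrt (G u u)) *\<^sub>R u) ((1 / sqrt (G u u)) *\<^sub>R u) = 1"
  using G_pos[OF assms] by (simp add: field_simps)

lemma G_sum_left: "G (\<Sum>b\<in>B. f b) w = (\<Sum>b\<in>B. G (f b) w)"
  by (induction B rule: infinite_finite_induct) auto

definition orthonormal :: "'v set \<Rightarrow> bool" where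
  "orthonormal B \<longleftrightarrow> finite B \<and> (\<forall>b\<in>B. \<forall>c\<in>B. G b c = (if b = c then 1 else 0))"

lemma orthonormal_insert:
  "orthonormal B \<Longrightarrow> G e e = 1 \<Longrightarrow> (\<And>b. b \<in> B \<Longrightarrow> G e b = 0) \<Longrightarrow> orthonormal (insert e B)"
  by (auto simp: orthonormal_def G_sym)

lemma G_residual:
  assumes "orthonormal B" "b \<in> B"
  shows "G (u - (\<Sum>c\<in>B. G u c *\<^sub>R c)) b = 0"
proof -
  have "(\<Sum>c\<in>B. G u c * G c b) = (\<Sum>c\<in>B. if c = b then G u b else 0)"
    using assms by (intro sum.cong) (auto simp: orthonormal_def)
  then show ?thesis
    using assms by (simp add: G_sum_left orthonormal_def)
qed

lemma orthonormal_independent: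
  assumes "orthonormal B" shows "independent B"
proof
  assume "dependent B"
  then obtain a b where ab: "b \<in> B" "a b \<noteq> 0" "(\<Sum>v\<in>B. a v *\<^sub>R v) = 0"
    using assms by (auto simp: orthonormal_def dependent_finite)
  have "0 = G (\<Sum>v\<in>B. a v *\<^sub>R v) b" by (simp add: ab)
  also have "\<dots> = (\<Sum>v\<in>B. if v = b then a b else 0)"
    unfolding G_sum_left using assms ab(1) by (intro sum.cong) (auto simp: orthonormal_def)
  also have "\<dots> = a b" using assms ab(1) by (simp add: orthonormal_def)
  finally show False using ab(2) by simp
qed

end

section \<open>Orthonormal bases and traces for an arbitrary inner product\<close>

locale euclidean_form = inner_form G
  for G :: "real ^ 'n \<Rightarrow> real ^ 'n \<Rightarrow> real"
begin

lemma orthonormal_expansion: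
  assumes "orthonormal B" "card B = CARD('n)"
  shows "u = (\<Sum>b\<in>B. G u b *\<^sub>R b)"
proof -
  let ?w = "u - (\<Sum>b\<in>B. G u b *\<^sub>R b)"
  have "UNIV \<subseteq> span B"
    by (rule card_ge_dim_independent) (use assms orthonormal_independent in \<open>auto simp: dim_UNIV\<close>)
  moreover have "span B \<subseteq> {x. G ?w x = 0}"
  proof (rule span_minimal)
    show "B \<subseteq> {x. G ?w x = 0}"
      using G_residual[OF assms(1)] by blast
    show "subspace {x. G ?w x = 0}"
      by (auto simp: subspace_def simp del: bilinear_lsub[OF bilinear_G])
  qed
  ultimately have "G ?w ?w = 0" by blast
  then have "?w = 0" using G_pos[of ?w] by (metis less_irrefl)
  then show ?thesis by simp
qed

lemma orthonormal_extend:
  assumes B: "orthonormal B" and card: "card B < CARD('n)"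
  obtains e where "G e e = 1" "\<And>b. b \<in> B \<Longrightarrow> G e b = 0"
proof -
  have "dim (span B) \<le> card B"
    using B by (simp add: orthonormal_def dim_le_card')
  then have "span B \<noteq> UNIV" using card by (metis dim_UNIV not_less DIM_cart DIM_real mult_1_right)
  then obtain u where u: "u \<notin> span B" by blast
  let ?w = "u - (\<Sum>c\<in>B. G u c *\<^sub>R c)"
  have "?w \<noteq> 0"
  proof
    assume "?w = 0"
    then have "u = (\<Sum>c\<in>B. G u c *\<^sub>R c)" by simp
    moreover have "(\<Sum>c\<in>B. G u c *\<^sub>R c) \<in> span B"
      by (intro span_sum span_scale span_base)
    ultimately show False using u by simp
  qed
  show thesis
  proof (rule that)
    show "G ((1 / sqrt (G ?w ?w)) *\<^sub>R ?w) ((1 / sqrt (G ?w ?w)) *\<^sub>R ?w) = 1"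
      by (rule G_normalise[OF \<open>?w \<noteq> 0\<close>])
    fix b assume "b \<in> B"
    then show "G ((1 / sqrt (G ?w ?w)) *\<^sub>R ?w) b = 0"
      by (simp only: bilinear_lmul[OF bilinear_G] G_residual[OF B]) simp
  qed
qed

text \<open>\<open>ricci\<close> is a matrix trace in standard coordinates; this allows it to be
  computed in a basis adapted to the structure.\<close>

lemma trace_orthonormal:
  assumes "orthonormal B" "card B = CARD('n)" and f: "linear f"
  shows "trace (matrix f) = (\<Sum>b\<in>B. G (f b) b)"
proof -
  have basis: "(\<Sum>i\<in>UNIV. x $ i *\<^sub>R axis i 1) = x" for x :: "real ^ 'n"
    using basis_expansion[of x] by (simp add: scalar_mult_eq_scaleR)
  have "trace (matrix f) = (\<Sum>i\<in>UNIV. f (axis i 1) $ i)"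
    by (simp add: trace_def matrix_def)
  also have "\<dots> = (\<Sum>i\<in>UNIV. (\<Sum>b\<in>B. G (axis i 1) b * f b $ i))"
  proof (intro sum.cong refl)
    fix i :: 'n
    have "f (axis i 1) = (\<Sum>b\<in>B. G (axis i 1) b *\<^sub>R f b)"
      by (subst orthonormal_expansion[OF assms(1,2)]) (simp add: linear_sum[OF f] linear_cmul[OF f])
    then show "f (axis i 1) $ i = (\<Sum>b\<in>B. G (axis i 1) b * f b $ i)" by simp
  qed
  also have "\<dots> = (\<Sum>b\<in>B. \<Sum>i\<in>UNIV. G (axis i 1) b * f b $ i)" by (rule sum.swap)
  also have "\<dots> = (\<Sum>b\<in>B. G (\<Sum>i\<in>UNIV. f b $ i *\<^sub>R axis i 1) b)"
    by (simp add: G_sum_left mult.commute)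
  also have "\<dots> = (\<Sum>b\<in>B. G (f b) b)"
    by (simp add: basis)
  finally show ?thesis .
qed

end

subsection \<open>Almost contact structures\<close>

locale almost_contact_point = inner_form G
  for G :: "'v::real_vector \<Rightarrow> 'v \<Rightarrow> real" +
  fixes \<phi> :: "'v \<Rightarrow> 'v" and \<xi> :: 'v and \<eta> :: "'v \<Rightarrow> real"
  assumes linear_phi: "linear \<phi>"
    and linear_eta: "linear \<eta>"
    and phi_phi: "\<phi> (\<phi> v) = - v + \<eta> v *\<^sub>R \<xi>"
    and eta_xi [simp]: "\<eta> \<xi> = 1"
    and G_phi_phi: "G (\<phi> u) (\<phi> v) = G u v - \<eta> u * \<eta> v"
begin

lemmas phi_simps [simp] =
  linear_add[OF linear_phi] linear_diff[OF linear_phi] linear_neg[OF linear_phi]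
  linear_0[OF linear_phi] linear_cmul[OF linear_phi]

lemmas eta_simps [simp] =
  linear_add[OF linear_eta] linear_diff[OF linear_eta] linear_neg[OF linear_eta]
  linear_0[OF linear_eta] linear_cmul[OF linear_eta]

lemma xi_nonzero: "\<xi> \<noteq> 0"
  using eta_xi by (metis eta_simps(4) zero_neq_one)

text \<open>From \<phi>^2 \<xi> = 0 and the formula for \<phi>^2 at \<phi> \<xi>, the vector \<phi>
  \<xi> is a multiple c \<xi>. Applying \<phi> once more gives c \<phi> \<xi> = 0, and either factor
  being zero suffices.\<close>

lemma phi_xi [simp]: "\<phi> \<xi> = 0"
proof -
  have 0: "\<phi> (\<phi> \<xi>) = 0" by (simp add: phi_phi)
  have "\<phi> (\<phi> (\<phi> \<xi>)) = 0" by (simp add: 0)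
  then have 1: "\<phi> \<xi> = \<eta> (\<phi> \<xi>) *\<^sub>R \<xi>" by (simp add: phi_phi[of "\<phi> \<xi>"])
  have "\<phi> (\<phi> \<xi>) = \<eta> (\<phi> \<xi>) *\<^sub>R \<phi> \<xi>" by (subst 1) simp
  then have "\<eta> (\<phi> \<xi>) *\<^sub>R \<phi> \<xi> = 0" using 0 by simp
  then show ?thesis using 1 by (metis scaleR_eq_0_iff)
qed

lemma eta_phi [simp]: "\<eta> (\<phi> u) = 0"
proof -
  have "\<phi> (\<phi> (\<phi> u)) = - \<phi> u" by (subst phi_phi[of u]) simp
  then have "\<eta> (\<phi> u) *\<^sub>R \<xi> = 0" by (simp add: phi_phi[of "\<phi> u"])
  then show ?thesis using xi_nonzero by simp
qed

lemma eta_eq: "\<eta> u = G u \<xi>"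
  using G_phi_phi[of u \<xi>] by simp

lemma G_xi_left: "G \<xi> u = \<eta> u"
  by (simp add: eta_eq G_sym)

lemma G_phi: "G (\<phi> u) v = - G u (\<phi> v)"
  using G_phi_phi[of u "\<phi> v"] by (simp add: phi_phi) (simp add: eta_eq[symmetric])

lemma G_phi_self: "G (\<phi> u) u = 0" "G u (\<phi> u) = 0"
  using G_phi[of u u] by (simp_all add: G_sym)

lemma phi_phi_horizontal: "\<eta> u = 0 \<Longrightarrow> \<phi> (\<phi> u) = - u"
  by (simp add: phi_phi)

lemma horizontal_part: "\<eta> (u - \<eta> u *\<^sub>R \<xi>) = 0"
  by simp

end

locale almost_contact_point5 = almost_contact_point G \<phi> \<xi> \<eta>
  for G :: "real ^ 5 \<Rightarrow> real ^ 5 \<Rightarrow> real" and \<phi> \<xi> \<eta>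
begin

sublocale euclidean_form G ..

text \<open>As \<open>orthonormal\<close> concerns sets, distinctness is recorded too: it yields the
  cardinality 5 and lets sums over the basis be written out.\<close>

lemma adapted_orthonormal:
  assumes "G e e = 1" "\<eta> e = 0" "G f f = 1" "\<eta> f = 0" "G e f = 0" "G (\<phi> e) f = 0"
  shows "orthonormal {e, \<phi> e, f, \<phi> f, \<xi>}" and "distinct [e, \<phi> e, f, \<phi> f, \<xi>]"
proof -
  have G: "G \<xi> \<xi> = 1" "G (\<phi> e) (\<phi> e) = 1" "G (\<phi> f) (\<phi> f) = 1" "G e \<xi> = 0" "G f \<xi> = 0"
    "G (\<phi> e) \<xi> = 0" "G (\<phi> f) \<xi> = 0" "G e (\<phi> f) = 0" "G (\<phi> e) (\<phi> f) = 0"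
    "G e (\<phi> e) = 0" "G f (\<phi> f) = 0"
    using assms G_phi[of e f] by (simp_all add: G_phi_phi G_phi_self flip: eta_eq)
  have "orthonormal {}" by (simp add: orthonormal_def)
  then show "orthonormal {e, \<phi> e, f, \<phi> f, \<xi>}"
    by (intro orthonormal_insert) (use G assms in auto)
  show "distinct [e, \<phi> e, f, \<phi> f, \<xi>]"
    using G assms by (auto simp: G_sym)
qed

lemma adapted_expansion:
  assumes "G e e = 1" "\<eta> e = 0" "G f f = 1" "\<eta> f = 0" "G e f = 0" "G (\<phi> e) f = 0"
  shows "u = G u e *\<^sub>R e + G u (\<phi> e) *\<^sub>R \<phi> e + G u f *\<^sub>R f + G u (\<phi> f) *\<^sub>R \<phi> f + \<eta> u *\<^sub>R \<xi>"
  using orthonormal_expansion[OF adapted_orthonormal(1)[OF assms], of u]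
    adapted_orthonormal(2)[OF assms]
  by (simp add: eta_eq add.assoc)

lemma ex_unit_horizontal:
  obtains e where "G e e = 1" "\<eta> e = 0"
proof -
  have "orthonormal {\<xi>}" by (simp add: orthonormal_def flip: eta_eq)
  then show thesis by (rule orthonormal_extend) (auto simp: eta_eq intro: that)
qed

lemma ex_adapted:
  assumes "G e e = 1" "\<eta> e = 0"
  obtains f where "G f f = 1" "\<eta> f = 0" "G e f = 0" "G (\<phi> e) f = 0"
proof -
  have "orthonormal {}" by (simp add: orthonormal_def)
  then have "orthonormal {e, \<phi> e, \<xi>}"
    by (intro orthonormal_insert) (use assms in \<open>auto simp: G_phi_phi G_phi_self simp flip: eta_eq\<close>)
  moreover have "card {e, \<phi> e, \<xi>} < CARD(5)"
    using card_insert_le_m1[of 3 "{\<phi> e, \<xi>}" e] card_insert_le_m1[of 2 "{\<xi>}" "\<phi> e"] by simp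
  ultimately show thesis
    by (rule orthonormal_extend) (auto simp: eta_eq G_sym intro: that)
qed

end

subsection \<open>The covariant derivatives of the structure tensors\<close>

text \<open>\<open>T\<close>, \<open>h\<close> and \<open>H\<close> stand for \<open>\<nabla>\<phi>\<close>, \<open>\<nabla>\<xi>\<close> and \<open>\<nabla>h\<close>.\<close>

locale nearly_cosymplectic_point = almost_contact_point5 G \<phi> \<xi> \<eta>
  for G :: "real ^ 5 \<Rightarrow> real ^ 5 \<Rightarrow> real" and \<phi> \<xi> \<eta> +
  fixes h :: "real ^ 5 \<Rightarrow> real ^ 5" and T :: "real ^ 5 \<Rightarrow> real ^ 5 \<Rightarrow> real ^ 5"
  assumes linear_h: "linear h"
    and bilinear_T: "bilinear T"
    and T_skew: "T u v = - T v u"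
    and G_T: "G (T u v) w = - G v (T u w)"
    and T_phi: "T u (\<phi> v) + \<phi> (T u v) = G (h u) v *\<^sub>R \<xi> + \<eta> v *\<^sub>R h u"
    and eta_h [simp]: "\<eta> (h u) = 0"
begin

lemmas h_simps [simp] =
  linear_add[OF linear_h] linear_diff[OF linear_h] linear_neg[OF linear_h]
  linear_0[OF linear_h] linear_cmul[OF linear_h]

lemmas T_simps [simp] =
  bilinear_ladd[OF bilinear_T] bilinear_radd[OF bilinear_T]
  bilinear_lsub[OF bilinear_T] bilinear_rsub[OF bilinear_T]
  bilinear_lneg[OF bilinear_T] bilinear_rneg[OF bilinear_T]
  bilinear_lzero[OF bilinear_T] bilinear_rzero[OF bilinear_T]
  bilinear_lmul[OF bilinear_T] bilinear_rmul[OF bilinear_T]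

lemma T_self [simp]: "T u u = 0"
  using arg_cong[OF T_skew[of u u], of "\<lambda>t. G t w" for w] by (intro G_eqI) simp

text \<open>Since \<open>T\<close> is alternating, \<open>T_phi\<close> at \<xi>, \<xi> leaves only
  h \<xi>. Geometrically, the integral curves of \<xi> are geodesics.\<close>

lemma h_xi [simp]: "h \<xi> = 0"
  using T_phi[of \<xi> \<xi>] by (simp flip: eta_eq)

lemma eta_T_self: "\<eta> (T u \<xi>) = 0"
  using G_T[of u \<xi> \<xi>] by (simp add: eta_eq G_sym)

lemma T_xi: "T u \<xi> = - \<phi> (h u)"
proof -
  have "\<phi> (T u \<xi>) = h u" using T_phi[of u \<xi>] by (simp flip: eta_eq)
  then have "\<phi> (h u) = - T u \<xi>" by (metis phi_phi_horizontal eta_T_self)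
  then show ?thesis by simp
qed

lemma T_xi_left: "T \<xi> u = \<phi> (h u)"
  using T_skew[of \<xi> u] T_xi by simp

lemma h_phi: "h (\<phi> u) = - \<phi> (h u)"
proof -
  have "\<phi> (h (\<phi> u)) = h u"
    using T_phi[of \<xi> u] by (simp add: T_xi_left phi_phi_horizontal)
  then show ?thesis by (metis phi_phi_horizontal eta_h minus_minus)
qed

lemma G_phi_h: "G (\<phi> (h u)) v = - G u (\<phi> (h v))"
  using G_T[of \<xi> u v] by (simp add: T_xi_left)

text \<open>That is, \<xi> is a Killing field. Skewness is first known for \<phi>h, where it is that
  of \<open>T\<close> at \<xi>, and passes to \<open>h\<close> because \<open>h\<close> anticommutes
  with \<phi>.\<close>

lemma G_h: "G (h u) v = - G u (h v)"
proof -
  have "G (h u) (\<phi> (\<phi> v)) = - G (\<phi> (h u)) (\<phi> v)" by (simp add: G_phi)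
  also have "\<dots> = G u (\<phi> (h (\<phi> v)))" by (simp add: G_phi_h)
  also have "\<dots> = - G u (\<phi> (\<phi> (h v)))" by (simp add: h_phi)
  also have "\<dots> = G u (h v)" by (simp add: phi_phi_horizontal)
  finally show ?thesis by (simp add: phi_phi) (simp flip: eta_eq)
qed

lemma G_h_self: "G (h u) u = 0" "G (\<phi> (h u)) u = 0"
  using G_h[of u u] G_phi_h[of u u] by (simp_all add: G_sym)

text \<open>On ker \<eta> the right-hand side of \<open>T_phi\<close> is a multiple of \<xi>, so
  \<phi> moves from the second slot to the third; alternation moves it to the first. This is complex
  multilinearity of the three-form.\<close>

lemma T_horizontal_phi:
  assumes "\<eta> u = 0" "\<eta> v = 0" "\<eta> w = 0"
  shows "G (T (\<phi> u) v) w = G (T u (\<phi> v)) w" and "G (T u (\<phi> v)) w = G (T u v) (\<phi> w)"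
proof -
  have *: "G (T a (\<phi> b)) c = G (T a b) (\<phi> c)" if "\<eta> a = 0" "\<eta> b = 0" "\<eta> c = 0" for a b c
  proof -
    have "G (T a (\<phi> b) + \<phi> (T a b)) c = G (G (h a) b *\<^sub>R \<xi> + \<eta> b *\<^sub>R h a) c"
      by (simp only: T_phi)
    then show ?thesis using that by (simp add: G_phi G_xi_left)
  qed
  show "G (T u (\<phi> v)) w = G (T u v) (\<phi> w)" by (rule *[OF assms])
  have "G (T (\<phi> u) v) w = - G (T v (\<phi> u)) w" by (subst T_skew) simp
  also have "\<dots> = - G (T v u) (\<phi> w)" using * assms by simp
  also have "\<dots> = G (T u v) (\<phi> w)" by (subst T_skew) simp
  finally show "G (T (\<phi> u) v) w = G (T u (\<phi> v)) w" using * assms by simp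
qed

lemma T_phi_self:
  assumes "\<eta> u = 0" "\<eta> w = 0"
  shows "G (T u (\<phi> u)) w = 0"
proof -
  have "T (\<phi> u) u = - T u (\<phi> u)" by (rule T_skew)
  then show ?thesis
    using T_horizontal_phi(1)[of u u w] assms by simp
qed

text \<open>Any three of e, \<phi> e, f, \<phi> f include a pair x, \<phi> x, and by
  \<open>T_phi_self\<close> the three-form vanishes on such a triple.\<close>

lemma T_horizontal_unit:
  assumes e: "G e e = 1" "\<eta> e = 0" and v: "\<eta> v = 0" and w: "\<eta> w = 0"
  shows "G (T e v) w = 0"
proof -
  obtain f where f: "G f f = 1" "\<eta> f = 0" "G e f = 0" "G (\<phi> e) f = 0"
    by (rule ex_adapted[OF e])
  have 1: "G (T e (\<phi> e)) z = 0" if "\<eta> z = 0" for z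
    by (rule T_phi_self[OF e(2) that])
  have cyc: "G (T a b) c = G (T c a) b" for a b c
    using G_T[of a b c] T_skew[of a c] by (simp add: G_sym)
  have flip: "G (T a b) c = - G (T a c) b" for a b c
    using G_T[of a b c] by (simp add: G_sym)
  have z: "G (T e f) e = 0" "G (T e f) f = 0" "G (T e (\<phi> f)) e = 0" "G (T e (\<phi> f)) (\<phi> f) = 0"
    "G (T e f) (\<phi> e) = 0" "G (T e (\<phi> f)) (\<phi> e) = 0"
    "G (T e f) (\<phi> f) = 0" "G (T e (\<phi> f)) f = 0"
    using flip[of e f e] flip[of e f f] flip[of e "\<phi> f" e] flip[of e "\<phi> f" "\<phi> f"]
      flip[of e f "\<phi> e"] flip[of e "\<phi> f" "\<phi> e"] 1[of f] 1[of "\<phi> f"]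
      cyc[of e f "\<phi> f"] cyc[of "\<phi> f" e f] flip[of e "\<phi> f" f] T_phi_self[OF f(2) e(2)] f(2)
    by simp_all
  have ve: "v = G v e *\<^sub>R e + G v (\<phi> e) *\<^sub>R \<phi> e + G v f *\<^sub>R f + G v (\<phi> f) *\<^sub>R \<phi> f"
    and we: "w = G w e *\<^sub>R e + G w (\<phi> e) *\<^sub>R \<phi> e + G w f *\<^sub>R f + G w (\<phi> f) *\<^sub>R \<phi> f"
    using adapted_expansion[OF e f] v w by (metis add.right_neutral scaleR_zero_left)+
  show ?thesis
    by (subst ve, subst we) (simp add: z 1 e f)
qed

text \<open>This is the pointwise reason why nearly Kaehler four-manifolds are Kaehler.\<close>

lemma T_horizontal:
  assumes "\<eta> u = 0" "\<eta> v = 0" "\<eta> w = 0"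
  shows "G (T u v) w = 0"
proof (cases "u = 0")
  case False
  let ?s = "1 / sqrt (G u u)"
  have "G (T (?s *\<^sub>R u) v) w = 0"
    by (rule T_horizontal_unit[OF G_normalise[OF False]]) (use assms in auto)
  then show ?thesis using G_pos[OF False] by simp
qed simp

text \<open>After splitting all three arguments into a horizontal part and a multiple of \<xi>, the
  purely horizontal term vanishes and \<open>T_xi\<close> gives the terms with \<xi> in one
  slot.\<close>

lemma T_eq: "T u v = \<eta> u *\<^sub>R \<phi> (h v) - \<eta> v *\<^sub>R \<phi> (h u) + G (\<phi> (h u)) v *\<^sub>R \<xi>"
proof (rule G_eqI)
  fix w
  let ?u = "u - \<eta> u *\<^sub>R \<xi>" and ?v = "v - \<eta> v *\<^sub>R \<xi>" and ?w = "w - \<eta> w *\<^sub>R \<xi>"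
  have 0: "G (T ?u ?v) ?w = 0" by (rule T_horizontal) simp_all
  have "G (T u v) \<xi> = G (\<phi> (h u)) v"
    using G_T[of u v \<xi>] by (simp add: T_xi G_sym)
  then show "G (T u v) w = G (\<eta> u *\<^sub>R \<phi> (h v) - \<eta> v *\<^sub>R \<phi> (h u) + G (\<phi> (h u)) v *\<^sub>R \<xi>) w"
    using 0 by (simp add: T_xi T_xi_left G_xi_left) (simp add: algebra_simps flip: eta_eq)
qed

text \<open>Skewness of \<open>h\<close> and of \<phi>h makes h e orthogonal to e and \<phi> e,
  hence h e = a f + b \<phi> f. Skewness then determines h f, anticommutation the rest, and m = a^2
  + b^2.\<close>

lemma h_h:
  obtains m where "m \<ge> 0" "\<And>u. h (h u) = - m *\<^sub>R (u - \<eta> u *\<^sub>R \<xi>)"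
proof -
  obtain e where e: "G e e = 1" "\<eta> e = 0" by (rule ex_unit_horizontal)
  obtain f where f: "G f f = 1" "\<eta> f = 0" "G e f = 0" "G (\<phi> e) f = 0"
    by (rule ex_adapted[OF e])
  note exp = adapted_expansion[OF e f]
  define a b where "a = G (h e) f" and "b = G (h e) (\<phi> f)"
  have phe: "G (h e) (\<phi> e) = 0" "G (h f) (\<phi> f) = 0" for e f
    using G_h_self(2)[of e] G_h_self(2)[of f] by (simp_all add: G_phi)
  have he: "h e = a *\<^sub>R f + b *\<^sub>R \<phi> f"
    using exp[of "h e"] by (simp add: G_h_self phe a_def b_def)
  have "G (h f) e = - a" using G_h[of f e] by (simp add: a_def G_sym)
  moreover have "G (h f) (\<phi> e) = - b"
    using G_h[of f "\<phi> e"] G_phi[of f "h e"] by (simp add: b_def h_phi G_sym)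
  ultimately have hf: "h f = - a *\<^sub>R e - b *\<^sub>R \<phi> e"
    using exp[of "h f"] by (simp add: G_h_self phe)
  have hhe: "h (h e) = - (a * a + b * b) *\<^sub>R e" and hhf: "h (h f) = - (a * a + b * b) *\<^sub>R f"
    using e f by (simp_all add: he hf h_phi phi_phi_horizontal algebra_simps)
  have hhp: "h (h (\<phi> u)) = \<phi> (h (h u))" for u by (simp add: h_phi)
  show thesis
  proof (rule that)
    show "0 \<le> a * a + b * b" by simp
    fix u
    have "h (h u) = G u e *\<^sub>R h (h e) + G u (\<phi> e) *\<^sub>R \<phi> (h (h e)) + G u f *\<^sub>R h (h f) + G u (\<phi> f) *\<^sub>R \<phi> (h (h f))"
      by (subst exp[of u]) (simp add: hhp)
    also have "\<dots> = - (a * a + b * b) *\<^sub>R (G u e *\<^sub>R e + G u (\<phi> e) *\<^sub>R \<phi> e + G u f *\<^sub>R f + G u (\<phi> f) *\<^sub>R \<phi> f)"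
      by (simp add: hhe hhf algebra_simps)
    also have "G u e *\<^sub>R e + G u (\<phi> e) *\<^sub>R \<phi> e + G u f *\<^sub>R f + G u (\<phi> f) *\<^sub>R \<phi> f = u - \<eta> u *\<^sub>R \<xi>"
      using exp[of u] by (metis add_diff_cancel_right')
    finally show "h (h u) = - (a * a + b * b) *\<^sub>R (u - \<eta> u *\<^sub>R \<xi>)" .
  qed
qed

end

section \<open>Algebraic curvature tensors\<close>

locale curvature_form = inner_form G
  for G :: "'v::real_vector \<Rightarrow> 'v \<Rightarrow> real" +
  fixes R :: "'v \<Rightarrow> 'v \<Rightarrow> 'v \<Rightarrow> 'v"
  assumes R_skew: "R u v w = - R v u w"
    and G_R: "G (R u v w) z = - G w (R u v z)"
    and R_bianchi: "R u v w + R v w u + R w u v = 0"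
    and linear_R1: "linear (\<lambda>u. R u v w)"
    and linear_R3: "linear (\<lambda>w. R u v w)"
begin

lemma linear_R2: "linear (\<lambda>v. R u v w)"
  unfolding R_skew[of u _ w] by (rule linear_compose_neg[OF linear_R1])

lemmas R_simps [simp] =
  linear_add[OF linear_R1] linear_diff[OF linear_R1] linear_neg[OF linear_R1]
  linear_0[OF linear_R1] linear_cmul[OF linear_R1]
  linear_add[OF linear_R2] linear_diff[OF linear_R2] linear_neg[OF linear_R2]
  linear_0[OF linear_R2] linear_cmul[OF linear_R2]
  linear_add[OF linear_R3] linear_diff[OF linear_R3] linear_neg[OF linear_R3]
  linear_0[OF linear_R3] linear_cmul[OF linear_R3]

lemma R_self [simp]: "R u u w = 0"
  using arg_cong[OF R_skew[of u u w], of "\<lambda>t. G t z" for z] by (intro G_eqI) simp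

lemma G_R_skew: "G (R u v w) z = - G (R v u w) z" "G (R u v w) z = - G (R u v z) w"
  using arg_cong[OF R_skew[of u v w], of "\<lambda>t. G t z"] G_R[of u v w z] by (simp_all add: G_sym)

lemma G_R_bianchi: "G (R u v w) z + G (R v w u) z + G (R w u v) z = 0"
  using arg_cong[OF R_bianchi[of u v w], of "\<lambda>t. G t z"] by simp

text \<open>The four Bianchi sums obtained by rotating \<open>u\<close>, \<open>v\<close>,
  \<open>w\<close>, \<open>z\<close> combine, after the two skew symmetries, to this
  symmetry.\<close>

lemma G_R_pair: "G (R u v w) z = G (R w z u) v"
  using G_R_bianchi[of u v w z] G_R_bianchi[of v w z u] G_R_bianchi[of w z u v] G_R_bianchi[of z u v w]
    G_R_skew(1)[of u v w z] G_R_skew(1)[of v w u z] G_R_skew(1)[of w u v z]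
    G_R_skew(2)[of u v w z] G_R_skew(2)[of v w u z] G_R_skew(2)[of w u v z]
    G_R_skew(1)[of w z u v] G_R_skew(2)[of w z u v] G_R_skew(2)[of z u v w] G_R_skew(1)[of z u v w]
    G_R_skew(1)[of z v w u] G_R_skew(2)[of v w z u] G_R_skew(1)[of z v u w] G_R_skew(2)[of z v w u]
    G_R_skew(1)[of u w z v] G_R_skew(2)[of u w z v] G_R_skew(1)[of u w v z] G_R_skew(2)[of z u w v]
  by linarith

end

text \<open>The assumption \<open>R_phi\<close> is the Ricci identity for \<open>\<nabla>\<^sup>2 \<phi>\<close>, where \<open>\<nabla>\<phi>\<close> has been replaced by the
  expression \<open>T_eq\<close> before differentiating it again; \<open>\<phi> (H u w) + T u (h w)\<close> is \<open>\<nabla>(\<phi>h)\<close>.\<close>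

locale nearly_cosymplectic_curvature =
  nearly_cosymplectic_point G \<phi> \<xi> \<eta> h T + curvature_form G R
  for G :: "real ^ 5 \<Rightarrow> real ^ 5 \<Rightarrow> real" and \<phi> \<xi> \<eta> h T R +
  fixes H :: "real ^ 5 \<Rightarrow> real ^ 5 \<Rightarrow> real ^ 5"
  assumes G_H: "G (H u v) w = - G v (H u w)"
    and R_xi: "R u v \<xi> = H u v - H v u"
    and H_xi: "H u \<xi> = - h (h u)"
    and eta_H: "\<eta> (H u v) = - G (h v) (h u)"
    and H_phi: "H u (\<phi> v) + \<phi> (H u v) + h (T u v) + T u (h v) = 0"
    and R_phi: "R u v (\<phi> w) - \<phi> (R u v w) =
      (G (h u) v *\<^sub>R \<phi> (h w) + \<eta> v *\<^sub>R (\<phi> (H u w) + T u (h w))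
        - G (h u) w *\<^sub>R \<phi> (h v) - \<eta> w *\<^sub>R (\<phi> (H u v) + T u (h v))
        + G (\<phi> (H u v) + T u (h v)) w *\<^sub>R \<xi> + G (\<phi> (h v)) w *\<^sub>R h u)
      - (G (h v) u *\<^sub>R \<phi> (h w) + \<eta> u *\<^sub>R (\<phi> (H v w) + T v (h w))
        - G (h v) w *\<^sub>R \<phi> (h u) - \<eta> w *\<^sub>R (\<phi> (H v u) + T v (h u))
        + G (\<phi> (H v u) + T v (h u)) w *\<^sub>R \<xi> + G (\<phi> (h u)) w *\<^sub>R h v)"
begin

text \<open>The usual identity for Killing fields. Bianchi's identity together with
  \<open>R_xi\<close> and skewness of \<open>H u\<close> makes the cyclic sum of G (H u v) w vanish;
  \<open>R_xi\<close> then expresses G (R v w \<xi>) u by two of its summands, that is, by minus the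
  third.\<close>

lemma R_xi_eq_H: "R u \<xi> v = H u v"
proof (rule G_eqI)
  fix w
  have eq: "G (R a b \<xi>) c = G (H a b) c - G (H b a) c" for a b c
    by (simp add: R_xi)
  have sk: "G (H a b) c = - G (H a c) b" for a b c
    using G_H[of a b c] by (simp add: G_sym)
  have sum: "G (R a b \<xi>) c + G (R b c \<xi>) a + G (R c a \<xi>) b = 0" for a b c
    using G_R_bianchi[of a b c \<xi>] G_R_skew(2)[of a b \<xi> c] G_R_skew(2)[of b c \<xi> a] G_R_skew(2)[of c a \<xi> b]
    by linarith
  have "G (R u \<xi> v) w = G (R v w u) \<xi>" by (rule G_R_pair)
  also have "\<dots> = - G (R v w \<xi>) u" by (rule G_R_skew)
  also have "\<dots> = G (H u v) w"
    using sum[of v w u] eq[of v w u] eq[of w u v] eq[of u v w]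
      sk[of v w u] sk[of w u v] sk[of u v w] by linarith
  finally show "G (R u \<xi> v) w = G (H u v) w" .
qed

text \<open>In horizontal components the Ricci identity \<open>R_phi\<close> at \<xi>, u gives H u
  (\<phi> v) = 2 \<phi> (H u v), while \<open>H_phi\<close> gives H u (\<phi> v) = - \<phi> (H u v).
  Hence 3 \<phi> (H u v) = 0 there.\<close>

lemma H_horizontal:
  assumes "\<eta> u = 0" "\<eta> v = 0" "\<eta> w = 0"
  shows "G (H u v) w = 0"
proof -
  have *: "G (H u v) (\<phi> z) = 0" if z: "\<eta> z = 0" for z
  proof -
    have Rxi: "R \<xi> u a = - H u a" for a
      using R_skew[of \<xi> u a] R_xi_eq_H by simp
    have "G (R \<xi> u (\<phi> v) - \<phi> (R \<xi> u v)) z = - G (\<phi> (H u v)) z"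
      unfolding R_phi using assms z
      by (simp add: G_xi_left T_horizontal) (simp flip: eta_eq)
    then have 1: "- G (H u (\<phi> v)) z + G (\<phi> (H u v)) z = - G (\<phi> (H u v)) z"
      by (simp add: Rxi)
    have "H u (\<phi> v) + \<phi> (H u v) = - (h (T u v) + T u (h v))"
      unfolding eq_neg_iff_add_eq_0 using H_phi[of u v] by (simp add: add.assoc)
    moreover have "T u v = G (\<phi> (h u)) v *\<^sub>R \<xi>" "T u (h v) = G (\<phi> (h u)) (h v) *\<^sub>R \<xi>"
      using assms by (simp_all add: T_eq)
    ultimately have "G (H u (\<phi> v) + \<phi> (H u v)) z = 0"
      using z by (simp add: G_xi_left)
    with 1 show ?thesis by (simp add: G_phi)
  qed
  have "G (H u v) (\<phi> (\<phi> w)) = 0" by (rule *) simp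
  then show ?thesis using assms by (simp add: phi_phi_horizontal)
qed

lemma H_eq: "H u v = G (h (h u)) v *\<^sub>R \<xi> - \<eta> v *\<^sub>R h (h u)"
proof (rule G_eqI)
  fix w
  let ?u = "u - \<eta> u *\<^sub>R \<xi>" and ?v = "v - \<eta> v *\<^sub>R \<xi>" and ?w = "w - \<eta> w *\<^sub>R \<xi>"
  have 0: "G (H ?u ?v) ?w = 0" by (rule H_horizontal) simp_all
  have Hu: "H ?u a = H u a" for a by (simp flip: R_xi_eq_H)
  have Hv: "H u (a - k *\<^sub>R b) = H u a - k *\<^sub>R H u b" for a b k by (simp flip: R_xi_eq_H)
  have "G (H u v) \<xi> = - G (h v) (h u)" by (simp add: eta_H flip: eta_eq)
  also have "\<dots> = G (h (h u)) v" using G_h[of "h u" v] by (simp add: G_sym)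
  finally have "G (H u v) \<xi> = G (h (h u)) v" .
  then show "G (H u v) w = G (G (h (h u)) v *\<^sub>R \<xi> - \<eta> v *\<^sub>R h (h u)) w"
    using 0 by (simp add: Hu Hv H_xi G_xi_left) (simp add: algebra_simps flip: eta_eq)
qed

end


subsection \<open>The Ricci tensor\<close>

text \<open>\<open>m\<close> is \<lambda>^2 and \<open>R_h\<close> is the Ricci identity for
  \<open>h\<close> with \<open>H_eq\<close> inserted. Its right-hand side has no derivative of
  \<open>m\<close>, so constancy of \<lambda>^2 is built into this assumption.\<close>

locale nearly_cosymplectic_einstein =
  nearly_cosymplectic_curvature G \<phi> \<xi> \<eta> h T R H
  for G :: "real ^ 5 \<Rightarrow> real ^ 5 \<Rightarrow> real" and \<phi> \<xi> \<eta> h T R H +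
  fixes m :: real
  assumes m_pos: "m > 0"
    and h_square: "h (h u) = - m *\<^sub>R (u - \<eta> u *\<^sub>R \<xi>)"
    and R_h: "R u v (h w) - h (R u v w) =
      m *\<^sub>R (G (h u) w *\<^sub>R v - G v w *\<^sub>R h u) - m *\<^sub>R (G (h v) w *\<^sub>R u - G u w *\<^sub>R h v)"
begin

definition ric :: "real ^ 5 \<Rightarrow> real ^ 5 \<Rightarrow> real" where
  "ric v w = trace (matrix (\<lambda>u. R u v w))"

lemma ric_orthonormal:
  "orthonormal B \<Longrightarrow> card B = 5 \<Longrightarrow> ric v w = (\<Sum>b\<in>B. G (R b v w) b)"
  unfolding ric_def by (simp add: trace_orthonormal linear_R1)

lemma ex_orthonormal_basis:
  obtains B where "orthonormal B" "card B = 5"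
proof -
  obtain e where e: "G e e = 1" "\<eta> e = 0" by (rule ex_unit_horizontal)
  obtain f where f: "G f f = 1" "\<eta> f = 0" "G e f = 0" "G (\<phi> e) f = 0"
    by (rule ex_adapted[OF e])
  show thesis
    by (rule that[OF adapted_orthonormal(1)[OF e f]]) (use adapted_orthonormal(2)[OF e f] in simp)
qed

lemma ric_sym: "ric v w = ric w v"
proof -
  obtain B where B: "orthonormal B" "card B = 5" by (rule ex_orthonormal_basis)
  have "G (R b v w) b = G (R b w v) b" for b
    using G_R_pair[of b v w b] G_R_skew[of w b b v] G_R_skew[of w b v b] by linarith
  then show ?thesis by (simp add: ric_orthonormal[OF B])
qed

lemma ric_linear [simp]:
  "ric (u + v) w = ric u w + ric v w" "ric u (v + w) = ric u v + ric u w"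
  "ric (c *\<^sub>R u) v = c * ric u v" "ric u (c *\<^sub>R v) = c * ric u v"
proof -
  obtain B where B: "orthonormal B" "card B = 5" by (rule ex_orthonormal_basis)
  show "ric (u + v) w = ric u w + ric v w" "ric u (v + w) = ric u v + ric u w"
    "ric (c *\<^sub>R u) v = c * ric u v" "ric u (c *\<^sub>R v) = c * ric u v"
    by (simp_all add: ric_orthonormal[OF B] sum.distrib sum_distrib_left)
qed

text \<open>R b v \<xi> has the form it has in constant curvature \<open>m\<close>; each of the four
  horizontal basis vectors contributes m \<eta>(v), and \<xi> contributes nothing.\<close>

lemma ric_xi: "ric v \<xi> = 4 * m * \<eta> v"
proof -
  obtain e where e: "G e e = 1" "\<eta> e = 0" by (rule ex_unit_horizontal)
  obtain f where f: "G f f = 1" "\<eta> f = 0" "G e f = 0" "G (\<phi> e) f = 0"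
    by (rule ex_adapted[OF e])
  have "R b v \<xi> = m *\<^sub>R (\<eta> v *\<^sub>R b - \<eta> b *\<^sub>R v)" for b
    using G_h[of "h b" v] G_h[of b "h v"]
    by (simp add: R_xi H_eq h_square algebra_simps G_sym flip: eta_eq)
  then show ?thesis
    using adapted_orthonormal(2)[OF e f] e f
    by (subst ric_orthonormal[OF adapted_orthonormal(1)[OF e f]])
      (simp_all add: G_phi_phi flip: eta_eq)
qed

text \<open>The curvature \<open>R - R\<^sub>0\<close>, where \<open>R\<^sub>0\<close> has constant sectional curvature \<open>m\<close>, commutes with
  \<open>\<phi>\<close> and \<open>h\<close> on \<open>ker \<eta>\<close>; like for hyperkaehler manifolds, Bianchi's identity then gives Ricci-flatness.\<close>

lemma ric_unit:
  assumes e: "G e e = 1" "\<eta> e = 0"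
  shows "ric e e = 4 * m"
proof -
  \<comment> \<open>As h e has length sqrt m, the vector \<open>f\<close> is a unit vector, and e,
    \<phi> e, f, \<phi> f are e and its images under the quaternionic structure. Keeping
    \<open>k\<close> and \<open>l\<close> unnormalised frees the relations below from square
    roots.\<close>
  define k l f where "k = h e" and "l = \<phi> k" and "f = (1 / sqrt m) *\<^sub>R k"
  have eta: "\<eta> k = 0" "\<eta> l = 0" by (simp_all add: k_def l_def)
  have hk: "h k = - m *\<^sub>R e" "h l = m *\<^sub>R \<phi> e" "h (\<phi> e) = - l" "\<phi> l = - k"
    using e by (simp_all add: k_def l_def h_square h_phi phi_phi_horizontal)
  have G: "G e k = 0" "G k e = 0" "G e l = 0" "G l e = 0" "G k l = 0" "G l k = 0" "G k k = m" "G l l = m"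
    "G e (\<phi> e) = 0" "G (\<phi> e) e = 0" "G (\<phi> e) k = 0" "G k (\<phi> e) = 0" "G (\<phi> e) l = 0" "G l (\<phi> e) = 0"
    "G (\<phi> e) (\<phi> e) = 1"
  proof -
    show "G k e = 0" "G l e = 0" by (simp_all add: k_def l_def G_h_self)
    then show "G e k = 0" "G e l = 0" by (simp_all add: G_sym)
    show "G l k = 0" "G k l = 0" by (simp_all add: l_def G_phi_self)
    have "G k k = - G e (h k)" unfolding k_def by (rule G_h)
    then show "G k k = m" using e by (simp add: hk)
    then show "G l l = m" using eta by (simp add: l_def G_phi_phi)
    show "G e (\<phi> e) = 0" "G (\<phi> e) e = 0" by (simp_all add: G_phi_self)
    show "G (\<phi> e) (\<phi> e) = 1" using e by (simp add: G_phi_phi)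
    show "G (\<phi> e) k = 0" using \<open>G e l = 0\<close> by (simp add: G_phi l_def)
    then show "G k (\<phi> e) = 0" by (simp add: G_sym)
    show "G (\<phi> e) l = 0" using \<open>G e k = 0\<close> eta by (simp add: l_def G_phi_phi)
    then show "G l (\<phi> e) = 0" by (simp add: G_sym)
  qed
  have kd: "h e = k" "\<phi> k = l" by (simp_all add: k_def l_def)
  have f: "G f f = 1" "\<eta> f = 0" "G e f = 0" "G (\<phi> e) f = 0"
    using m_pos eta by (simp_all add: f_def G)
  have "ric e e = G (R (\<phi> e) e e) (\<phi> e) + G (R f e e) f + G (R (\<phi> f) e e) (\<phi> f) + G (R \<xi> e e) \<xi>"
    using adapted_orthonormal(2)[OF e f]
    by (subst ric_orthonormal[OF adapted_orthonormal(1)[OF e f]]) (simp_all add: add.assoc)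
  also have "G (R f e e) f = G (R k e e) k / m"
    using m_pos by (simp add: f_def)
  also have "G (R (\<phi> f) e e) (\<phi> f) = G (R l e e) l / m"
    using m_pos by (simp add: f_def kd)
  also have "G (R \<xi> e e) \<xi> = m"
    using R_skew[of \<xi> e e] e by (simp add: R_xi_eq_H H_eq h_square flip: eta_eq)
  finally have ric: "ric e e = G (R (\<phi> e) e e) (\<phi> e) + G (R k e e) k / m + G (R l e e) l / m + m" .
  have hG: "G (h a) l = - m * G a (\<phi> e)" for a
    using G_h[of a l] by (simp add: hk)
  \<comment> \<open>In \<open>1\<close>, \<open>2\<close> and \<open>3\<close> the commutator of the
    curvature with \<open>h\<close> or \<phi> is paired with \<open>l\<close> or \<open>k\<close> up
    to sign. Each links one sectional curvature term in the sum for \<open>ric e e\<close> to one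
    mixed term.\<close>
  have 1: "- G (R (\<phi> e) e k) l - m * G (R (\<phi> e) e e) (\<phi> e) = - (m * m)"
  proof -
    have "G (R (\<phi> e) e (h e) - h (R (\<phi> e) e e)) (- l) = - (m * m)"
      unfolding R_h using e by (simp add: kd hk G)
    then show ?thesis by (simp add: kd hG)
  qed
  have 2: "G (R k e (\<phi> e)) l - G (R k e e) k = - (m * m)"
  proof -
    have "G (R k e (\<phi> e) - \<phi> (R k e e)) l = - (m * m)"
      unfolding R_phi using e by (simp add: kd hk G H_eq T_eq eta G_xi_left phi_phi_horizontal)
    then show ?thesis by (simp add: G_phi hk)
  qed
  have 3: "- G (R l e (\<phi> e)) k - G (R l e e) l = - (m * m)"
  proof -
    have "G (R l e (\<phi> e) - \<phi> (R l e e)) (- k) = - (m * m)"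
      unfolding R_phi using e by (simp add: kd hk G H_eq T_eq eta G_xi_left phi_phi_horizontal)
    then show ?thesis by (simp add: G_phi kd)
  qed
  \<comment> \<open>The three mixed terms form a Bianchi sum, so adding \<open>1\<close>,
    \<open>2\<close> and \<open>3\<close> leaves only the terms of \<open>ric e e\<close>.\<close>
  have "- G (R (\<phi> e) e k) l + G (R k e (\<phi> e)) l - G (R l e (\<phi> e)) k = 0"
    using G_R_bianchi[of "\<phi> e" e k l] G_R_skew(1)[of k "\<phi> e" e l] G_R_skew[of e k "\<phi> e" l]
      G_R_pair[of l e "\<phi> e" k] G_R_skew(2)[of "\<phi> e" k l e] G_R_skew(1)[of k "\<phi> e" l e]
    by linarith
  with 1 2 3 have "m * G (R (\<phi> e) e e) (\<phi> e) + G (R k e e) k + G (R l e e) l = 3 * (m * m)"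
    by linarith
  then have "m * ric e e = m * (4 * m)"
    using m_pos unfolding ric by (simp add: field_simps)
  then show ?thesis using m_pos by simp
qed

text \<open>Scaling extends \<open>ric_unit\<close> to all horizontal vectors, and polarisation uses
  the symmetry of \<open>ric\<close>.\<close>

lemma ric_horizontal:
  assumes "\<eta> u = 0" "\<eta> v = 0"
  shows "ric u v = 4 * m * G u v"
proof -
  have *: "ric a a = 4 * m * G a a" if a: "\<eta> a = 0" for a
  proof (cases "a = 0")
    case True
    then show ?thesis using ric_linear(3)[of 0 0 0] by simp
  next
    case False
    let ?s = "1 / sqrt (G a a)"
    have "ric (?s *\<^sub>R a) (?s *\<^sub>R a) = 4 * m"
      by (rule ric_unit[OF G_normalise[OF False]]) (use a in simp)
    then show ?thesis using G_pos[OF False] by (simp add: field_simps)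
  qed
  have "ric (u + v) (u + v) = 4 * m * G (u + v) (u + v)"
    by (rule *) (use assms in simp)
  then show ?thesis
    using *[OF assms(1)] *[OF assms(2)] by (simp add: ric_sym[of v u] G_sym[of v u] algebra_simps)
qed

lemma ric_eq: "ric u v = 4 * m * G u v"
proof -
  let ?u = "u - \<eta> u *\<^sub>R \<xi>" and ?v = "v - \<eta> v *\<^sub>R \<xi>"
  have "ric (?u + \<eta> u *\<^sub>R \<xi>) (?v + \<eta> v *\<^sub>R \<xi>) = 4 * m * (G u v - \<eta> u * \<eta> v) + 4 * m * \<eta> u * \<eta> v"
    unfolding ric_linear ric_horizontal[OF horizontal_part horizontal_part] ric_xi ric_sym[of \<xi>]
    by (simp add: G_xi_left) (simp add: algebra_simps flip: eta_eq)
  then show ?thesis by (simp add: algebra_simps)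
qed

end

section \<open>Riemannian curvature\<close>

locale riemannian_manifold = manifold A
  for A :: "('a::{t2_space, second_countable_topology}, 'n::finite) chart set" +
  fixes g :: "'a \<Rightarrow> real ^ 'n \<Rightarrow> real ^ 'n \<Rightarrow> real"
    and D :: "('a, 'n) connection"
  assumes riemannian_metric: "riemannian_metric A g"
    and levi_civita: "levi_civita A g D"
begin

sublocale euclidean_form "g p" for p
  by unfold_locales (use riemannian_metric in \<open>auto simp: riemannian_metric_def\<close>)

lemma smooth_metric: "smooth_vf A X \<Longrightarrow> smooth_vf A Y \<Longrightarrow> smooth_fun A (\<lambda>p. g p (X p) (Y p))"
  using riemannian_metric by (simp add: riemannian_metric_def)

lemmas affine_connection = levi_civita[unfolded levi_civita_def affine_connection_def, THEN conjunct1]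

lemma smooth_D: "smooth_vf A X \<Longrightarrow> smooth_vf A Y \<Longrightarrow> smooth_vf A (D X Y)"
  by (rule affine_connection[THEN conjunct1, rule_format])

lemma D_add_left: "smooth_vf A X \<Longrightarrow> smooth_vf A Y \<Longrightarrow> smooth_vf A Z \<Longrightarrow>
    D (\<lambda>q. X q + Y q) Z p = D X Z p + D Y Z p"
  by (rule affine_connection[THEN conjunct2, THEN conjunct1, rule_format, THEN conjunct1, THEN spec])

lemma D_add_right: "smooth_vf A X \<Longrightarrow> smooth_vf A Y \<Longrightarrow> smooth_vf A Z \<Longrightarrow>
    D X (\<lambda>q. Y q + Z q) p = D X Y p + D X Z p"
  by (rule affine_connection[THEN conjunct2, THEN conjunct1, rule_format, THEN conjunct2, THEN spec])

lemma D_scale_left: "smooth_fun A f \<Longrightarrow> smooth_vf A X \<Longrightarrow> smooth_vf A Y \<Longrightarrow>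
    D (\<lambda>q. f q *\<^sub>R X q) Y p = f p *\<^sub>R D X Y p"
  by (rule affine_connection[THEN conjunct2, THEN conjunct2, rule_format, THEN conjunct1, THEN spec])

lemma D_scale_right: "smooth_fun A f \<Longrightarrow> smooth_vf A X \<Longrightarrow> smooth_vf A Y \<Longrightarrow>
    D X (\<lambda>q. f q *\<^sub>R Y q) p = f p *\<^sub>R D X Y p + vf_deriv A X f p *\<^sub>R Y p"
  by (rule affine_connection[THEN conjunct2, THEN conjunct2, rule_format, THEN conjunct2, THEN spec])

lemma torsion_free: "smooth_vf A X \<Longrightarrow> smooth_vf A Y \<Longrightarrow> lie_bracket A X Y p = D X Y p - D Y X p"
  by (rule levi_civita[unfolded levi_civita_def, THEN conjunct2, THEN conjunct1, rule_format, symmetric])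

lemma metric_compatible: "smooth_vf A X \<Longrightarrow> smooth_vf A Y \<Longrightarrow> smooth_vf A Z \<Longrightarrow>
    vf_deriv A X (\<lambda>q. g q (Y q) (Z q)) p = g p (D X Y p) (Z p) + g p (Y p) (D X Z p)"
  by (rule levi_civita[unfolded levi_civita_def, THEN conjunct2, THEN conjunct2, rule_format])

lemma vf_deriv_const: "vf_deriv A X (\<lambda>q. k) p = 0"
  by (simp add: vf_deriv_def Let_def o_def)

lemma D_cscale_right: "smooth_vf A X \<Longrightarrow> smooth_vf A Y \<Longrightarrow> D X (\<lambda>q. k *\<^sub>R Y q) p = k *\<^sub>R D X Y p"
  by (simp add: D_scale_right[OF smooth_fun_const] vf_deriv_const)

lemma D_cscale_left: "smooth_vf A X \<Longrightarrow> smooth_vf A Y \<Longrightarrow> D (\<lambda>q. k *\<^sub>R X q) Y p = k *\<^sub>R D X Y p"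
  by (simp add: D_scale_left[OF smooth_fun_const])

lemma D_diff_right:
  assumes "smooth_vf A X" "smooth_vf A Y" "smooth_vf A Z"
  shows "D X (\<lambda>q. Y q - Z q) p = D X Y p - D X Z p"
  using D_add_right[OF assms(1,2) smooth_vf_cscale[OF assms(3)], of "- 1"] D_cscale_right[OF assms(1,3), of "- 1"]
  by simp

lemma D_diff_left:
  assumes "smooth_vf A X" "smooth_vf A Y" "smooth_vf A Z"
  shows "D (\<lambda>q. X q - Y q) Z p = D X Z p - D Y Z p"
  using D_add_left[OF assms(1) smooth_vf_cscale[OF assms(2)] assms(3), of "- 1"] D_cscale_left[OF assms(2,3), of "- 1"]
  by simp

lemma D_zero_right: "smooth_vf A X \<Longrightarrow> D X (\<lambda>q. 0) p = 0"
  using D_cscale_right[OF _ smooth_vf_zero, of X 0] by simp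

lemma D_sum_right:
  "smooth_vf A X \<Longrightarrow> (\<And>i. i \<in> I \<Longrightarrow> smooth_vf A (Y i)) \<Longrightarrow>
    D X (\<lambda>q. \<Sum>i\<in>I. Y i q) p = (\<Sum>i\<in>I. D X (Y i) p)"
  by (induction I rule: infinite_finite_induct)
    (simp_all add: D_zero_right D_add_right smooth_vf_sum)

lemma D_tensorial:
  assumes "smooth_vf A X" "smooth_vf A Y" "X p = Y p" "smooth_vf A Z"
  shows "D X Z p = D Y Z p"
  by (rule tensorial_eq[where p = p and F = "\<lambda>X. D X Z p"])
    (use assms in \<open>simp_all add: D_add_left D_scale_left\<close>)

lemma D_tensorial_0: "smooth_vf A X \<Longrightarrow> X p = 0 \<Longrightarrow> smooth_vf A Z \<Longrightarrow> D X Z p = 0"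
  using D_tensorial[OF _ smooth_vf_cscale, of X X p 0 Z] D_cscale_left[of X Z 0 p] by simp

lemma smooth_vf_extension: "smooth_vf A (vf_extension A p v)"
  and vf_extension_at [simp]: "vf_extension A p v p = v"
proof -
  have "\<exists>X. smooth_vf A X \<and> X p = v" using ex_smooth_vf by metis
  from someI_ex[OF this] show "smooth_vf A (vf_extension A p v)" "vf_extension A p v p = v"
    unfolding vf_extension_def by auto
qed

lemma linear_D:
  assumes "smooth_vf A Z"
  shows "linear (\<lambda>v. D (vf_extension A p v) Z p)"
proof
  fix u v k
  note s = smooth_vf_extension
  show "D (vf_extension A p (u + v)) Z p = D (vf_extension A p u) Z p + D (vf_extension A p v) Z p"
    using D_tensorial[of "vf_extension A p (u + v)" "\<lambda>q. vf_extension A p u q + vf_extension A p v q" p Z]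
    by (simp add: D_add_left s assms smooth_vf_add)
  show "D (vf_extension A p (k *\<^sub>R v)) Z p = k *\<^sub>R D (vf_extension A p v) Z p"
    using D_tensorial[of "vf_extension A p (k *\<^sub>R v)" "\<lambda>q. k *\<^sub>R vf_extension A p v q" p Z]
    by (simp add: D_cscale_left s assms smooth_vf_cscale)
qed

lemma lie_bracket_eq:
  "smooth_vf A X \<Longrightarrow> smooth_vf A Y \<Longrightarrow> lie_bracket A X Y = (\<lambda>q. D X Y q - D Y X q)"
  by (simp add: torsion_free fun_eq_iff)

lemma smooth_lie_bracket: "smooth_vf A X \<Longrightarrow> smooth_vf A Y \<Longrightarrow> smooth_vf A (lie_bracket A X Y)"
  by (simp add: lie_bracket_eq smooth_vf_diff smooth_D)

text \<open>Tensor identities are verified on fields that are parallel at the point considered, where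
  all first-order terms vanish.\<close>

definition parallel_at :: "'a \<Rightarrow> ('a \<Rightarrow> real ^ 'n) \<Rightarrow> bool" where
  "parallel_at p X \<longleftrightarrow> smooth_vf A X \<and> (\<forall>Y. smooth_vf A Y \<longrightarrow> D Y X p = 0)"

lemma parallel_at_smooth: "parallel_at p X \<Longrightarrow> smooth_vf A X"
  and parallel_at_D: "parallel_at p X \<Longrightarrow> smooth_vf A Y \<Longrightarrow> D Y X p = 0"
  by (auto simp: parallel_at_def)

text \<open>An arbitrary extension is corrected by the sum of the \<open>f j\<close> times
  \<open>W j\<close>, where \<open>f j\<close> vanishes at \<open>p\<close> and has the j-th
  component as differential, and \<open>W j\<close> takes at \<open>p\<close> the covariant
  derivative in the j-th direction. The correction keeps the value at \<open>p\<close> and cancels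
  all first derivatives there.\<close>

lemma ex_parallel_at:
  obtains X where "parallel_at p X" "X p = v"
proof -
  let ?E = "vf_extension A p"
  let ?X = "?E v"
  note s = smooth_vf_extension
  have "\<exists>f. smooth_fun A f \<and> f p = 0 \<and> (\<forall>X. vf_deriv A X f p = X p $ j)" for j
    using ex_coordinate_fun by metis
  then obtain f where f: "\<And>j. smooth_fun A (f j)" "\<And>j. f j p = 0" "\<And>j X. vf_deriv A X (f j) p = X p $ j"
    by metis
  define W where "W = (\<lambda>j::'n. ?E (D (?E (axis j 1)) ?X p))"
  have W: "smooth_vf A (W j)" for j by (simp add: W_def s)
  have sum: "smooth_vf A (\<lambda>q. \<Sum>j\<in>UNIV. f j q *\<^sub>R W j q)"
    by (intro smooth_vf_sum smooth_vf_scale f W)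
  show thesis
  proof (rule that[of "\<lambda>q. ?X q - (\<Sum>j\<in>UNIV. f j q *\<^sub>R W j q)"])
    show "?X p - (\<Sum>j\<in>UNIV. f j p *\<^sub>R W j p) = v" by (simp add: f)
    have lin: "linear (\<lambda>u. D (?E u) ?X p)" by (rule linear_D[OF s])
    have "D Y (\<lambda>q. ?X q - (\<Sum>j\<in>UNIV. f j q *\<^sub>R W j q)) p = 0" if Y: "smooth_vf A Y" for Y
    proof -
      have "D Y (\<lambda>q. \<Sum>j\<in>UNIV. f j q *\<^sub>R W j q) p = (\<Sum>j\<in>UNIV. Y p $ j *\<^sub>R D (?E (axis j 1)) ?X p)"
        by (subst D_sum_right) (auto simp: Y f W D_scale_right intro!: smooth_vf_scale sum.cong, simp add: W_def)
      also have "\<dots> = D (?E (\<Sum>j\<in>UNIV. Y p $ j *\<^sub>R axis j 1)) ?X p"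
        by (simp add: linear_sum[OF lin] linear_cmul[OF lin])
      also have "\<dots> = D Y ?X p"
        by (rule D_tensorial) (use s Y basis_expansion[of "Y p"] in \<open>simp_all add: scalar_mult_eq_scaleR\<close>)
      finally show ?thesis by (simp add: D_diff_right Y s sum)
    qed
    then show "parallel_at p (\<lambda>q. ?X q - (\<Sum>j\<in>UNIV. f j q *\<^sub>R W j q))"
      unfolding parallel_at_def using smooth_vf_diff[OF s sum] by blast
  qed
qed

lemma lie_bracket_parallel: "parallel_at p X \<Longrightarrow> parallel_at p Y \<Longrightarrow> lie_bracket A X Y p = 0"
  by (simp add: torsion_free parallel_at_smooth parallel_at_D)

lemma vf_deriv_swap_parallel:
  assumes "smooth_fun A f" "parallel_at p X" "parallel_at p Y"
  shows "vf_deriv A X (vf_deriv A Y f) p = vf_deriv A Y (vf_deriv A X f) p"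
proof -
  have "vf_deriv A (lie_bracket A X Y) f p = vf_deriv A (\<lambda>q. 0) f p"
    using vf_deriv_linear(2)[OF assms(1)] lie_bracket_parallel[OF assms(2,3)] by metis
  also have "\<dots> = 0" by (rule linear_0[OF vf_deriv_linear(1)[OF assms(1)]])
  finally show ?thesis
    using vf_deriv_lie_bracket[OF assms(1) parallel_at_smooth parallel_at_smooth, OF assms(2,3), of p] by simp
qed

text \<open>Acting on a function, each double bracket is a combination of triple derivatives, which
  cancel in pairs. The identity is wanted for Bianchi's identity.\<close>

lemma jacobi:
  assumes X: "smooth_vf A X" and Y: "smooth_vf A Y" and Z: "smooth_vf A Z"
  shows "lie_bracket A X (lie_bracket A Y Z) p + lie_bracket A Y (lie_bracket A Z X) p
    + lie_bracket A Z (lie_bracket A X Y) p = 0"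
proof -
  let ?L = "lie_bracket A"
  let ?J = "\<lambda>q. ?L X (?L Y Z) p + ?L Y (?L Z X) p + ?L Z (?L X Y) p"
  have "vf_deriv A ?J f p = vf_deriv A (\<lambda>q. 0) f p" if f: "smooth_fun A f" for f
  proof -
    note lin = vf_deriv_linear(1)[OF f, of p]
    have *: "vf_deriv A (?L U (?L V W)) f p = vf_deriv A U (vf_deriv A V (vf_deriv A W f)) p
        - vf_deriv A U (vf_deriv A W (vf_deriv A V f)) p
        - vf_deriv A V (vf_deriv A W (vf_deriv A U f)) p + vf_deriv A W (vf_deriv A V (vf_deriv A U f)) p"
      if "smooth_vf A U" "smooth_vf A V" "smooth_vf A W" for U V W
    proof -
      have "vf_deriv A (?L V W) f = (\<lambda>q. vf_deriv A V (vf_deriv A W f) q - vf_deriv A W (vf_deriv A V f) q)"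
        using vf_deriv_lie_bracket[OF f that(2,3)] by blast
      then show ?thesis
        using that f by (simp add: vf_deriv_lie_bracket smooth_lie_bracket smooth_vf_deriv vf_deriv_diff_fun)
    qed
    have "vf_deriv A ?J f p = vf_deriv A (?L X (?L Y Z)) f p + vf_deriv A (?L Y (?L Z X)) f p
        + vf_deriv A (?L Z (?L X Y)) f p"
      using linear_add[OF lin] vf_deriv_linear(2)[OF f] by metis
    also have "\<dots> = 0" by (simp add: * X Y Z)
    also have "\<dots> = vf_deriv A (\<lambda>q. 0) f p" using linear_0[OF lin] by simp
    finally show ?thesis .
  qed
  then show ?thesis using vf_eqI[of ?J p "\<lambda>q. 0"] by simp
qed

section \<open>Tensoriality and symmetries of the Riemannian curvature\<close>

abbreviation curv :: "('a \<Rightarrow> real ^ 'n) \<Rightarrow> ('a \<Rightarrow> real ^ 'n) \<Rightarrow> ('a \<Rightarrow> real ^ 'n) \<Rightarrow> 'a \<Rightarrow> real ^ 'n" where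
  "curv \<equiv> curvature A D"

lemma curvature_skew:
  assumes "smooth_vf A X" "smooth_vf A Y" "smooth_vf A Z"
  shows "curv X Y Z p = - curv Y X Z p"
proof -
  have "D (lie_bracket A X Y) Z p = D (\<lambda>q. (- 1) *\<^sub>R lie_bracket A Y X q) Z p"
    by (rule D_tensorial) (use assms in \<open>simp_all add: torsion_free smooth_lie_bracket smooth_vf_cscale smooth_vf_diff smooth_D\<close>)
  also have "\<dots> = - D (lie_bracket A Y X) Z p"
    by (subst D_cscale_left) (use assms in \<open>auto intro!: smooth_lie_bracket\<close>)
  finally show ?thesis by (simp add: curvature_def)
qed

lemma curvature_add1:
  assumes X: "smooth_vf A X" "smooth_vf A X'" and Y: "smooth_vf A Y" and Z: "smooth_vf A Z"
  shows "curv (\<lambda>q. X q + X' q) Y Z p = curv X Y Z p + curv X' Y Z p"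
proof -
  have "D (\<lambda>q. X q + X' q) Z = (\<lambda>q. D X Z q + D X' Z q)"
    using X Z by (simp add: D_add_left fun_eq_iff)
  moreover have "D (lie_bracket A (\<lambda>q. X q + X' q) Y) Z p
      = D (\<lambda>q. lie_bracket A X Y q + lie_bracket A X' Y q) Z p"
    by (rule D_tensorial)
      (use X Y Z in \<open>simp_all add: torsion_free D_add_left D_add_right smooth_vf_add smooth_lie_bracket smooth_vf_diff smooth_D\<close>)
  ultimately show ?thesis
    using X Y Z by (simp add: curvature_def D_add_left D_add_right smooth_D smooth_lie_bracket)
qed

lemma curvature_scale1:
  assumes f: "smooth_fun A f" and X: "smooth_vf A X" and Y: "smooth_vf A Y" and Z: "smooth_vf A Z"
  shows "curv (\<lambda>q. f q *\<^sub>R X q) Y Z p = f p *\<^sub>R curv X Y Z p"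
proof -
  have "D (\<lambda>q. f q *\<^sub>R X q) Z = (\<lambda>q. f q *\<^sub>R D X Z q)"
    using f X Z by (simp add: D_scale_left fun_eq_iff)
  moreover have "D (lie_bracket A (\<lambda>q. f q *\<^sub>R X q) Y) Z p
      = D (\<lambda>q. f q *\<^sub>R lie_bracket A X Y q - vf_deriv A Y f q *\<^sub>R X q) Z p"
  proof (rule D_tensorial)
    show "lie_bracket A (\<lambda>q. f q *\<^sub>R X q) Y p = f p *\<^sub>R lie_bracket A X Y p - vf_deriv A Y f p *\<^sub>R X p"
      using f X Y by (simp add: torsion_free D_scale_left D_scale_right smooth_vf_scale scaleR_diff_right)
  qed (intro smooth_lie_bracket smooth_vf_diff smooth_vf_scale smooth_vf_deriv f X Y Z)+
  moreover have "\<dots> = f p *\<^sub>R D (lie_bracket A X Y) Z p - vf_deriv A Y f p *\<^sub>R D X Z p"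
    using f X Y Z by (simp add: D_diff_left D_scale_left smooth_lie_bracket smooth_vf_scale smooth_vf_deriv)
  ultimately show ?thesis
    using f X Y Z by (simp add: curvature_def D_scale_left D_scale_right smooth_D smooth_vf_scale algebra_simps)
qed

lemma curvature_add3:
  assumes X: "smooth_vf A X" and Y: "smooth_vf A Y" and Z: "smooth_vf A Z" "smooth_vf A Z'"
  shows "curv X Y (\<lambda>q. Z q + Z' q) p = curv X Y Z p + curv X Y Z' p"
proof -
  have "D U (\<lambda>q. Z q + Z' q) = (\<lambda>q. D U Z q + D U Z' q)" if "smooth_vf A U" for U
    using that Z by (simp add: D_add_right fun_eq_iff)
  then show ?thesis
    using X Y Z by (simp add: curvature_def D_add_right smooth_D smooth_lie_bracket)
qed

text \<open>The second derivatives of \<open>f\<close> enter as X(Y f) - Y(X f) - [X, Y] f, which is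
  zero by \<open>vf_deriv_lie_bracket\<close>.\<close>

lemma curvature_scale3:
  assumes f: "smooth_fun A f" and X: "smooth_vf A X" and Y: "smooth_vf A Y" and Z: "smooth_vf A Z"
  shows "curv X Y (\<lambda>q. f q *\<^sub>R Z q) p = f p *\<^sub>R curv X Y Z p"
proof -
  have "D U (\<lambda>q. f q *\<^sub>R Z q) = (\<lambda>q. f q *\<^sub>R D U Z q + vf_deriv A U f q *\<^sub>R Z q)" if "smooth_vf A U" for U
    using that f Z by (simp add: D_scale_right fun_eq_iff)
  then show ?thesis
    using f X Y Z
    by (simp add: curvature_def D_add_right D_scale_right smooth_D smooth_lie_bracket smooth_vf_scale
        smooth_vf_deriv vf_deriv_lie_bracket algebra_simps)
qed

text \<open>This makes the choice in \<open>vf_extension\<close> harmless. The second argument is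
  reduced to the first by skewness.\<close>

lemma curvature_tensorial:
  assumes "smooth_vf A X" "smooth_vf A Y" "smooth_vf A Z"
  shows "curv X Y Z p = curvature_at A D p (X p) (Y p) (Z p)"
proof -
  note s = smooth_vf_extension
  let ?X = "vf_extension A p (X p)" and ?Y = "vf_extension A p (Y p)" and ?Z = "vf_extension A p (Z p)"
  have 1: "curv U V W p = curv U' V W p"
    if "smooth_vf A U" "smooth_vf A U'" "smooth_vf A V" "smooth_vf A W" "U p = U' p" for U U' V W
    by (rule tensorial_eq[where p = p and F = "\<lambda>U. curv U V W p"])
      (use that in \<open>simp_all add: curvature_add1 curvature_scale1\<close>)
  have 3: "curv U V W p = curv U V W' p"
    if "smooth_vf A U" "smooth_vf A V" "smooth_vf A W" "smooth_vf A W'" "W p = W' p" for U V W W'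
    by (rule tensorial_eq[where p = p and F = "\<lambda>W. curv U V W p"])
      (use that in \<open>simp_all add: curvature_add3 curvature_scale3\<close>)
  have "curv X Y Z p = curv ?X Y Z p" by (rule 1) (use assms s in simp_all)
  also have "\<dots> = - curv Y ?X Z p" by (rule curvature_skew) (use assms s in simp_all)
  also have "curv Y ?X Z p = curv ?Y ?X Z p" by (rule 1) (use assms s in simp_all)
  also have "- curv ?Y ?X Z p = curv ?X ?Y Z p" by (rule curvature_skew[symmetric]) (use assms s in simp_all)
  also have "\<dots> = curv ?X ?Y ?Z p" by (rule 3) (use assms s in simp_all)
  finally show ?thesis by (simp add: curvature_at_def)
qed

lemma curvature_parallel:
  assumes "parallel_at p X" "parallel_at p Y" "smooth_vf A Z"
  shows "curv X Y Z p = D X (D Y Z) p - D Y (D X Z) p"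
  using assms by (simp add: curvature_def D_tensorial_0 lie_bracket_parallel smooth_lie_bracket parallel_at_smooth)

text \<open>Products of first derivatives vanish at \<open>p\<close>. Exchanging \<open>X\<close>
  and \<open>Y\<close> does not change the left-hand side, which yields skewness of the curvature
  endomorphism.\<close>

lemma vf_deriv_metric_parallel:
  assumes "parallel_at p X" "parallel_at p Y" "parallel_at p Z" "parallel_at p W"
  shows "vf_deriv A X (vf_deriv A Y (\<lambda>q. g q (Z q) (W q))) p
    = g p (D X (D Y Z) p) (W p) + g p (Z p) (D X (D Y W) p)"
proof -
  note s = assms[THEN parallel_at_smooth]
  have "vf_deriv A Y (\<lambda>q. g q (Z q) (W q)) = (\<lambda>q. g q (D Y Z q) (W q) + g q (Z q) (D Y W q))"
    using metric_compatible[OF s(2,3,4)] by blast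
  moreover have "vf_deriv A X (\<lambda>q. g q (D Y Z q) (W q) + g q (Z q) (D Y W q)) p
      = vf_deriv A X (\<lambda>q. g q (D Y Z q) (W q)) p + vf_deriv A X (\<lambda>q. g q (Z q) (D Y W q)) p"
    by (intro vf_deriv_add_fun smooth_metric smooth_D s)
  ultimately show ?thesis
    using metric_compatible[OF s(1) smooth_D[OF s(2,3)] s(4), of p]
      metric_compatible[OF s(1) s(3) smooth_D[OF s(2,4)], of p]
    by (simp add: assms parallel_at_D s)
qed

lemma linear_curvature1: "linear (\<lambda>u. curvature_at A D p u v w)"
proof
  note s = smooth_vf_extension
  fix a b k
  show "curvature_at A D p (a + b) v w = curvature_at A D p a v w + curvature_at A D p b v w"
    using curvature_add1[OF s s s s, of p a p b p v p w p]
      curvature_tensorial[OF smooth_vf_add[OF s s] s s, of p a p b p v p w p]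
    by (simp add: curvature_at_def)
  show "curvature_at A D p (k *\<^sub>R a) v w = k *\<^sub>R curvature_at A D p a v w"
    using curvature_scale1[OF smooth_fun_const s s s, of k p a p v p w p]
      curvature_tensorial[OF smooth_vf_cscale[OF s] s s, of k p a p v p w p]
    by (simp add: curvature_at_def)
qed

lemma linear_curvature3: "linear (\<lambda>w. curvature_at A D p u v w)"
proof
  note s = smooth_vf_extension
  fix a b k
  show "curvature_at A D p u v (a + b) = curvature_at A D p u v a + curvature_at A D p u v b"
    using curvature_add3[OF s s s s, of p u p v p a p b p]
      curvature_tensorial[OF s s smooth_vf_add[OF s s], of p u p v p a p b p]
    by (simp add: curvature_at_def)
  show "curvature_at A D p u v (k *\<^sub>R a) = k *\<^sub>R curvature_at A D p u v a"
    using curvature_scale3[OF smooth_fun_const s s s, of p u p v k p a p]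
      curvature_tensorial[OF s s smooth_vf_cscale[OF s], of p u p v k p a p]
    by (simp add: curvature_at_def)
qed

sublocale curvature_form "g p" "curvature_at A D p" for p
proof
  note s = smooth_vf_extension
  fix u v w z :: "real ^ 'n"
  let ?R = "curvature_at A D p"
  show "?R u v w = - ?R v u w"
    unfolding curvature_at_def by (rule curvature_skew[OF s s s])
  obtain X where X: "parallel_at p X" "X p = u" by (rule ex_parallel_at)
  obtain Y where Y: "parallel_at p Y" "Y p = v" by (rule ex_parallel_at)
  obtain Z where Z: "parallel_at p Z" "Z p = w" by (rule ex_parallel_at)
  obtain W where W: "parallel_at p W" "W p = z" by (rule ex_parallel_at)
  note sm = X(1)[THEN parallel_at_smooth] Y(1)[THEN parallel_at_smooth]
    Z(1)[THEN parallel_at_smooth] W(1)[THEN parallel_at_smooth]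
  have "vf_deriv A X (vf_deriv A Y (\<lambda>q. g q (Z q) (W q))) p = vf_deriv A Y (vf_deriv A X (\<lambda>q. g q (Z q) (W q))) p"
    by (rule vf_deriv_swap_parallel[OF smooth_metric X(1) Y(1)]) (use sm in auto)
  then have "g p (curv X Y Z p) (W p) = - g p (Z p) (curv X Y W p)"
    using sm by (simp add: vf_deriv_metric_parallel X Y Z W curvature_parallel)
  then show "g p (?R u v w) z = - g p w (?R u v z)"
    using sm by (simp add: curvature_tensorial X Y Z W)
  \<comment> \<open>For fields parallel at \<open>p\<close>, the double bracket [X, [Y, Z]] there is
    the covariant derivative of [Y, Z] along X, so Jacobi's identity turns into Bianchi's.\<close>
  have "D X (lie_bracket A Y Z) p + D Y (lie_bracket A Z X) p + D Z (lie_bracket A X Y) p = 0"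
    using jacobi[OF sm(1-3), of p] sm
    by (simp add: torsion_free[of _ "lie_bracket A _ _"] smooth_lie_bracket parallel_at_D X Y Z)
  moreover have "D U (lie_bracket A V V') p = D U (D V V') p - D U (D V' V) p"
    if "smooth_vf A U" "smooth_vf A V" "smooth_vf A V'" for U V V'
    using that by (simp add: lie_bracket_eq D_diff_right smooth_D)
  ultimately have "curv X Y Z p + curv Y Z X p + curv Z X Y p = 0"
    using sm by (simp add: curvature_parallel X Y Z algebra_simps)
  then show "?R u v w + ?R v w u + ?R w u v = 0"
    using sm by (simp add: curvature_tensorial X Y Z)
qed (simp_all add: linear_add[OF linear_curvature1] linear_cmul[OF linear_curvature1]
  linear_add[OF linear_curvature3] linear_cmul[OF linear_curvature3])

end

section \<open>Nearly cosymplectic five-manifolds\<close>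

locale nearly_cosymplectic_manifold = riemannian_manifold A g D
  for A :: "('a::{t2_space, second_countable_topology}, 5) chart set"
    and g :: "'a \<Rightarrow> real ^ 5 \<Rightarrow> real ^ 5 \<Rightarrow> real"
    and D :: "('a, 5) connection" +
  fixes \<phi> :: "'a \<Rightarrow> real ^ 5 \<Rightarrow> real ^ 5"
    and \<xi> :: "'a \<Rightarrow> real ^ 5"
    and \<eta> :: "'a \<Rightarrow> real ^ 5 \<Rightarrow> real"
  assumes almost_contact_metric: "almost_contact_metric A \<phi> \<xi> \<eta> g"
    and nearly_cosymplectic: "nearly_cosymplectic A \<phi> D"
begin

lemma linear_phi_at: "linear (\<phi> p)" and linear_eta_at: "linear (\<eta> p)"
  using almost_contact_metric by (auto simp: almost_contact_metric_def tensor_1_1_def one_form_def)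

sublocale almost_contact_point5 "g p" "\<phi> p" "\<xi> p" "\<eta> p" for p
  by (unfold_locales; (rule linear_add[OF linear_phi_at] linear_cmul[OF linear_phi_at]
        linear_add[OF linear_eta_at] linear_cmul[OF linear_eta_at])?)
    (use almost_contact_metric in \<open>auto simp: almost_contact_metric_def
        linear_add[OF linear_eta_at] linear_cmul[OF linear_eta_at]\<close>)

lemma smooth_phi: "smooth_vf A Y \<Longrightarrow> smooth_vf A (\<lambda>q. \<phi> q (Y q))"
  and smooth_xi: "smooth_vf A \<xi>"
  using almost_contact_metric by (auto simp: almost_contact_metric_def tensor_1_1_def)

definition dphi :: "'a \<Rightarrow> real ^ 5 \<Rightarrow> real ^ 5 \<Rightarrow> real ^ 5" where
  "dphi p u v = cov_deriv_1_1 D \<phi> (vf_extension A p u) (vf_extension A p v) p"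

definition dxi :: "'a \<Rightarrow> real ^ 5 \<Rightarrow> real ^ 5" where
  "dxi p u = D (vf_extension A p u) \<xi> p"

text \<open>The second covariant derivative of \<xi>, that is \<nabla>h; the subtracted term makes
  it independent of the extension of \<open>v\<close>.\<close>

definition ddxi :: "'a \<Rightarrow> real ^ 5 \<Rightarrow> real ^ 5 \<Rightarrow> real ^ 5" where
  "ddxi p u v = D (vf_extension A p u) (D (vf_extension A p v) \<xi>) p
    - D (D (vf_extension A p u) (vf_extension A p v)) \<xi> p"

lemma D_xi: "smooth_vf A X \<Longrightarrow> D X \<xi> p = dxi p (X p)"
  unfolding dxi_def by (rule D_tensorial) (simp_all add: smooth_vf_extension smooth_xi)

lemma D_xi_fun: "smooth_vf A X \<Longrightarrow> D X \<xi> = (\<lambda>p. dxi p (X p))"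
  using D_xi by blast

lemma linear_dxi: "linear (dxi p)"
  using linear_D[OF smooth_xi, of p] unfolding dxi_def[abs_def] .

lemma smooth_dxi: "smooth_vf A X \<Longrightarrow> smooth_vf A (\<lambda>q. dxi q (X q))"
  using smooth_D[OF _ smooth_xi] D_xi_fun by metis

lemma cov_deriv_skew:
  "smooth_vf A X \<Longrightarrow> smooth_vf A Y \<Longrightarrow> cov_deriv_1_1 D \<phi> X Y p = - cov_deriv_1_1 D \<phi> Y X p"
  using nearly_cosymplectic by (simp add: nearly_cosymplectic_def eq_neg_iff_add_eq_0)

text \<open>Tensoriality in the second argument is obtained from that in the first by the nearly
  cosymplectic condition.\<close>

lemma cov_deriv_tensorial:
  assumes "smooth_vf A X" "smooth_vf A Y"
  shows "cov_deriv_1_1 D \<phi> X Y p = dphi p (X p) (Y p)"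
proof -
  note s = smooth_vf_extension
  have 1: "cov_deriv_1_1 D \<phi> U V p = cov_deriv_1_1 D \<phi> U' V p"
    if "smooth_vf A U" "smooth_vf A U'" "smooth_vf A V" "U p = U' p" for U U' V
    by (rule tensorial_eq[where p = p and F = "\<lambda>U. cov_deriv_1_1 D \<phi> U V p"])
      (use that in \<open>simp_all add: cov_deriv_1_1_def D_add_left D_scale_left smooth_phi scaleR_diff_right\<close>)
  have "cov_deriv_1_1 D \<phi> X Y p = cov_deriv_1_1 D \<phi> (vf_extension A p (X p)) Y p"
    by (rule 1) (use assms s in simp_all)
  also have "\<dots> = - cov_deriv_1_1 D \<phi> Y (vf_extension A p (X p)) p"
    by (rule cov_deriv_skew) (use assms s in simp_all)
  also have "cov_deriv_1_1 D \<phi> Y (vf_extension A p (X p)) p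
      = cov_deriv_1_1 D \<phi> (vf_extension A p (Y p)) (vf_extension A p (X p)) p"
    by (rule 1) (use assms s in simp_all)
  finally show ?thesis
    unfolding dphi_def by (subst cov_deriv_skew) (use assms s in simp_all)
qed

lemma D_phi:
  "smooth_vf A X \<Longrightarrow> smooth_vf A Y \<Longrightarrow>
    D X (\<lambda>q. \<phi> q (Y q)) p = \<phi> p (D X Y p) + dphi p (X p) (Y p)"
  using cov_deriv_tensorial[of X Y p] by (simp add: cov_deriv_1_1_def algebra_simps)

lemma dphi_skew: "dphi p u v = - dphi p v u"
  unfolding dphi_def by (rule cov_deriv_skew) (rule smooth_vf_extension)+

lemma linear_dphi: "linear (\<lambda>u. dphi p u v)"
proof
  note s = smooth_vf_extension
  fix a b :: "real ^ 5" and k :: real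
  let ?E = "vf_extension A p"
  have "cov_deriv_1_1 D \<phi> (\<lambda>q. ?E a q + ?E b q) (?E v) p
      = cov_deriv_1_1 D \<phi> (?E a) (?E v) p + cov_deriv_1_1 D \<phi> (?E b) (?E v) p"
    by (simp add: cov_deriv_1_1_def D_add_left s smooth_phi)
  then show "dphi p (a + b) v = dphi p a v + dphi p b v"
    by (simp add: cov_deriv_tensorial s smooth_vf_add)
  have "cov_deriv_1_1 D \<phi> (\<lambda>q. k *\<^sub>R ?E a q) (?E v) p = k *\<^sub>R cov_deriv_1_1 D \<phi> (?E a) (?E v) p"
    by (simp add: cov_deriv_1_1_def D_cscale_left s smooth_phi scaleR_diff_right)
  then show "dphi p (k *\<^sub>R a) v = k *\<^sub>R dphi p a v"
    by (simp add: cov_deriv_tensorial s smooth_vf_cscale)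
qed

lemma bilinear_dphi: "bilinear (dphi p)"
proof -
  have "linear (\<lambda>v. dphi p u v)" for u
    unfolding dphi_skew[of p u] by (rule linear_compose_neg[OF linear_dphi])
  then show ?thesis using linear_dphi by (simp add: bilinear_def)
qed

text \<open>The shape with two summands fits skewness of an endomorphism field; it is applied to
  \<phi> and to \<open>h\<close>.\<close>

lemma metric_sum_const:
  assumes s: "smooth_vf A X" "smooth_vf A P" "smooth_vf A Q" "smooth_vf A U" "smooth_vf A V"
    and k: "\<And>q. g q (P q) (Q q) + g q (U q) (V q) = k"
  shows "g p (D X P p) (Q p) + g p (P p) (D X Q p) + (g p (D X U p) (V p) + g p (U p) (D X V p)) = 0"
proof -
  have "vf_deriv A X (\<lambda>q. g q (P q) (Q q) + g q (U q) (V q)) p = 0"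
    by (simp only: k vf_deriv_const)
  then show ?thesis
    using s by (simp add: vf_deriv_add_fun smooth_metric metric_compatible)
qed

lemma eta_dxi: "\<eta> p (dxi p u) = 0"
proof -
  have "vf_deriv A (vf_extension A p u) (\<lambda>q. g q (\<xi> q) (\<xi> q)) p = 0"
    by (simp add: vf_deriv_const flip: eta_eq)
  then show ?thesis
    by (simp add: metric_compatible smooth_vf_extension smooth_xi D_xi eta_eq G_sym)
qed

lemma vf_deriv_eta:
  assumes "smooth_vf A X" "parallel_at p Y"
  shows "vf_deriv A X (\<lambda>q. \<eta> q (Y q)) p = g p (dxi p (X p)) (Y p)"
  unfolding eta_eq using assms
  by (simp add: metric_compatible parallel_at_smooth parallel_at_D smooth_xi D_xi G_sym)

lemma smooth_eta: "smooth_vf A Y \<Longrightarrow> smooth_fun A (\<lambda>q. \<eta> q (Y q))"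
  unfolding eta_eq by (rule smooth_metric[OF _ smooth_xi])

sublocale nearly_cosymplectic_point "g p" "\<phi> p" "\<xi> p" "\<eta> p" "dxi p" "dphi p" for p
proof
  fix u v w :: "real ^ 5"
  obtain X where X: "parallel_at p X" "X p = u" by (rule ex_parallel_at)
  obtain Y where Y: "parallel_at p Y" "Y p = v" by (rule ex_parallel_at)
  obtain Z where Z: "parallel_at p Z" "Z p = w" by (rule ex_parallel_at)
  note s = X(1)[THEN parallel_at_smooth] Y(1)[THEN parallel_at_smooth] Z(1)[THEN parallel_at_smooth]
  note par = parallel_at_D[OF X(1)] parallel_at_D[OF Y(1)] parallel_at_D[OF Z(1)]
  show "dphi p u v = - dphi p v u" by (rule dphi_skew)
  show "\<eta> p (dxi p u) = 0" by (rule eta_dxi)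
  have "g p (D X (\<lambda>q. \<phi> q (Y q)) p) (Z p) + g p (\<phi> p (Y p)) (D X Z p)
      + (g p (D X Y p) (\<phi> p (Z p)) + g p (Y p) (D X (\<lambda>q. \<phi> q (Z q)) p)) = 0"
    by (rule metric_sum_const) (use s in \<open>auto simp: smooth_phi G_phi\<close>)
  then show "g p (dphi p u v) w = - g p v (dphi p u w)"
    using s by (simp add: D_phi par X Y Z)
  \<comment> \<open>The derivative of \<phi>^2 Y is computed twice: by the product rule here, and
    from \<phi>^2 = -I + \<eta> \<otimes> \<xi> below.\<close>
  have "D X (\<lambda>q. \<phi> q (\<phi> q (Y q))) p = \<phi> p (dphi p u v) + dphi p u (\<phi> p v)"
    using s by (simp add: D_phi smooth_phi par X Y)
  moreover have "D X (\<lambda>q. \<phi> q (\<phi> q (Y q))) p = g p (dxi p u) v *\<^sub>R \<xi> p + \<eta> p v *\<^sub>R dxi p u"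
  proof -
    have "(\<lambda>q. \<phi> q (\<phi> q (Y q))) = (\<lambda>q. \<eta> q (Y q) *\<^sub>R \<xi> q - Y q)"
      by (simp add: phi_phi fun_eq_iff)
    then show ?thesis
      using s by (simp add: D_diff_right D_scale_right smooth_vf_scale smooth_eta smooth_xi
          vf_deriv_eta[OF _ Y(1)] par X Y D_xi)
  qed
  ultimately show "dphi p u (\<phi> p v) + \<phi> p (dphi p u v) = g p (dxi p u) v *\<^sub>R \<xi> p + \<eta> p v *\<^sub>R dxi p u"
    by (simp add: add.commute)
qed (use linear_dxi bilinear_dphi in \<open>auto simp: linear_add linear_cmul\<close>)

lemma ddxi_tensorial:
  assumes "smooth_vf A X" "smooth_vf A Y"
  shows "D X (\<lambda>q. dxi q (Y q)) p - dxi p (D X Y p) = ddxi p (X p) (Y p)"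
proof -
  note s = smooth_vf_extension
  let ?F = "\<lambda>X Y. D X (\<lambda>q. dxi q (Y q)) p - dxi p (D X Y p)"
  have 1: "?F U V = ?F U' V"
    if "smooth_vf A U" "smooth_vf A U'" "smooth_vf A V" "U p = U' p" for U U' V
    by (rule tensorial_eq[where p = p and F = "\<lambda>U. ?F U V"])
      (use that in \<open>simp_all add: D_add_left D_scale_left smooth_dxi scaleR_diff_right\<close>)
  have 2: "?F U V = ?F U V'"
    if "smooth_vf A U" "smooth_vf A V" "smooth_vf A V'" "V p = V' p" for U V V'
    by (rule tensorial_eq[where p = p and F = "\<lambda>V. ?F U V"])
      (use that in \<open>simp_all add: D_add_right D_scale_right smooth_dxi scaleR_diff_right\<close>)
  have "?F X Y = ?F (vf_extension A p (X p)) Y" by (rule 1) (use assms s in simp_all)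
  also have "\<dots> = ?F (vf_extension A p (X p)) (vf_extension A p (Y p))" by (rule 2) (use assms s in simp_all)
  also have "\<dots> = ddxi p (X p) (Y p)"
    unfolding ddxi_def by (simp add: D_xi_fun D_xi s smooth_D)
  finally show ?thesis .
qed

lemma D_dxi:
  "smooth_vf A X \<Longrightarrow> smooth_vf A Y \<Longrightarrow>
    D X (\<lambda>q. dxi q (Y q)) p = dxi p (D X Y p) + ddxi p (X p) (Y p)"
  by (simp flip: ddxi_tensorial)

text \<open>This is the product rule for the three terms of \<open>T_eq\<close>, with \<phi> (ddxi u
  w) + dphi u (dxi w) as the derivative of \<phi>h.\<close>

lemma D_dphi_parallel:
  assumes X: "parallel_at p X" and Y: "parallel_at p Y" and Z: "parallel_at p Z"
  shows "D X (\<lambda>q. dphi q (Y q) (Z q)) p =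
    g p (dxi p (X p)) (Y p) *\<^sub>R \<phi> p (dxi p (Z p))
    + \<eta> p (Y p) *\<^sub>R (\<phi> p (ddxi p (X p) (Z p)) + dphi p (X p) (dxi p (Z p)))
    - g p (dxi p (X p)) (Z p) *\<^sub>R \<phi> p (dxi p (Y p))
    - \<eta> p (Z p) *\<^sub>R (\<phi> p (ddxi p (X p) (Y p)) + dphi p (X p) (dxi p (Y p)))
    + g p (\<phi> p (ddxi p (X p) (Y p)) + dphi p (X p) (dxi p (Y p))) (Z p) *\<^sub>R \<xi> p
    + g p (\<phi> p (dxi p (Y p))) (Z p) *\<^sub>R dxi p (X p)"
proof -
  note s = X[THEN parallel_at_smooth] Y[THEN parallel_at_smooth] Z[THEN parallel_at_smooth]
  have psi: "smooth_vf A (\<lambda>q. \<phi> q (dxi q (U q)))" if "smooth_vf A U" for U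
    by (rule smooth_phi[OF smooth_dxi[OF that]])
  have D_psi: "D X (\<lambda>q. \<phi> q (dxi q (U q))) p = \<phi> p (ddxi p (X p) (U p)) + dphi p (X p) (dxi p (U p))"
    if "parallel_at p U" for U
    using D_phi[OF s(1) smooth_dxi[OF parallel_at_smooth[OF that]], of p]
      D_dxi[OF s(1) parallel_at_smooth[OF that], of p] parallel_at_D[OF that s(1)]
    by simp
  have "smooth_vf A (\<lambda>q. \<eta> q (Y q) *\<^sub>R \<phi> q (dxi q (Z q)))" "smooth_vf A (\<lambda>q. \<eta> q (Z q) *\<^sub>R \<phi> q (dxi q (Y q)))"
    "smooth_vf A (\<lambda>q. g q (\<phi> q (dxi q (Y q))) (Z q) *\<^sub>R \<xi> q)"
    by (intro smooth_vf_scale smooth_eta smooth_metric psi s smooth_xi)+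
  note sm = this smooth_vf_diff[OF this(1,2)]
  have "D X (\<lambda>q. dphi q (Y q) (Z q)) p = D X (\<lambda>q. \<eta> q (Y q) *\<^sub>R \<phi> q (dxi q (Z q))) p
      - D X (\<lambda>q. \<eta> q (Z q) *\<^sub>R \<phi> q (dxi q (Y q))) p + D X (\<lambda>q. g q (\<phi> q (dxi q (Y q))) (Z q) *\<^sub>R \<xi> q) p"
    unfolding T_eq using sm s by (simp only: D_add_right D_diff_right)
  also have "D X (\<lambda>q. \<eta> q (Y q) *\<^sub>R \<phi> q (dxi q (Z q))) p
      = \<eta> p (Y p) *\<^sub>R (\<phi> p (ddxi p (X p) (Z p)) + dphi p (X p) (dxi p (Z p)))
        + g p (dxi p (X p)) (Y p) *\<^sub>R \<phi> p (dxi p (Z p))"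
    by (simp only: D_scale_right[OF smooth_eta[OF s(2)] s(1) psi[OF s(3)]] D_psi[OF Z] vf_deriv_eta[OF s(1) Y])
  also have "D X (\<lambda>q. \<eta> q (Z q) *\<^sub>R \<phi> q (dxi q (Y q))) p
      = \<eta> p (Z p) *\<^sub>R (\<phi> p (ddxi p (X p) (Y p)) + dphi p (X p) (dxi p (Y p)))
        + g p (dxi p (X p)) (Z p) *\<^sub>R \<phi> p (dxi p (Y p))"
    by (simp only: D_scale_right[OF smooth_eta[OF s(3)] s(1) psi[OF s(2)]] D_psi[OF Y] vf_deriv_eta[OF s(1) Z])
  also have "D X (\<lambda>q. g q (\<phi> q (dxi q (Y q))) (Z q) *\<^sub>R \<xi> q) p
      = g p (\<phi> p (dxi p (Y p))) (Z p) *\<^sub>R dxi p (X p)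
        + g p (\<phi> p (ddxi p (X p) (Y p)) + dphi p (X p) (dxi p (Y p))) (Z p) *\<^sub>R \<xi> p"
    unfolding D_scale_right[OF smooth_metric[OF psi[OF s(2)] s(3)] s(1) smooth_xi]
      metric_compatible[OF s(1) psi[OF s(2)] s(3)] D_psi[OF Y] D_xi[OF s(1)]
    by (simp add: parallel_at_D[OF Z s(1)])
  finally show ?thesis by (simp only: add_diff_eq diff_add_eq diff_diff_eq add_ac diff_diff_add)
qed

sublocale nearly_cosymplectic_curvature "g p" "\<phi> p" "\<xi> p" "\<eta> p" "dxi p" "dphi p" "curvature_at A D p" "ddxi p" for p
proof
  fix u v w :: "real ^ 5"
  obtain X where X: "parallel_at p X" "X p = u" by (rule ex_parallel_at)
  obtain Y where Y: "parallel_at p Y" "Y p = v" by (rule ex_parallel_at)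
  obtain Z where Z: "parallel_at p Z" "Z p = w" by (rule ex_parallel_at)
  note s = X(1)[THEN parallel_at_smooth] Y(1)[THEN parallel_at_smooth] Z(1)[THEN parallel_at_smooth]
  note par = parallel_at_D[OF X(1)] parallel_at_D[OF Y(1)] parallel_at_D[OF Z(1)]
  \<comment> \<open>Identities already known at every point are differentiated: skewness of
    \<open>h\<close> here, then h \<xi> = 0, orthogonality of h Y to \<xi>, and h\<phi> + \<phi>h =
    0.\<close>
  have "g p (D X (\<lambda>q. dxi q (Y q)) p) (Z p) + g p (dxi p (Y p)) (D X Z p)
      + (g p (D X Y p) (dxi p (Z p)) + g p (Y p) (D X (\<lambda>q. dxi q (Z q)) p)) = 0"
    by (rule metric_sum_const) (use s in \<open>auto simp: smooth_dxi G_h\<close>)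
  then show "g p (ddxi p u v) w = - g p v (ddxi p u w)"
    using s by (simp add: D_dxi par X Y Z)
  show "curvature_at A D p u v (\<xi> p) = ddxi p u v - ddxi p v u"
    using curvature_parallel[OF X(1) Y(1) smooth_xi] s curvature_tensorial[OF s(1,2) smooth_xi, of p]
    by (simp add: D_xi_fun D_dxi par X Y)
  show "ddxi p u (\<xi> p) = - dxi p (dxi p u)"
    using D_dxi[OF s(1) smooth_xi, of p] s
    by (simp add: D_zero_right D_xi X eq_neg_iff_add_eq_0 add.commute)
  have "vf_deriv A X (\<lambda>q. g q (dxi q (Y q)) (\<xi> q)) p = 0"
    by (simp add: vf_deriv_const flip: eta_eq)
  then show "\<eta> p (ddxi p u v) = - g p (dxi p v) (dxi p u)"
    using s by (simp add: metric_compatible smooth_dxi smooth_xi D_dxi D_xi par X Y eta_eq)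
  have "D X (\<lambda>q. dxi q (\<phi> q (Y q)) + \<phi> q (dxi q (Y q))) p = 0"
    using s by (simp add: h_phi D_zero_right)
  then show "ddxi p u (\<phi> p v) + \<phi> p (ddxi p u v) + dxi p (dphi p u v) + dphi p u (dxi p v) = 0"
    using s by (simp add: D_add_right smooth_dxi smooth_phi D_dxi D_phi par X Y add_ac)
  \<comment> \<open>The terms of \<open>dphi\<close> with a covariant derivative of \<open>Z\<close>
    vanish at \<open>p\<close>. Antisymmetrising in \<open>U\<close> and \<open>V\<close> therefore
    leaves only derivatives of \<open>dphi\<close> beside the commutator of the curvature with
    \<phi>.\<close>
  have DDphi: "D U (D V (\<lambda>q. \<phi> q (Z q))) p = \<phi> p (D U (D V Z) p) + D U (\<lambda>q. dphi q (V q) (Z q)) p"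
    if "parallel_at p U" "parallel_at p V" for U V
  proof -
    note sU = parallel_at_smooth[OF that(1)] and sV = parallel_at_smooth[OF that(2)]
    have eq: "(\<lambda>q. dphi q (V q) (Z q)) = (\<lambda>q. D V (\<lambda>q. \<phi> q (Z q)) q - \<phi> q (D V Z q))"
      using s sV by (simp add: D_phi)
    have "smooth_vf A (\<lambda>q. dphi q (V q) (Z q))"
      unfolding eq by (intro smooth_vf_diff smooth_D smooth_phi s sV)
    moreover have "D V (\<lambda>q. \<phi> q (Z q)) = (\<lambda>q. \<phi> q (D V Z q) + dphi q (V q) (Z q))"
      using s sV by (simp add: D_phi fun_eq_iff)
    ultimately show ?thesis
      using s sU sV by (simp add: D_add_right smooth_phi smooth_D D_phi par)
  qed
  have "curvature_at A D p u v (\<phi> p w) - \<phi> p (curvature_at A D p u v w)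
      = D X (\<lambda>q. dphi q (Y q) (Z q)) p - D Y (\<lambda>q. dphi q (X q) (Z q)) p"
    using curvature_parallel[OF X(1) Y(1) smooth_phi[OF s(3)]] curvature_parallel[OF X(1) Y(1) s(3)]
      curvature_tensorial[OF s(1,2) smooth_phi[OF s(3)], of p] curvature_tensorial[OF s(1,2,3), of p]
    by (simp add: DDphi X Y Z)
  then show "curvature_at A D p u v (\<phi> p w) - \<phi> p (curvature_at A D p u v w) =
      (g p (dxi p u) v *\<^sub>R \<phi> p (dxi p w) + \<eta> p v *\<^sub>R (\<phi> p (ddxi p u w) + dphi p u (dxi p w))
        - g p (dxi p u) w *\<^sub>R \<phi> p (dxi p v) - \<eta> p w *\<^sub>R (\<phi> p (ddxi p u v) + dphi p u (dxi p v))
        + g p (\<phi> p (ddxi p u v) + dphi p u (dxi p v)) w *\<^sub>R \<xi> p + g p (\<phi> p (dxi p v)) w *\<^sub>R dxi p u)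
      - (g p (dxi p v) u *\<^sub>R \<phi> p (dxi p w) + \<eta> p u *\<^sub>R (\<phi> p (ddxi p v w) + dphi p v (dxi p w))
        - g p (dxi p v) w *\<^sub>R \<phi> p (dxi p u) - \<eta> p w *\<^sub>R (\<phi> p (ddxi p v u) + dphi p v (dxi p u))
        + g p (\<phi> p (ddxi p v u) + dphi p v (dxi p u)) w *\<^sub>R \<xi> p + g p (\<phi> p (dxi p u)) w *\<^sub>R dxi p v)"
    by (simp only: D_dphi_parallel X Y Z)
qed

subsection \<open>The Einstein condition\<close>

lemma G_dxi: "g p (dxi p u) (dxi p v) = - g p (dxi p (dxi p u)) v"
  using G_h[of p "dxi p u" v] by simp

text \<open>By \<open>H_eq\<close>, for Y orthogonal to \<xi> at \<open>p\<close> the derivative of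
  h Y there is a multiple of \<xi>, to which h Y is orthogonal. So |h Y|^2 is stationary at
  \<open>p\<close>.\<close>

lemma D_dxi_parallel_orthogonal:
  assumes X: "smooth_vf A X" and Y: "parallel_at p Y" "\<eta> p (Y p) = 0"
  shows "g p (D X (\<lambda>q. dxi q (Y q)) p) (dxi p (Y p)) = 0"
  using assms by (simp add: D_dxi parallel_at_smooth parallel_at_D H_eq G_xi_left)

text \<open>The squares of the eigenvalues of \<open>\<nabla>\<xi>\<close> on \<open>ker \<eta>\<close> all equal \<open>- \<lambda>\<^sup>2\<close>; it is \<open>\<lambda>\<^sup>2\<close> that is defined here.\<close>

definition lambda_sq :: "'a \<Rightarrow> real" where
  "lambda_sq p = (SOME m. m \<ge> 0 \<and> (\<forall>u. dxi p (dxi p u) = - m *\<^sub>R (u - \<eta> p u *\<^sub>R \<xi> p)))"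

lemma lambda_sq_nonneg: "lambda_sq p \<ge> 0" and dxi_dxi: "dxi p (dxi p u) = - lambda_sq p *\<^sub>R (u - \<eta> p u *\<^sub>R \<xi> p)"
proof -
  have "\<exists>m\<ge>0. \<forall>u. dxi p (dxi p u) = - m *\<^sub>R (u - \<eta> p u *\<^sub>R \<xi> p)"
    using h_h[of p] by metis
  then have "lambda_sq p \<ge> 0 \<and> (\<forall>u. dxi p (dxi p u) = - lambda_sq p *\<^sub>R (u - \<eta> p u *\<^sub>R \<xi> p))"
    unfolding lambda_sq_def by (rule someI_ex)
  then show "lambda_sq p \<ge> 0" "dxi p (dxi p u) = - lambda_sq p *\<^sub>R (u - \<eta> p u *\<^sub>R \<xi> p)"
    by blast+
qed

text \<open>As \<lambda>^2 is chosen pointwise, it is represented near \<open>p\<close> as the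
  quotient of the smooth functions |h Y|^2 and |\<phi> Y|^2, with \<open>Y\<close> parallel at
  \<open>p\<close>. The denominator is 1 at \<open>p\<close>, and both functions are stationary
  there.\<close>

lemma lambda_sq_has_derivative_0:
  assumes c: "c \<in> A" "p \<in> fst c"
  shows "(lambda_sq \<circ> chart_inv c has_derivative (\<lambda>v. 0)) (at (snd c p))"
proof -
  let ?x = "snd c p"
  have x: "?x \<in> chart_image c" by (rule chart_mem_image[OF c(2)])
  obtain e where e: "g p e e = 1" "\<eta> p e = 0" by (rule ex_unit_horizontal)
  obtain Y where Y: "parallel_at p Y" "Y p = e" by (rule ex_parallel_at)
  note sY = parallel_at_smooth[OF Y(1)]
  define f1 f2 where "f1 = (\<lambda>q. g q (dxi q (Y q)) (dxi q (Y q)))"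
    and "f2 = (\<lambda>q. g q (Y q) (Y q) - \<eta> q (Y q) * \<eta> q (Y q))"
  have f2_eq: "f2 = (\<lambda>q. g q (\<phi> q (Y q)) (\<phi> q (Y q)))"
    by (simp add: f2_def G_phi_phi)
  then have smooth: "smooth_fun A f1" "smooth_fun A f2"
    unfolding f1_def by (simp_all add: smooth_metric smooth_dxi smooth_phi sY)
  have f12: "f1 q = lambda_sq q * f2 q" for q
    by (simp add: f1_def f2_def G_dxi dxi_dxi G_xi_left)
  have f2p: "f2 p = 1" using e Y by (simp add: f2_def)
  have d0: "vf_deriv A V f1 p = 0" "vf_deriv A V f2 p = 0" if V: "smooth_vf A V" for V
  proof -
    have "vf_deriv A V f1 p = 2 * g p (D V (\<lambda>q. dxi q (Y q)) p) (dxi p (Y p))"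
      unfolding f1_def using V sY by (simp add: metric_compatible smooth_dxi G_sym)
    then show "vf_deriv A V f1 p = 0"
      using D_dxi_parallel_orthogonal[OF V Y(1)] e Y by simp
    have "vf_deriv A V f2 p = 2 * g p (D V (\<lambda>q. \<phi> q (Y q)) p) (\<phi> p (Y p))"
      unfolding f2_eq using V sY by (simp add: metric_compatible smooth_phi G_sym)
    also have "\<dots> = 0"
      using V sY e Y by (simp add: D_phi parallel_at_D T_eq G_xi_left G_phi_phi G_h_self)
    finally show "vf_deriv A V f2 p = 0" .
  qed
  \<comment> \<open>A global field whose components at \<open>p\<close> in the chart
    \<open>c\<close> are \<open>v\<close> turns stationarity along vector fields into a vanishing
    partial derivative.\<close>
  have fd0: "frechet_derivative (f \<circ> chart_inv c) (at ?x) v = 0" if "f \<in> {f1, f2}" for f v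
  proof -
    obtain V where V: "smooth_vf A V" "V p = jac c (ch p) p v" by (rule ex_smooth_vf)
    have "vf_rep A c V ?x = v"
      using c by (simp add: vf_rep_chart V jac_compose jac_self chart_at_in chart_at_mem)
    moreover have "vf_deriv A V f p = 0" "smooth_fun A f"
      using d0[OF V(1)] that smooth by auto
    ultimately show ?thesis using vf_deriv_chart[of f c p V] c by simp
  qed
  have der: "(f \<circ> chart_inv c has_derivative (\<lambda>v. 0)) (at ?x)" if "f \<in> {f1, f2}" for f
  proof (rule has_derivative_eq_rhs)
    show "(f \<circ> chart_inv c has_derivative frechet_derivative (f \<circ> chart_inv c) (at ?x)) (at ?x)"
      by (rule smooth_on_has_derivative[OF smooth_funD[OF _ c(1)] x]) (use that smooth in auto)
  qed (use fd0[OF that] in blast)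
  let ?F = "\<lambda>f. f \<circ> chart_inv c"
  have inv: "chart_inv c ?x = p" by (rule chart_inv_chart[OF c])
  define U where "U = {x \<in> chart_image c. ?F f2 x \<noteq> 0}"
  have U: "open U"
  proof -
    have "continuous_on (chart_image c) (?F f2)"
      by (rule smooth_on_continuous_on[OF smooth_funD[OF smooth(2) c(1)]])
    then have "open (?F f2 -` (- {0}) \<inter> chart_image c)"
      using continuous_on_open_vimage[OF chart_open(2)[OF c(1)]] open_Compl[OF closed_singleton] by blast
    moreover have "U = ?F f2 -` (- {0}) \<inter> chart_image c" by (auto simp: U_def)
    ultimately show ?thesis by simp
  qed
  have xU: "?x \<in> U" using x by (simp add: U_def inv f2p)
  have "((\<lambda>x. ?F f1 x / ?F f2 x) has_derivative (\<lambda>v. 0)) (at ?x)"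
    using has_derivative_divide[OF der[of f1] der[of f2]] by (simp add: inv f2p)
  then show ?thesis
    by (rule has_derivative_transform_within_open[OF _ U xU]) (auto simp: U_def f12)
qed

lemma lambda_sq_constant:
  assumes "connected (UNIV :: 'a set)"
  obtains m where "\<And>p. lambda_sq p = m"
proof -
  have "lambda_sq constant_on UNIV"
  proof (rule locally_constant_imp_constant[OF assms])
    fix p
    let ?c = "ch p"
    have c: "?c \<in> A" "p \<in> fst ?c" by (rule chart_at_in chart_at_mem)+
    obtain r where r: "0 < r" "ball (snd ?c p) r \<subseteq> chart_image ?c"
      using openE[OF chart_open(2)[OF c(1)] chart_mem_image[OF c(2)]] by blast
    have "(lambda_sq \<circ> chart_inv ?c) x = (lambda_sq \<circ> chart_inv ?c) (snd ?c p)" if x: "x \<in> ball (snd ?c p) r" for x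
    proof (rule has_derivative_zero_unique[OF convex_ball _ x])
      show "snd ?c p \<in> ball (snd ?c p) r" using r by simp
      fix y assume "y \<in> ball (snd ?c p) r"
      then have "y \<in> chart_image ?c" using r by blast
      then obtain q where "q \<in> fst ?c" "y = snd ?c q" by (rule chart_image_cases[OF c(1)])
      then show "(lambda_sq \<circ> chart_inv ?c has_derivative (\<lambda>h. 0)) (at y within ball (snd ?c p) r)"
        using lambda_sq_has_derivative_0[OF c(1)] has_derivative_at_withinI by blast
    qed
    then have const: "lambda_sq q = lambda_sq p" if "q \<in> fst ?c" "snd ?c q \<in> ball (snd ?c p) r" for q
      using that c by (metis chart_inv_chart comp_apply)
    let ?T = "snd ?c -` ball (snd ?c p) r \<inter> fst ?c"
    have "open ?T"
      using continuous_on_chart[OF c(1)] chart_open(1)[OF c(1)] by (simp add: continuous_on_open_vimage)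
    then have "openin (top_of_set UNIV) ?T" by simp
    moreover have "p \<in> ?T" using c r by simp
    moreover have "\<forall>x\<in>?T. lambda_sq x = lambda_sq p" using const by blast
    ultimately show "\<exists>T. openin (top_of_set UNIV) T \<and> p \<in> T \<and> (\<forall>x\<in>T. lambda_sq x = lambda_sq p)"
      by blast
  qed
  then show thesis using that by (auto simp: constant_on_def)
qed

lemma dxi_0_imp_coKaehler:
  assumes "\<And>p u. dxi p u = 0"
  shows "coKaehler A \<phi> D"
  by (simp add: coKaehler_def cov_deriv_tensorial T_eq assms)

text \<open>The Ricci identity for \<open>h\<close>: with \<lambda>^2 constant, \<open>H_eq\<close>
  becomes an explicit formula in \<eta>, g and \<xi>, whose only derivatives are those of \<eta> and
  \<xi>, both given by \<open>h\<close>.\<close>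

lemma curvature_dxi:
  assumes lambda_sq: "\<And>p. lambda_sq p = m"
  shows "curvature_at A D p u v (dxi p w) - dxi p (curvature_at A D p u v w) =
    m *\<^sub>R (g p (dxi p u) w *\<^sub>R v - g p v w *\<^sub>R dxi p u)
    - m *\<^sub>R (g p (dxi p v) w *\<^sub>R u - g p u w *\<^sub>R dxi p v)"
proof -
  obtain X where X: "parallel_at p X" "X p = u" by (rule ex_parallel_at)
  obtain Y where Y: "parallel_at p Y" "Y p = v" by (rule ex_parallel_at)
  obtain Z where Z: "parallel_at p Z" "Z p = w" by (rule ex_parallel_at)
  note s = X(1)[THEN parallel_at_smooth] Y(1)[THEN parallel_at_smooth] Z(1)[THEN parallel_at_smooth]
  note par = parallel_at_D[OF X(1)] parallel_at_D[OF Y(1)] parallel_at_D[OF Z(1)]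
  have H: "ddxi q a b = m *\<^sub>R (\<eta> q b *\<^sub>R a - g q a b *\<^sub>R \<xi> q)" for q a b
    by (simp add: H_eq dxi_dxi lambda_sq G_xi_left algebra_simps)
  have DD: "D U (D V (\<lambda>q. dxi q (Z q))) p = dxi p (D U (D V Z) p)
      + m *\<^sub>R (g p (dxi p (U p)) w *\<^sub>R V p - g p (V p) w *\<^sub>R dxi p (U p))"
    if "parallel_at p U" "parallel_at p V" for U V
  proof -
    note sU = parallel_at_smooth[OF that(1)] and sV = parallel_at_smooth[OF that(2)]
    have sm: "smooth_vf A (\<lambda>q. \<eta> q (Z q) *\<^sub>R V q)" "smooth_vf A (\<lambda>q. g q (V q) (Z q) *\<^sub>R \<xi> q)"
      by (intro smooth_vf_scale smooth_eta smooth_metric smooth_xi s sV)+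
    have "D V (\<lambda>q. dxi q (Z q)) = (\<lambda>q. dxi q (D V Z q) + m *\<^sub>R (\<eta> q (Z q) *\<^sub>R V q - g q (V q) (Z q) *\<^sub>R \<xi> q))"
      using s sV by (simp add: D_dxi H fun_eq_iff)
    then have "D U (D V (\<lambda>q. dxi q (Z q))) p = D U (\<lambda>q. dxi q (D V Z q)) p
        + m *\<^sub>R (D U (\<lambda>q. \<eta> q (Z q) *\<^sub>R V q) p - D U (\<lambda>q. g q (V q) (Z q) *\<^sub>R \<xi> q) p)"
      using s sU sV sm
      by (simp only: D_add_right D_cscale_right D_diff_right smooth_vf_diff smooth_vf_cscale smooth_dxi smooth_D)
    also have "D U (\<lambda>q. dxi q (D V Z q)) p = dxi p (D U (D V Z) p)"
      using s sU sV by (simp add: D_dxi smooth_D par H)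
    also have "D U (\<lambda>q. \<eta> q (Z q) *\<^sub>R V q) p = g p (dxi p (U p)) w *\<^sub>R V p"
      using s sU sV by (simp add: D_scale_right smooth_eta vf_deriv_eta Z parallel_at_D[OF that(2)])
    also have "D U (\<lambda>q. g q (V q) (Z q) *\<^sub>R \<xi> q) p = g p (V p) w *\<^sub>R dxi p (U p)"
      using s sU sV by (simp add: D_scale_right smooth_metric smooth_xi metric_compatible par Z
          parallel_at_D[OF that(2)] D_xi)
    finally show ?thesis .
  qed
  show ?thesis
    using curvature_parallel[OF X(1) Y(1) smooth_dxi[OF s(3)]] curvature_parallel[OF X(1) Y(1) s(3)]
      curvature_tensorial[OF s(1,2) smooth_dxi[OF s(3)], of p] curvature_tensorial[OF s(1,2,3), of p]
    by (simp add: DD X Y Z)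
qed

lemma ex_einstein_constant:
  assumes "connected (UNIV :: 'a set)" and "\<not> coKaehler A \<phi> D"
  obtains m where "m > 0" "\<And>p v w. ricci A D p v w = 4 * m * g p v w"
proof -
  obtain m where m: "\<And>p. lambda_sq p = m" by (rule lambda_sq_constant[OF assms(1)]) blast
  have "m \<noteq> 0"
  proof
    assume "m = 0"
    then have "g p (dxi p u) (dxi p u) = 0" for p u
      by (simp add: G_dxi dxi_dxi m)
    then have "dxi p u = 0" for p u using G_pos by (metis less_irrefl)
    then show False using dxi_0_imp_coKaehler assms(2) by blast
  qed
  moreover have "m \<ge> 0" using lambda_sq_nonneg m by metis
  ultimately have "m > 0" by simp
  show thesis
  proof (rule that[OF \<open>m > 0\<close>])
    fix p v w
    interpret E: nearly_cosymplectic_einstein "g p" "\<phi> p" "\<xi> p" "\<eta> p" "dxi p" "dphi p"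
      "curvature_at A D p" "ddxi p" m
    proof
      show "m > 0" by fact
      show "dxi p (dxi p u) = - m *\<^sub>R (u - \<eta> p u *\<^sub>R \<xi> p)" for u
        using dxi_dxi[of p u] m by simp
    qed (rule curvature_dxi[OF m])
    show "ricci A D p v w = 4 * m * g p v w"
      using E.ric_eq[of v w] by (simp add: E.ric_def ricci_def)
  qed
qed

end

section \<open>Contraction of a multiple of the metric with the inverse metric\<close>

lemma (in euclidean_form) invertible_gram: "invertible (gram G)"
proof -
  have "x = 0" if "gram G *v x = 0" for x
  proof -
    have x: "x = (\<Sum>i\<in>UNIV. x $ i *\<^sub>R axis i 1)"
      using basis_expansion[of x] by (simp add: scalar_mult_eq_scaleR)
    have "G (axis i 1) x = (\<Sum>j\<in>UNIV. x $ j * G (axis i 1) (axis j 1))" for i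
    proof -
      have "G (axis i 1) x = G (\<Sum>j\<in>UNIV. x $ j *\<^sub>R axis j 1) (axis i 1)"
        using x G_sym by metis
      also have "\<dots> = (\<Sum>j\<in>UNIV. x $ j * G (axis j 1) (axis i 1))"
        by (simp add: G_sum_left)
      also have "\<dots> = (\<Sum>j\<in>UNIV. x $ j * G (axis i 1) (axis j 1))"
        by (intro sum.cong refl) (metis G_sym)
      finally show ?thesis .
    qed
    then have "G (axis i 1) x = 0" for i
      using that by (simp add: vec_eq_iff matrix_vector_mult_def gram_def mult.commute)
    then have "G x x = 0"
      by (subst x) (simp only: G_sum_left, simp)
    then show "x = 0" using G_pos[of x] by (metis less_irrefl)
  qed
  then show ?thesis
    using matrix_left_invertible_ker[of "gram G"] by (simp add: invertible_left_inverse)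
qed

lemma (in euclidean_form) trace_gram_multiple:
  assumes "\<And>v w. r v w = k * G v w"
  shows "trace (matrix_inv (gram G) ** gram r) = k * CARD('n)"
proof -
  have inv: "matrix_inv (gram G) ** gram G = mat 1"
    using someI_ex[OF invertible_gram[unfolded invertible_def]] by (simp add: matrix_inv_def)
  have "gram r = k *\<^sub>R gram G"
    by (simp add: gram_def assms vec_eq_iff)
  then have "matrix_inv (gram G) ** gram r = k *\<^sub>R mat 1"
    using inv by (simp add: matrix_scalar_ac flip: scalar_matrix_assoc)
  then show ?thesis by (simp add: trace_def mat_def)
qed

theorem theorem5p4:
  fixes A :: "('a::{t2_space, second_countable_topology}, 5) chart set"
    and \<phi> :: "'a \<Rightarrow> real ^ 5 \<Rightarrow> real ^ 5"
    and \<xi> :: "'a \<Rightarrow> real ^ 5"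
    and \<eta> :: "'a \<Rightarrow> real ^ 5 \<Rightarrow> real"
    and g :: "'a \<Rightarrow> real ^ 5 \<Rightarrow> real ^ 5 \<Rightarrow> real"
    and D :: "('a, 5) connection"
  assumes "smooth_manifold A"
    and "connected (UNIV :: 'a set)"
    and "almost_contact_metric A \<phi> \<xi> \<eta> g"
    and "levi_civita A g D"
    and "nearly_cosymplectic A \<phi> D"
    and "\<not> coKaehler A \<phi> D"
  shows "einstein A g D \<and> (\<forall>p. scalar_curvature A g D p > 0)"
proof -
  have "riemannian_metric A g"
    using assms(3) by (simp add: almost_contact_metric_def)
  with assms interpret nearly_cosymplectic_manifold A g D \<phi> \<xi> \<eta>
    by unfold_locales
  obtain m where m: "m > 0" "\<And>p v w. ricci A D p v w = 4 * m * g p v w"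
    by (rule ex_einstein_constant[OF assms(2,6)]) blast
  \<comment> \<open>The factor 5 is the trace of the identity matrix.\<close>
  have "scalar_curvature A g D p = 4 * m * 5" for p
    using trace_gram_multiple[of "ricci A D p" "4 * m" p] m(2) by (simp add: scalar_curvature_def)
  then show ?thesis using m by (auto simp: einstein_def)
qed

end
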